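(* Let $\lambda,\mu,\nu\vdash n$ with $\lambda_1\le\mu_1\le\nu_1$, and set $s=n-\nu_1$. Let $k\ge 1$ be an integer such that $$ \min\{\lambda_k,\mu_k\}\ \ge\ \max\{\lambda_{k+1},\mu_{k+1}\}+s. $$ Then for all integers $t\ge 0$, $$ g(\lambda,\mu,\nu)\ =\ g\bigl(\lambda+(t^k),\ \mu+(t^k),\ \nu+(tk)\bigr). $$
   Context: Partitions are written $\lambda=(\lambda_1\ge\lambda_2\ge\cdots)$ with $\lambda_i=0$ for $i$ beyond the length. Partitions are added as vectors: $\alpha+\beta=(\alpha_1+\beta_1,\alpha_2+\beta_2,\ldots)$. $(t^k)$ is the partition with $k$ parts equal to $t$, and $(tk)$ is the one-part partition with part $tk$. The Kronecker coefficient $g(\alpha,\beta,\gamma)$ for $\alpha,\beta,\gamma\vdash N$ is the multiplicity of $\chi^\gamma$ in $\chi^\alpha\otimes\chi^\beta$, where $\chi^\alpha$ is the irreducible character of $S_N$ indexed by $\alpha$. *)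

theory Defs
  imports Complex_Main "HOL-Library.Function_Algebras" "HOL-Combinatorics.Permutations"
begin

text \<open>
  A partition is the full sequence of its parts, indexed from 0: the part usually written
  \<open>\<alpha>\<^sub>i\<close> is \<open>\<alpha> (i - 1)\<close>. The vector sum of two partitions is the pointwise sum of
  functions, i.e. \<open>+\<close> from \<open>HOL-Library.Function_Algebras\<close>.
\<close>

type_synonym parts = "nat \<Rightarrow> nat"

definition psize :: "parts \<Rightarrow> nat" where
  "psize \<alpha> = (\<Sum>i | \<alpha> i \<noteq> 0. \<alpha> i)"

definition partitions :: "nat \<Rightarrow> parts set" where
  "partitions n = {\<alpha>. antimono \<alpha> \<and> finite {i. \<alpha> i \<noteq> 0} \<and> psize \<alpha> = n}"

definition rectangle :: "nat \<Rightarrow> nat \<Rightarrow> parts" where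
  "rectangle t k = (\<lambda>i. if i < k then t else 0)"

abbreviation one_part :: "nat \<Rightarrow> parts" where
  "one_part m \<equiv> rectangle m 1"

text \<open>The complex vector space of all functions \<open>'a \<Rightarrow> complex\<close>.\<close>

definition scale_fun :: "complex \<Rightarrow> ('a \<Rightarrow> complex) \<Rightarrow> 'a \<Rightarrow> complex" where
  "scale_fun c f = (\<lambda>x. c * f x)"

global_interpretation cfun: vector_space scale_fun
  by standard (simp_all add: scale_fun_def fun_eq_iff algebra_simps)

text \<open>
  The trace of a linear endomorphism \<open>F\<close> of a finite-dimensional subspace \<open>V\<close>;
  it does not depend on the basis \<open>B\<close> of \<open>V\<close>.
\<close>

definition trace_on :: "('a \<Rightarrow> complex) set \<Rightarrow> (('a \<Rightarrow> complex) \<Rightarrow> 'a \<Rightarrow> complex) \<Rightarrow> complex" where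
  "trace_on V F =
    (let B = (SOME B. cfun.independent B \<and> cfun.span B = V)
     in \<Sum>b\<in>B. cfun.representation B (F b) b)"

text \<open>
  The irreducible character of the symmetric group on \<open>{1..N}\<close> indexed by \<open>\<alpha>\<close> is the
  character of the Specht module. A tableau maps each entry to its box (row, column);
  a tabloid, that is, a tableau up to reordering within rows, maps each entry to its row.
  The convention is such that \<open>(N)\<close> gives the trivial and \<open>(1\<^sup>N)\<close> the sign character.
\<close>

definition diagram :: "parts \<Rightarrow> (nat \<times> nat) set" where
  "diagram \<alpha> = {(i, j). j < \<alpha> i}"

definition tableaux :: "parts \<Rightarrow> (nat \<Rightarrow> nat \<times> nat) set" where
  "tableaux \<alpha> = {T. bij_betw T {1..psize \<alpha>} (diagram \<alpha>)}"

definition tabloid :: "parts \<Rightarrow> (nat \<Rightarrow> nat \<times> nat) \<Rightarrow> nat \<Rightarrow> nat" where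
  "tabloid \<alpha> T = restrict (fst \<circ> T) {1..psize \<alpha>}"

definition column_group :: "parts \<Rightarrow> (nat \<Rightarrow> nat \<times> nat) \<Rightarrow> (nat \<Rightarrow> nat) set" where
  "column_group \<alpha> T =
    {q. q permutes {1..psize \<alpha>} \<and> (\<forall>i\<in>{1..psize \<alpha>}. snd (T (q i)) = snd (T i))}"

text \<open>
  The polytabloid is the signed sum of the tabloids of \<open>q \<cdot> T = T \<circ> inv q\<close>, in the space of
  functions on tabloids.
\<close>

definition polytabloid :: "parts \<Rightarrow> (nat \<Rightarrow> nat \<times> nat) \<Rightarrow> (nat \<Rightarrow> nat) \<Rightarrow> complex" where
  "polytabloid \<alpha> T =
    (\<lambda>r. \<Sum>q\<in>column_group \<alpha> T. of_int (sign q) * of_bool (r = tabloid \<alpha> (T \<circ> inv q)))"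

definition specht :: "parts \<Rightarrow> ((nat \<Rightarrow> nat) \<Rightarrow> complex) set" where
  "specht \<alpha> = cfun.span (polytabloid \<alpha> ` tableaux \<alpha>)"

text \<open>
  A permutation \<open>\<sigma>\<close> sends the tabloid \<open>r\<close> to \<open>r \<circ> inv \<sigma>\<close>, hence the function \<open>f\<close> on
  tabloids to \<open>\<lambda>r. f (r \<circ> \<sigma>)\<close>.
\<close>

definition irr_char :: "parts \<Rightarrow> (nat \<Rightarrow> nat) \<Rightarrow> complex" where
  "irr_char \<alpha> \<sigma> = trace_on (specht \<alpha>) (\<lambda>f r. f (r \<circ> \<sigma>))"

text \<open>
  The multiplicity of \<open>irr_char \<gamma>\<close> in a character \<open>\<psi>\<close> of the symmetric group on
  \<open>{1..N}\<close>, for \<open>\<gamma> \<in> partitions N\<close>: its coefficient in the decomposition of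
  \<open>\<psi>\<close> into irreducible characters.
\<close>

definition char_multiplicity :: "nat \<Rightarrow> ((nat \<Rightarrow> nat) \<Rightarrow> complex) \<Rightarrow> parts \<Rightarrow> nat" where
  "char_multiplicity N \<psi> \<gamma> =
    (THE c. \<exists>m. m \<gamma> = c \<and>
      (\<forall>\<sigma>. \<sigma> permutes {1..N} \<longrightarrow> \<psi> \<sigma> = (\<Sum>\<delta>\<in>partitions N. of_nat (m \<delta>) * irr_char \<delta> \<sigma>)))"

definition kronecker :: "parts \<Rightarrow> parts \<Rightarrow> parts \<Rightarrow> nat" where
  "kronecker \<alpha> \<beta> \<gamma> =
    char_multiplicity (psize \<gamma>) (\<lambda>\<sigma>. irr_char \<alpha> \<sigma> * irr_char \<beta> \<sigma>) \<gamma>"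

end

theory Submission
  imports Defs "HOL-Library.Nat_Bijection"
begin

text \<open>
  By the Jacobi-Trudi formula an irreducible character of the symmetric group is an alternating sum
  of characters \<open>phi\<close> of permutation modules on set partitions with prescribed block sizes. Hence
  \<open>g(\<lambda>, \<mu>, \<nu>)\<close> is a signed count of three-dimensional contingency tables whose margins are
  \<open>\<lambda> + \<delta> - u\<delta>\<close>, \<open>\<mu> + \<delta> - v\<delta>\<close>, \<open>\<nu> + \<delta> - w\<delta>\<close>, where \<open>\<delta> = (L - 1, \<dots>, 1, 0)\<close>. Fix \<open>w\<close> and all
  slices of the table in the third direction except the first one. These slices have total at most
  \<open>s\<close>; let \<open>p\<close>, \<open>q\<close> be their margins. The signed count of the possible first slices is, by
  orthonormality of the irreducible characters, \<open>0\<close> unless \<open>\<lambda> + \<delta> - p\<close> and \<open>\<mu> + \<delta> - q\<close> are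
  rearrangements of one another, and otherwise the sign of the rearrangement. Because of the gap of
  size \<open>s\<close> after row \<open>k\<close>, the first \<open>k\<close> entries of either vector exceed all later ones, so raising
  them by \<open>t\<close> changes nothing, while adding \<open>tk\<close> to \<open>\<nu>\<^sub>1\<close> only affects the margin of the first slice.

  That the determinantal character \<open>\<psi>\<close> and the character \<open>\<chi>\<close> of the Specht module agree follows from
  \<open>\<langle>\<chi>, \<chi>\<rangle> \<le> 1\<close> and \<open>\<langle>\<chi>, \<psi>\<rangle> = \<langle>\<psi>, \<psi>\<rangle> = 1\<close>, which give \<open>\<parallel>\<chi> - \<psi>\<parallel>\<^sup>2 \<le> 0\<close>.
\<close>

section \<open>Permutation characters\<close>

text \<open>\<open>char_multiplicity\<close> is a definite description over decompositions with
  natural coefficients, so the signed count says something about it only once such a decomposition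
  is known to exist and to be unique. Uniqueness is orthonormality. Integer coefficients come from
  triangularity: every \<open>phi\<close> is an integer combination of the \<open>psi\<close> of
  partitions, and a product of two \<open>phi\<close> is a sum of \<open>phi\<close>. Nonnegativity
  comes from representations: the average of a matrix representation is idempotent, so its trace is
  a natural number. The same fact bounds \<langle>\<chi>, \<chi>\<rangle>, because \<phi> - \<chi>
  is the character of a quotient module.

  Orthonormality of the determinants cannot be borrowed from the \<chi>, whose identification with
  them relies on it; it is proved by sign-reversing exchanges on tables. It must moreover be usable
  for vectors not of the form \<alpha> + \<delta>: removing slices destroys the order of the
  entries, so that such vectors have to be sorted before they can be compared.\<close>

declare One_nat_def [simp del]

text \<open>
  Contents are integer valued, so that terms of a determinant with a negative entry vanish
  without a case distinction.
\<close>

definition fillings :: "nat \<Rightarrow> ('k \<Rightarrow> int) \<Rightarrow> (nat \<Rightarrow> 'k) set" where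
  "fillings N a = {h \<in> extensional {1..N}. \<forall>k. int (card {x \<in> {1..N}. h x = k}) = a k}"

definition fixed_fillings :: "nat \<Rightarrow> ('k \<Rightarrow> int) \<Rightarrow> (nat \<Rightarrow> nat) \<Rightarrow> (nat \<Rightarrow> 'k) set" where
  "fixed_fillings N a \<sigma> = {h \<in> fillings N a. h \<circ> \<sigma> = h}"

text \<open>The index type is arbitrary because a product of two such characters is expressed
  through contents indexed by pairs. A content with a negative entry admits no filling, so
  \<open>phi\<close> is 0 there.\<close>

definition phi :: "nat \<Rightarrow> ('k \<Rightarrow> int) \<Rightarrow> (nat \<Rightarrow> nat) \<Rightarrow> int" where
  "phi N a \<sigma> = int (card (fixed_fillings N a \<sigma>))"

definition perms :: "nat \<Rightarrow> (nat \<Rightarrow> nat) set" where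
  "perms N = {\<sigma>. \<sigma> permutes {1..N}}"

lemma finite_perms [simp]: "finite (perms N)"
  unfolding perms_def by (rule finite_permutations) simp

lemma card_perms [simp]: "card (perms N) = fact N"
  unfolding perms_def by (rule card_permutations) auto

lemma perms_compose: "\<sigma> \<in> perms N \<Longrightarrow> \<tau> \<in> perms N \<Longrightarrow> \<sigma> \<circ> \<tau> \<in> perms N"
  unfolding perms_def by (simp add: permutes_compose)

lemma perms_inv: "\<sigma> \<in> perms N \<Longrightarrow> inv \<sigma> \<in> perms N"
  unfolding perms_def by (simp add: permutes_inv)

lemma sum_perms_compose_left:
  assumes "\<tau> \<in> perms N"
  shows "(\<Sum>\<sigma>\<in>perms N. f (\<tau> \<circ> \<sigma>)) = (\<Sum>\<sigma>\<in>perms N. f \<sigma>)"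
  using assms unfolding perms_def
  by (intro sum.reindex_bij_witness[where j = "\<lambda>\<sigma>. \<tau> \<circ> \<sigma>" and i = "\<lambda>\<sigma>. inv \<tau> \<circ> \<sigma>"])
    (auto simp: permutes_compose permutes_inv o_assoc permutes_inv_o)

lemma fillings_extensional: "h \<in> fillings N a \<Longrightarrow> h \<in> extensional {1..N}"
  by (simp add: fillings_def)

lemma fillings_card: "h \<in> fillings N a \<Longrightarrow> int (card {x \<in> {1..N}. h x = k}) = a k"
  by (simp add: fillings_def)

lemma fillings_support: "h \<in> fillings N a \<Longrightarrow> {k. a k \<noteq> 0} = h ` {1..N}"
proof -
  assume h: "h \<in> fillings N a"
  have "a k \<noteq> 0 \<longleftrightarrow> k \<in> h ` {1..N}" for k
  proof -
    have "a k \<noteq> 0 \<longleftrightarrow> {x \<in> {1..N}. h x = k} \<noteq> {}"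
      unfolding fillings_card[OF h, of k, symmetric] by simp
    then show ?thesis by blast
  qed
  then show ?thesis by blast
qed

lemma finite_fillings [simp]: "finite (fillings N a)"
proof (cases "fillings N a = {}")
  case False
  then obtain h0 where h0: "h0 \<in> fillings N a" by auto
  have "fillings N a \<subseteq> {1..N} \<rightarrow>\<^sub>E {k. a k \<noteq> 0}"
    using fillings_support[of _ N a] by (auto simp: PiE_def fillings_extensional)
  moreover have "finite {k. a k \<noteq> 0}" using fillings_support[OF h0] by simp
  ultimately show ?thesis by (meson finite_PiE finite_atLeastAtMost finite_subset)
qed simp

lemma finite_fixed_fillings [simp]: "finite (fixed_fillings N a \<sigma>)"
  by (simp add: fixed_fillings_def)

lemma extensional_compose_permutes:
  "h \<in> extensional A \<Longrightarrow> \<sigma> permutes A \<Longrightarrow> h \<circ> \<sigma> \<in> extensional A"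
  by (auto simp: extensional_def permutes_not_in)

lemma card_fibre_compose:
  assumes "\<sigma> permutes A"
  shows "card {x \<in> A. (h \<circ> \<sigma>) x = k} = card {x \<in> A. h x = k}"
proof -
  have "\<sigma> ` {x \<in> A. (h \<circ> \<sigma>) x = k} = {y \<in> \<sigma> ` A. h y = k}" by auto
  then have "{x \<in> A. h x = k} = \<sigma> ` {x \<in> A. (h \<circ> \<sigma>) x = k}"
    by (simp only: permutes_image[OF assms])
  moreover have "inj_on \<sigma> {x \<in> A. (h \<circ> \<sigma>) x = k}" using permutes_inj_on[OF assms] by blast
  ultimately show ?thesis by (simp only: card_image)
qed

lemma fillings_compose:
  assumes "h \<in> fillings N a" "\<sigma> \<in> perms N"
  shows "h \<circ> \<sigma> \<in> fillings N a"
  using assms card_fibre_compose[of \<sigma> "{1..N}" h]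
  by (auto simp: fillings_def perms_def extensional_compose_permutes)

text \<open>Equal contents mean equal multisets of values, and two functions with equal image
  multisets differ by a permutation of the domain. So the symmetric group has a single orbit on the
  fillings of a given content.\<close>

lemma fillings_transitive:
  assumes "h \<in> fillings N a" "h' \<in> fillings N a"
  obtains p where "p \<in> perms N" "h' = h \<circ> p"
proof -
  have cnt: "count (image_mset g (mset_set {1..N})) k = card {x \<in> {1..N}. g x = k}" for g :: "nat \<Rightarrow> 'a" and k
    by (simp add: count_image_mset vimage_def Int_def conj_commute)
  have "image_mset h' (mset_set {1..N}) = image_mset h (mset_set {1..N})"
  proof (rule multiset_eqI)
    fix k show "count (image_mset h' (mset_set {1..N})) k = count (image_mset h (mset_set {1..N})) k"
      unfolding cnt using fillings_card[OF assms(1), of k] fillings_card[OF assms(2), of k] by simp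
  qed
  then obtain p where p: "p permutes {1..N}" "\<forall>x\<in>{1..N}. h' x = h (p x)"
    using image_mset_eq_implies_permutes[of "{1..N}" h' h] by auto
  have "h' = h \<circ> p"
  proof
    fix x show "h' x = (h \<circ> p) x"
      using p assms by (cases "x \<in> {1..N}")
        (auto simp: permutes_not_in fillings_def extensional_def simp del: atLeastAtMost_iff)
  qed
  with p that show thesis by (auto simp: perms_def)
qed

text \<open>For a filling \<open>h\<close> this is the Young subgroup of its blocks.\<close>

definition stabilizer :: "nat \<Rightarrow> (nat \<Rightarrow> 'k) \<Rightarrow> (nat \<Rightarrow> nat) set" where
  "stabilizer N h = {\<sigma> \<in> perms N. h \<circ> \<sigma> = h}"

lemma finite_stabilizer [simp]: "finite (stabilizer N h)"
  by (simp add: stabilizer_def)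

text \<open>Frobenius reciprocity, by double counting the pairs of a permutation and a filling fixed
  by it: pairing with \<open>phi\<close> becomes summing over Young subgroups. The ring is general
  because both integer and complex \<open>f\<close> occur.\<close>

lemma sum_phi_times:
  fixes f :: "(nat \<Rightarrow> nat) \<Rightarrow> 'b :: comm_ring_1"
  shows "(\<Sum>\<sigma>\<in>perms N. f \<sigma> * of_int (phi N a \<sigma>)) = (\<Sum>h\<in>fillings N a. \<Sum>\<sigma>\<in>stabilizer N h. f \<sigma>)"
proof -
  have "(\<Sum>\<sigma>\<in>perms N. f \<sigma> * of_int (phi N a \<sigma>)) = (\<Sum>\<sigma>\<in>perms N. \<Sum>h\<in>fillings N a. if h \<circ> \<sigma> = h then f \<sigma> else 0)"
    by (simp add: phi_def fixed_fillings_def sum.If_cases Int_def conj_commute mult.commute)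
  also have "\<dots> = (\<Sum>h\<in>fillings N a. \<Sum>\<sigma>\<in>perms N. if h \<circ> \<sigma> = h then f \<sigma> else 0)"
    by (rule sum.swap)
  also have "\<dots> = (\<Sum>h\<in>fillings N a. \<Sum>\<sigma>\<in>stabilizer N h. f \<sigma>)"
    by (simp add: stabilizer_def sum.If_cases Int_def)
  finally show ?thesis .
qed

text \<open>Orbit-stabilizer: left multiplication by \<open>p\<close> identifies the stabilizer of
  \<open>h = h0 \<circ> p\<close> with the permutations that carry \<open>h0\<close> to
  \<open>h\<close>, and the latter sets partition the group.\<close>

lemma sum_card_stabilizer:
  assumes "fillings N a \<noteq> {}"
  shows "(\<Sum>h\<in>fillings N a. card (stabilizer N h)) = fact N"
proof -
  obtain h0 where h0: "h0 \<in> fillings N a" using assms by auto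
  have eq: "card (stabilizer N h) = card {\<sigma> \<in> perms N. h0 \<circ> \<sigma> = h}" if h: "h \<in> fillings N a" for h
  proof -
    obtain p where p: "p \<in> perms N" "h = h0 \<circ> p" using fillings_transitive[OF h0 h] by blast
    then have pp: "p permutes {1..N}" by (simp add: perms_def)
    have ip: "inv p \<in> perms N" using p(1) by (rule perms_inv)
    show ?thesis
    proof (rule bij_betw_same_card[of "\<lambda>\<sigma>. p \<circ> \<sigma>"],
        rule bij_betw_byWitness[where f' = "\<lambda>\<sigma>. inv p \<circ> \<sigma>"])
      show "\<forall>\<sigma>\<in>stabilizer N h. inv p \<circ> (p \<circ> \<sigma>) = \<sigma>"
        using permutes_inv_o(2)[OF pp] by (simp add: o_assoc)
      show "\<forall>\<sigma>\<in>{\<sigma> \<in> perms N. h0 \<circ> \<sigma> = h}. p \<circ> (inv p \<circ> \<sigma>) = \<sigma>"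
        using permutes_inv_o(1)[OF pp] by (simp add: o_assoc)
      show "(\<lambda>\<sigma>. p \<circ> \<sigma>) ` stabilizer N h \<subseteq> {\<sigma> \<in> perms N. h0 \<circ> \<sigma> = h}"
        using p perms_compose by (auto simp: stabilizer_def o_assoc)
      show "(\<lambda>\<sigma>. inv p \<circ> \<sigma>) ` {\<sigma> \<in> perms N. h0 \<circ> \<sigma> = h} \<subseteq> stabilizer N h"
        using p ip perms_compose permutes_inv_o(1)[OF pp]
        by (auto simp: stabilizer_def o_assoc) (metis comp_assoc comp_id)
    qed
  qed
  have "(\<Sum>h\<in>fillings N a. card (stabilizer N h)) = (\<Sum>h\<in>fillings N a. card {\<sigma> \<in> perms N. h0 \<circ> \<sigma> = h})"
    by (rule sum.cong) (use eq in auto)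
  also have "\<dots> = card (perms N)"
    using sum_fun_comp[of "perms N" "fillings N a" "\<lambda>\<sigma>. h0 \<circ> \<sigma>" "\<lambda>_. 1::nat"] fillings_compose[OF h0]
    by (simp add: image_subset_iff)
  finally show ?thesis by simp
qed

lemma sum_phi:
  assumes "fillings N a \<noteq> {}"
  shows "(\<Sum>\<sigma>\<in>perms N. phi N a \<sigma>) = fact N"
proof -
  have "(\<Sum>\<sigma>\<in>perms N. phi N a \<sigma>) = (\<Sum>h\<in>fillings N a. int (card (stabilizer N h)))"
    using sum_phi_times[of "\<lambda>_. 1::int" N a] by simp
  also have "\<dots> = int (fact N)" using sum_card_stabilizer[OF assms] by (simp flip: of_nat_sum)
  finally show ?thesis by simp
qed

text \<open>A bijection from \<open>{1..N}\<close> to a disjoint union of blocks of the prescribed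
  sizes, followed by the block index, is a filling.\<close>

lemma fillings_nonempty:
  assumes "finite I" "\<And>k. a k \<ge> 0" "\<And>k. k \<notin> I \<Longrightarrow> a k = 0" "(\<Sum>k\<in>I. a k) = int N"
  shows "fillings N a \<noteq> {}"
proof -
  let ?S = "SIGMA k:I. {..<nat (a k)}"
  have fin: "finite ?S" using assms(1) by auto
  have "int (card ?S) = (\<Sum>k\<in>I. int (nat (a k)))" using assms(1) by (simp add: card_SigmaI)
  also have "\<dots> = int N" using assms by simp
  finally have "card {1..N} = card ?S" by simp
  then obtain f where f: "bij_betw f {1..N} ?S"
    using finite_same_card_bij[OF _ fin] by blast
  have "restrict (fst \<circ> f) {1..N} \<in> fillings N a"
    unfolding fillings_def
  proof (safe)
    fix k
    have im: "f ` {x \<in> {1..N}. (fst \<circ> f) x = k} = {y \<in> f ` {1..N}. fst y = k}" by auto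
    have "inj_on f {x \<in> {1..N}. (fst \<circ> f) x = k}"
      using f unfolding bij_betw_def by (blast intro: inj_on_subset)
    from card_image[OF this] have "card {x \<in> {1..N}. (fst \<circ> f) x = k} = card {y \<in> ?S. fst y = k}"
      using f unfolding im bij_betw_def by simp
    also have "{y \<in> ?S. fst y = k} = (if k \<in> I then {k} \<times> {..<nat (a k)} else {})" by auto
    finally have "int (card {x \<in> {1..N}. (fst \<circ> f) x = k}) = a k"
      using assms(2)[of k] assms(3)[of k] by (simp add: card_cartesian_product split: if_splits)
    moreover have "{x \<in> {1..N}. restrict (fst \<circ> f) {1..N} x = k} = {x \<in> {1..N}. (fst \<circ> f) x = k}"
      by auto
    ultimately show "int (card {x \<in> {1..N}. restrict (fst \<circ> f) {1..N} x = k}) = a k"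
      by simp
  qed simp
  then show ?thesis by blast
qed

section \<open>Contingency tables and products of permutation characters\<close>

definition tables :: "'k set \<Rightarrow> 'l set \<Rightarrow> ('k \<Rightarrow> int) \<Rightarrow> ('l \<Rightarrow> int) \<Rightarrow> ('k \<times> 'l \<Rightarrow> int) set" where
  "tables I J a b = {M. (\<forall>x. M x \<ge> 0) \<and> (\<forall>x. x \<notin> I \<times> J \<longrightarrow> M x = 0) \<and>
     (\<forall>i\<in>I. (\<Sum>j\<in>J. M (i, j)) = a i) \<and> (\<forall>j\<in>J. (\<Sum>i\<in>I. M (i, j)) = b j)}"

lemma finite_tables [simp]:
  assumes "finite I" "finite J"
  shows "finite (tables I J a b)"
proof -
  let ?F = "{M :: 'a \<times> 'b \<Rightarrow> int. \<forall>x. (x \<in> I \<times> J \<longrightarrow> M x \<in> {0..(\<Sum>i\<in>I. \<bar>a i\<bar>)}) \<and> (x \<notin> I \<times> J \<longrightarrow> M x = 0)}"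
  have "finite ?F" using assms by (intro finite_set_of_finite_funs) auto
  moreover have "tables I J a b \<subseteq> ?F"
  proof (safe)
    fix M i j assume M: "M \<in> tables I J a b" and i: "i \<in> I" and j: "j \<in> J"
    have "M (i, j) \<le> (\<Sum>j\<in>J. M (i, j))"
      using M j assms by (intro member_le_sum) (auto simp: tables_def)
    also have "\<dots> = a i" using M i by (auto simp: tables_def)
    also have "\<dots> \<le> \<bar>a i\<bar>" by simp
    also have "\<dots> \<le> (\<Sum>i\<in>I. \<bar>a i\<bar>)" using i assms by (intro member_le_sum) auto
    finally show "M (i, j) \<in> {0..\<Sum>i\<in>I. \<bar>a i\<bar>}" using M by (auto simp: tables_def)
  qed (auto simp: tables_def)
  ultimately show ?thesis by (rule finite_subset[rotated])
qed

lemma sum_tables: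
  assumes "M \<in> tables I J a b" shows "(\<Sum>x\<in>I \<times> J. M x) = (\<Sum>i\<in>I. a i)"
proof -
  have "(\<Sum>x\<in>I \<times> J. M x) = (\<Sum>i\<in>I. \<Sum>j\<in>J. M (i, j))"
    by (simp add: sum.cartesian_product)
  also have "\<dots> = (\<Sum>i\<in>I. a i)" using assms by (auto simp: tables_def)
  finally show ?thesis .
qed

text \<open>A pair of fillings is one filling by pairs (\<open>?f\<close>, with inverse
  \<open>?g\<close>), and the content of the latter is a table with margins \<open>a\<close> and
  \<open>b\<close>. This is a combinatorial form of Mackey's formula: a product of permutation
  characters is again a sum of such characters. Tables vanish off \<open>I \<times> J\<close>, so
  they serve directly as contents.\<close>

lemma phi_times_phi:
  assumes I: "finite I" "\<And>k. k \<notin> I \<Longrightarrow> a k = 0" and J: "finite J" "\<And>k. k \<notin> J \<Longrightarrow> b k = 0"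
    and \<sigma>: "\<sigma> \<in> perms N"
  shows "phi N a \<sigma> * phi N b \<sigma> = (\<Sum>M\<in>tables I J a b. phi N M \<sigma>)"
proof -
  let ?X = "fixed_fillings N a \<sigma>" and ?Y = "fixed_fillings N b \<sigma>"
  let ?P = "\<lambda>M. fixed_fillings N M \<sigma>"
  let ?f = "\<lambda>(h, g). restrict (\<lambda>x. (h x, g x)) {1..N}"
  let ?g = "\<lambda>p. (restrict (fst \<circ> p) {1..N}, restrict (snd \<circ> p) {1..N})"
  have s: "\<sigma> permutes {1..N}" using \<sigma> by (simp add: perms_def)
  have sin: "\<sigma> x \<in> {1..N} \<longleftrightarrow> x \<in> {1..N}" for x using permutes_in_image[OF s] by blast
  have rsum: "card {x \<in> {1..N}. fst (p x) = i} = (\<Sum>j\<in>J. card {x \<in> {1..N}. p x = (i, j)})"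
    if "\<forall>x\<in>{1..N}. p x \<in> I \<times> J" for p :: "nat \<Rightarrow> 'a \<times> 'b" and i
  proof -
    have "{x \<in> {1..N}. fst (p x) = i} = (\<Union>j\<in>J. {x \<in> {1..N}. p x = (i, j)})"
      using that by (force simp del: atLeastAtMost_iff)
    then show ?thesis using J(1) by (simp only:) (subst card_UN_disjoint, auto)
  qed
  have csum: "card {x \<in> {1..N}. snd (p x) = j} = (\<Sum>i\<in>I. card {x \<in> {1..N}. p x = (i, j)})"
    if "\<forall>x\<in>{1..N}. p x \<in> I \<times> J" for p :: "nat \<Rightarrow> 'a \<times> 'b" and j
  proof -
    have "{x \<in> {1..N}. snd (p x) = j} = (\<Union>i\<in>I. {x \<in> {1..N}. p x = (i, j)})"
      using that by (force simp del: atLeastAtMost_iff)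
    then show ?thesis using I(1) by (simp only:) (subst card_UN_disjoint, auto)
  qed
  have "bij_betw ?f (?X \<times> ?Y) (\<Union>M\<in>tables I J a b. ?P M)"
  proof (rule bij_betw_byWitness[where f' = ?g])
    show "\<forall>x\<in>?X \<times> ?Y. ?g (?f x) = x"
      by (auto simp: fixed_fillings_def fillings_def extensional_def restrict_def fun_eq_iff)
    show "\<forall>p\<in>(\<Union>M\<in>tables I J a b. ?P M). ?f (?g p) = p"
      by (auto simp: fixed_fillings_def fillings_def extensional_def restrict_def fun_eq_iff)
    show "?f ` (?X \<times> ?Y) \<subseteq> (\<Union>M\<in>tables I J a b. ?P M)"
    proof (clarify)
      fix h g assume h: "h \<in> ?X" and g: "g \<in> ?Y"
      let ?p = "restrict (\<lambda>x. (h x, g x)) {1..N}"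
      let ?M = "\<lambda>k. int (card {x \<in> {1..N}. ?p x = k})"
      have hI: "h ` {1..N} \<subseteq> I" using h I fillings_support[of h N a] by (auto simp: fixed_fillings_def)
      have gJ: "g ` {1..N} \<subseteq> J" using g J fillings_support[of g N b] by (auto simp: fixed_fillings_def)
      have pIJ: "\<forall>x\<in>{1..N}. ?p x \<in> I \<times> J" using hI gJ by auto
      have r: "card {x \<in> {1..N}. fst (?p x) = i} = card {x \<in> {1..N}. h x = i}" for i
        by (intro arg_cong[where f = card]) auto
      have c: "card {x \<in> {1..N}. snd (?p x) = j} = card {x \<in> {1..N}. g x = j}" for j
        by (intro arg_cong[where f = card]) auto
      have "?M \<in> tables I J a b"
        unfolding tables_def mem_Collect_eq
      proof (intro conjI allI ballI impI)
        fix x assume "x \<notin> I \<times> J"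
        then have "{y \<in> {1..N}. ?p y = x} = {}" using pIJ by blast
        then show "int (card {y \<in> {1..N}. ?p y = x}) = 0" by (simp only: card.empty)
      next
        fix i assume "i \<in> I"
        show "(\<Sum>j\<in>J. ?M (i, j)) = a i"
          using rsum[OF pIJ, of i] h fillings_card[of h N a i] unfolding r
          by (simp only: fixed_fillings_def mem_Collect_eq flip: of_nat_sum)
      next
        fix j assume "j \<in> J"
        show "(\<Sum>i\<in>I. ?M (i, j)) = b j"
          using csum[OF pIJ, of j] g fillings_card[of g N b j] unfolding c
          by (simp only: fixed_fillings_def mem_Collect_eq flip: of_nat_sum)
      qed simp
      moreover have "?p \<in> ?P ?M"
      proof -
        have "?p \<circ> \<sigma> = ?p"
        proof
          fix x
          have "h (\<sigma> x) = h x" "g (\<sigma> x) = g x"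
            using h g by (auto simp: fixed_fillings_def fun_eq_iff)
          then show "(?p \<circ> \<sigma>) x = ?p x"
            using sin[of x] by (auto simp: restrict_def simp del: atLeastAtMost_iff)
        qed
        then show ?thesis by (auto simp: fixed_fillings_def fillings_def)
      qed
      ultimately show "?p \<in> (\<Union>M\<in>tables I J a b. ?P M)" by blast
    qed
    show "?g ` (\<Union>M\<in>tables I J a b. ?P M) \<subseteq> ?X \<times> ?Y"
    proof (clarify)
      fix M p assume M: "M \<in> tables I J a b" and p: "p \<in> ?P M"
      have pf: "p \<in> fillings N M" and ps: "p \<circ> \<sigma> = p" using p by (auto simp: fixed_fillings_def)
      have pIJ: "\<forall>x\<in>{1..N}. p x \<in> I \<times> J"
      proof
        fix x assume "x \<in> {1..N}"
        then have "M (p x) \<noteq> 0" using fillings_support[OF pf] by blast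
        then show "p x \<in> I \<times> J" using M unfolding tables_def by blast
      qed
      have 1: "int (card {x \<in> {1..N}. restrict (fst \<circ> p) {1..N} x = i}) = a i" for i
      proof -
        have "int (card {x \<in> {1..N}. restrict (fst \<circ> p) {1..N} x = i}) = int (card {x \<in> {1..N}. fst (p x) = i})"
          by (intro arg_cong[where f = "\<lambda>x. int (card x)"]) auto
        also have "\<dots> = (\<Sum>j\<in>J. M (i, j))" using rsum[OF pIJ, of i] fillings_card[OF pf] by simp
        also have "\<dots> = a i" using M I(2) by (cases "i \<in> I") (auto simp: tables_def)
        finally show ?thesis .
      qed
      have 2: "int (card {x \<in> {1..N}. restrict (snd \<circ> p) {1..N} x = i}) = b i" for i
      proof -
        have "int (card {x \<in> {1..N}. restrict (snd \<circ> p) {1..N} x = i}) = int (card {x \<in> {1..N}. snd (p x) = i})"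
          by (intro arg_cong[where f = "\<lambda>x. int (card x)"]) auto
        also have "\<dots> = (\<Sum>j\<in>I. M (j, i))" using csum[OF pIJ, of i] fillings_card[OF pf] by simp
        also have "\<dots> = b i" using M J(2) by (cases "i \<in> J") (auto simp: tables_def)
        finally show ?thesis .
      qed
      have "restrict (fst \<circ> p) {1..N} \<circ> \<sigma> = restrict (fst \<circ> p) {1..N}"
        "restrict (snd \<circ> p) {1..N} \<circ> \<sigma> = restrict (snd \<circ> p) {1..N}"
        using sin ps by (auto simp: restrict_def fun_eq_iff simp del: atLeastAtMost_iff)
      with 1 2 show "restrict (fst \<circ> p) {1..N} \<in> ?X \<and> restrict (snd \<circ> p) {1..N} \<in> ?Y"
        unfolding fixed_fillings_def fillings_def by blast
    qed
  qed
  then have "card (?X \<times> ?Y) = card (\<Union>M\<in>tables I J a b. ?P M)" by (rule bij_betw_same_card)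
  also have "\<dots> = (\<Sum>M\<in>tables I J a b. card (?P M))"
  proof (rule card_UN_disjoint)
    show "\<forall>M\<in>tables I J a b. \<forall>M'\<in>tables I J a b. M \<noteq> M' \<longrightarrow> ?P M \<inter> ?P M' = {}"
    proof (intro ballI impI)
      fix M M' :: "'a \<times> 'b \<Rightarrow> int" assume "M \<noteq> M'"
      show "?P M \<inter> ?P M' = {}"
      proof -
        obtain x where "M x \<noteq> M' x" using \<open>M \<noteq> M'\<close> by blast
        then show ?thesis
          using fillings_card[of _ N M x] fillings_card[of _ N M' x]
          unfolding fixed_fillings_def by (metis (mono_tags, lifting) disjoint_iff mem_Collect_eq)
      qed
    qed
  qed (use I(1) J(1) in simp_all)
  finally have "card ?X * card ?Y = (\<Sum>M\<in>tables I J a b. card (?P M))"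
    by (simp add: card_cartesian_product)
  then have "int (card ?X * card ?Y) = int (\<Sum>M\<in>tables I J a b. card (?P M))" by (rule arg_cong)
  then show ?thesis unfolding phi_def of_nat_mult of_nat_sum .
qed

text \<open>Every table is a content that admits fillings, so its \<open>phi\<close> is a transitive
  permutation character and averages to 1.\<close>

lemma sum_phi_times_phi:
  assumes I: "finite I" "\<And>k. k \<notin> I \<Longrightarrow> a k = 0" and J: "finite J" "\<And>k. k \<notin> J \<Longrightarrow> b k = 0"
    and N: "(\<Sum>i\<in>I. a i) = int N"
  shows "(\<Sum>\<sigma>\<in>perms N. phi N a \<sigma> * phi N b \<sigma>) = fact N * int (card (tables I J a b))"
proof -
  have "(\<Sum>\<sigma>\<in>perms N. phi N a \<sigma> * phi N b \<sigma>) = (\<Sum>\<sigma>\<in>perms N. \<Sum>M\<in>tables I J a b. phi N M \<sigma>)"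
  proof (rule sum.cong)
    fix \<sigma> assume "\<sigma> \<in> perms N"
    then show "phi N a \<sigma> * phi N b \<sigma> = (\<Sum>M\<in>tables I J a b. phi N M \<sigma>)"
      using phi_times_phi[of I a J b \<sigma> N] I J by blast
  qed simp
  also have "\<dots> = (\<Sum>M\<in>tables I J a b. \<Sum>\<sigma>\<in>perms N. phi N M \<sigma>)"
    by (rule sum.swap)
  also have "\<dots> = (\<Sum>M\<in>tables I J a b. fact N)"
  proof (rule sum.cong)
    fix M assume M: "M \<in> tables I J a b"
    have "fillings N M \<noteq> {}"
    proof (rule fillings_nonempty)
      show "finite (I \<times> J)" using I(1) J(1) by simp
      show "(\<Sum>x\<in>I \<times> J. M x) = int N" using sum_tables[OF M] N by simp
    qed (use M in \<open>unfold tables_def, blast+\<close>)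
    then show "(\<Sum>\<sigma>\<in>perms N. phi N M \<sigma>) = fact N" by (rule sum_phi)
  qed simp
  finally show ?thesis by simp
qed

section \<open>Alternating sums of contingency tables\<close>

abbreviation rowperms :: "nat \<Rightarrow> (nat \<Rightarrow> nat) set" where
  "rowperms L \<equiv> {w. w permutes {..<L}}"

text \<open>The staircase \<delta>. Truncated subtraction makes it 0 from index \<open>L - 1\<close>
  on.\<close>

definition del :: "nat \<Rightarrow> nat \<Rightarrow> int" where
  "del L i = int (L - 1 - i)"

lemma finite_rowperms [simp]: "finite (rowperms L)"
  by (rule finite_permutations) simp

lemma tables_cong:
  "(\<And>i. i \<in> I \<Longrightarrow> a i = a' i) \<Longrightarrow> (\<And>j. j \<in> J \<Longrightarrow> b j = b' j) \<Longrightarrow> tables I J a b = tables I J a' b'"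
  by (simp add: tables_def)

lemma card_tables_compose:
  assumes "\<pi> permutes I"
  shows "card (tables I J (a \<circ> \<pi>) b) = card (tables I J a b)"
proof -
  have *: "(\<lambda>(i, j). M (\<pi> i, j)) \<in> tables I J (a \<circ> \<pi>) b" if "M \<in> tables I J a b" "\<pi> permutes I" for M \<pi> a
  proof -
    have "(\<Sum>i\<in>I. M (\<pi> i, j)) = (\<Sum>i\<in>I. M (i, j))" for j
      using sum.permute[OF that(2), of "\<lambda>i. M (i, j)"] by (simp add: o_def)
    moreover have "\<pi> i \<in> I \<longleftrightarrow> i \<in> I" for i using permutes_in_image[OF that(2)] .
    ultimately show ?thesis using that(1) by (auto simp: tables_def)
  qed
  have inv: "inv \<pi> permutes I" using assms by (rule permutes_inv)
  have cancel: "\<pi> (inv \<pi> i) = i" "inv \<pi> (\<pi> i) = i" for i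
    using permutes_inverses[OF assms] by auto
  have "bij_betw (\<lambda>M (i, j). M (\<pi> i, j)) (tables I J a b) (tables I J (a \<circ> \<pi>) b)"
  proof (rule bij_betw_byWitness[where f' = "\<lambda>M (i, j). M (inv \<pi> i, j)"])
    show "(\<lambda>M (i, j). M (\<pi> i, j)) ` tables I J a b \<subseteq> tables I J (a \<circ> \<pi>) b"
      using *[OF _ assms] by blast
    have "(a \<circ> \<pi>) \<circ> inv \<pi> = a" by (simp add: fun_eq_iff cancel)
    then show "(\<lambda>M (i, j). M (inv \<pi> i, j)) ` tables I J (a \<circ> \<pi>) b \<subseteq> tables I J a b"
      using *[OF _ inv, of _ "a \<circ> \<pi>"] by (simp add: image_subset_iff)
  qed (simp_all add: fun_eq_iff cancel)
  then show ?thesis by (simp add: bij_betw_same_card)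
qed

lemma card_tables_swap: "card (tables I J a b) = card (tables J I b a)"
proof -
  have *: "M \<circ> prod.swap \<in> tables J I b a" if "M \<in> tables I J a b" for M :: "'a \<times> 'b \<Rightarrow> int" and I J a b
    using that by (auto simp: tables_def)
  have **: "M \<circ> prod.swap \<in> tables I J a b" if "M \<in> tables J I b a" for M :: "'b \<times> 'a \<Rightarrow> int"
    using that by (auto simp: tables_def)
  have "bij_betw (\<lambda>M. M \<circ> prod.swap) (tables I J a b) (tables J I b a)"
    by (rule bij_betw_byWitness[where f' = "\<lambda>M. M \<circ> prod.swap"]) (use * ** in \<open>auto simp: comp_assoc\<close>)
  then show ?thesis by (rule bij_betw_same_card)
qed

text \<open>The determinant is expanded in the row margin only. For
  \<open>a = \<alpha> + \<delta>\<close> the value is the Kostka number of shape \<alpha> and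
  content \<open>b\<close>; the vanishing results, dominance and the diagonal value 1 below are the
  familiar properties of these numbers.\<close>

definition alt_tables :: "nat \<Rightarrow> nat \<Rightarrow> (nat \<Rightarrow> int) \<Rightarrow> (nat \<Rightarrow> int) \<Rightarrow> int" where
  "alt_tables L n a b =
    (\<Sum>u\<in>rowperms L. sign u * int (card (tables {..<L} {..<n} (\<lambda>i. a i - del L (u i)) b)))"

lemma alt_tables_cong:
  assumes "\<And>i. i < L \<Longrightarrow> a i = a' i" "\<And>j. j < n \<Longrightarrow> b j = b' j"
  shows "alt_tables L n a b = alt_tables L n a' b'"
proof -
  have "tables {..<L} {..<n} (\<lambda>i. a i - del L (u i)) b = tables {..<L} {..<n} (\<lambda>i. a' i - del L (u i)) b'" for u
    by (rule tables_cong) (use assms in auto)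
  then show ?thesis by (simp add: alt_tables_def)
qed

lemma rowperms_permutation: "w \<in> rowperms L \<Longrightarrow> permutation w"
  by (auto simp: permutation_permutes)

lemma alt_tables_compose:
  assumes p: "\<pi> permutes {..<L}"
  shows "alt_tables L n (a \<circ> \<pi>) b = sign \<pi> * alt_tables L n a b"
proof -
  let ?g = "\<lambda>a u. sign u * int (card (tables {..<L} {..<n} (\<lambda>i. a i - del L (u i)) b))"
  have "alt_tables L n (a \<circ> \<pi>) b = (\<Sum>v\<in>rowperms L. ?g (a \<circ> \<pi>) (v \<circ> \<pi>))"
    unfolding alt_tables_def by (rule sum_permutations_compose_right[OF p])
  also have "\<dots> = (\<Sum>v\<in>rowperms L. sign \<pi> * ?g a v)"
  proof (rule sum.cong)
    fix v assume v: "v \<in> rowperms L"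
    have "sign (v \<circ> \<pi>) = sign v * sign \<pi>"
      using v p by (intro sign_compose rowperms_permutation) auto
    moreover have "card (tables {..<L} {..<n} (\<lambda>i. (a \<circ> \<pi>) i - del L ((v \<circ> \<pi>) i)) b)
      = card (tables {..<L} {..<n} (\<lambda>i. a i - del L (v i)) b)"
      using card_tables_compose[OF p, of "{..<n}" "\<lambda>i. a i - del L (v i)" b] by (simp add: o_def)
    ultimately show "?g (a \<circ> \<pi>) (v \<circ> \<pi>) = sign \<pi> * ?g a v" by simp
  qed simp
  finally show ?thesis by (simp add: alt_tables_def sum_distrib_left)
qed

lemma alt_tables_transpose:
  assumes "p < L" "q < L" "p \<noteq> q"
  shows "alt_tables L n (a \<circ> transpose p q) b = - alt_tables L n a b"
  using assms alt_tables_compose[of "transpose p q" L n a b]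
  by (simp add: permutes_swap_id sign_swap_id)

text \<open>Exchanging two equal entries leaves the vector unchanged but negates the count.\<close>

lemma alt_tables_inj_on:
  assumes "alt_tables L n a b \<noteq> 0"
  shows "inj_on a {..<L}"
proof (rule inj_onI)
  fix p q assume pq: "p \<in> {..<L}" "q \<in> {..<L}" "a p = a q"
  show "p = q"
  proof (rule ccontr)
    assume "p \<noteq> q"
    moreover have "a \<circ> transpose p q = a" using pq by (auto simp: fun_eq_iff transpose_def)
    ultimately show False using alt_tables_transpose[of p L q n a b] pq assms by simp
  qed
qed

lemma alt_tables_total:
  assumes "alt_tables L n a b \<noteq> 0"
  shows "(\<Sum>i<L. a i) - (\<Sum>i<L. del L i) = (\<Sum>j<n. b j)"
proof -
  obtain u where u: "u permutes {..<L}" and ne: "tables {..<L} {..<n} (\<lambda>i. a i - del L (u i)) b \<noteq> {}"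
    using assms unfolding alt_tables_def
    by (metis (no_types, lifting) card.empty mem_Collect_eq mult_zero_right of_nat_0 sum.neutral)
  then obtain M where M: "M \<in> tables {..<L} {..<n} (\<lambda>i. a i - del L (u i)) b" by blast
  have "(\<Sum>i<L. a i - del L (u i)) = (\<Sum>i<L. \<Sum>j<n. M (i, j))"
    using M by (intro sum.cong) (auto simp: tables_def)
  also have "\<dots> = (\<Sum>j<n. \<Sum>i<L. M (i, j))" by (rule sum.swap)
  also have "\<dots> = (\<Sum>j<n. b j)"
    using M by (intro sum.cong) (auto simp: tables_def)
  finally show ?thesis
    using sum.permute[OF u, of "del L"] by (simp add: sum_subtractf o_def)
qed

section \<open>Removing columns and the missing-value principle\<close>

definition comps :: "nat \<Rightarrow> int \<Rightarrow> (nat \<Rightarrow> int) set" where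
  "comps L m = {c. (\<forall>i. c i \<ge> 0) \<and> (\<forall>i\<ge>L. c i = 0) \<and> (\<Sum>i<L. c i) = m}"

lemma finite_comps [simp]: "finite (comps L m)"
proof -
  let ?F = "{c :: nat \<Rightarrow> int. \<forall>i. (i \<in> {..<L} \<longrightarrow> c i \<in> {0..m}) \<and> (i \<notin> {..<L} \<longrightarrow> c i = 0)}"
  have "finite ?F" by (intro finite_set_of_finite_funs) auto
  moreover have "comps L m \<subseteq> ?F"
  proof
    fix c assume c: "c \<in> comps L m"
    have "c i \<le> (\<Sum>i<L. c i)" if "i < L" for i
      using c that by (intro member_le_sum) (auto simp: comps_def)
    then show "c \<in> ?F" using c by (auto simp: comps_def)
  qed
  ultimately show ?thesis by (rule finite_subset[rotated])
qed

lemma card_tables_Suc: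
  "card (tables {..<L} {..<Suc n} a b) = (\<Sum>c\<in>comps L (b n). card (tables {..<L} {..<n} (\<lambda>i. a i - c i) b))"
proof -
  \<comment> \<open>The removed column is overwritten by 0, because members of
    \<open>tables {..<L} {..<n}\<close> must vanish outside their index range.\<close>
  let ?f = "\<lambda>M. (\<lambda>i. M (i, n), \<lambda>(i, j). if j = n then 0 else M (i, j))"
  let ?g = "\<lambda>(c, M) (i, j). if j = n then c i else M (i, j)"
  let ?S = "SIGMA c:comps L (b n). tables {..<L} {..<n} (\<lambda>i. a i - c i) b"
  have "bij_betw ?f (tables {..<L} {..<Suc n} a b) ?S"
  proof (rule bij_betw_byWitness[where f' = ?g])
    show "\<forall>M\<in>tables {..<L} {..<Suc n} a b. ?g (?f M) = M" by (auto simp: fun_eq_iff)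
    show "\<forall>x\<in>?S. ?f (?g x) = x" by (auto simp: fun_eq_iff tables_def)
    show "?f ` tables {..<L} {..<Suc n} a b \<subseteq> ?S"
    proof (rule image_subsetI)
      fix M assume M: "M \<in> tables {..<L} {..<Suc n} a b"
      have "(\<lambda>i. M (i, n)) \<in> comps L (b n)" using M by (auto simp: tables_def comps_def)
      moreover have "(\<lambda>(i, j). if j = n then 0 else M (i, j)) \<in> tables {..<L} {..<n} (\<lambda>i. a i - M (i, n)) b"
      proof -
        have "(\<Sum>j<n. if j = n then 0 else M (i, j)) = (\<Sum>j<n. M (i, j))" for i
          by (rule sum.cong) auto
        moreover have "(\<Sum>j<n. M (i, j)) = a i - M (i, n)" if "i < L" for i
          using M that by (simp add: tables_def eq_diff_eq)
        ultimately show ?thesis using M by (auto simp: tables_def)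
      qed
      ultimately show "?f M \<in> ?S" by simp
    qed
    show "?g ` ?S \<subseteq> tables {..<L} {..<Suc n} a b"
    proof (rule image_subsetI)
      fix x assume x: "x \<in> ?S"
      obtain c M where cM: "x = (c, M)" by (cases x)
      have c: "c \<in> comps L (b n)" and M: "M \<in> tables {..<L} {..<n} (\<lambda>i. a i - c i) b"
        using x cM by auto
      have "(\<Sum>j<n. if j = n then c i else M (i, j)) = (\<Sum>j<n. M (i, j))" for i
        by (rule sum.cong) auto
      then show "?g x \<in> tables {..<L} {..<Suc n} a b"
        using c M by (auto simp: cM tables_def comps_def less_Suc_eq)
    qed
  qed
  then have "card (tables {..<L} {..<Suc n} a b) = card ?S" by (rule bij_betw_same_card)
  then show ?thesis by (simp add: card_SigmaI)
qed

text \<open>The recursion behind the vanishing results: stripping a column changes only the row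
  vector, and the alternating property is available for what remains.\<close>

lemma alt_tables_Suc:
  "alt_tables L (Suc n) a b = (\<Sum>c\<in>comps L (b n). alt_tables L n (\<lambda>i. a i - c i) b)"
proof -
  have eq: "(\<lambda>i. a i - del L (u i) - c i) = (\<lambda>i. a i - c i - del L (u i))" for u c :: "nat \<Rightarrow> _"
    by (simp add: algebra_simps)
  have "alt_tables L (Suc n) a b = (\<Sum>u\<in>rowperms L. \<Sum>c\<in>comps L (b n).
     sign u * int (card (tables {..<L} {..<n} (\<lambda>i. a i - c i - del L (u i)) b)))"
    by (simp add: alt_tables_def card_tables_Suc sum_distrib_left eq)
  then show ?thesis unfolding alt_tables_def by (subst sum.swap)
qed

lemma tables_empty: "tables I {} a b = (if \<forall>i\<in>I. a i = 0 then {\<lambda>_. 0} else {})"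
  by (auto simp: tables_def)

text \<open>
  The rows of a nonzero alternating count contain the values \<open>0, \<dots>, L - 1 - n\<close>: otherwise
  exchanging the values \<open>j\<close> and \<open>j + 1\<close> after removing the last column is a
  sign-reversing involution.
\<close>

lemma alt_tables_missing_value:
  assumes "j + n < L" "\<And>i. i < L \<Longrightarrow> a i \<noteq> int j"
  shows "alt_tables L n a b = 0"
  using assms
proof (induction n arbitrary: a j)
  case 0
  \<comment> \<open>Without columns all row sums are 0, so \<open>a\<close> would agree with
    \<delta> composed with \<open>u\<close> and attain every value below \<open>L\<close>.\<close>
  have "\<not> (\<forall>i<L. a i - del L (u i) = 0)" if u: "u permutes {..<L}" for u
  proof
    assume *: "\<forall>i<L. a i - del L (u i) = 0"
    have "inv u (L - 1 - j) < L"
      using permutes_in_image[OF permutes_inv[OF u], of "L - 1 - j"] 0 by auto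
    moreover have "u (inv u (L - 1 - j)) = L - 1 - j" using permutes_inverses[OF u] by simp
    ultimately have "a (inv u (L - 1 - j)) = int j" using * 0(1) by (force simp: del_def)
    then show False using 0(2) \<open>inv u (L - 1 - j) < L\<close> by blast
  qed
  then have "tables {..<L} {..<0} (\<lambda>i. a i - del L (u i)) b = {}" if "u permutes {..<L}" for u
    using that by (simp add: tables_empty Ball_def)
  then show ?case by (simp add: alt_tables_def)
next
  case (Suc n)
  define f where "f c = alt_tables L n (\<lambda>i. a i - c i) b" for c
  define C where "C = {c \<in> comps L (b n). f c \<noteq> 0}"
  \<comment> \<open>Exchanging two values rather than two positions makes \<iota> visibly an
    involution.\<close>
  define \<iota> where "\<iota> c = (\<lambda>i. if i < L then a i - transpose (int j) (int j + 1) (a i - c i) else c i)" for c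
  have key: "\<iota> c \<in> comps L (b n) \<and> f (\<iota> c) = - f c \<and> \<iota> (\<iota> c) = c" if c: "c \<in> C" for c
  proof -
    let ?e = "\<lambda>i. a i - c i"
    have cc: "c \<in> comps L (b n)" and ne: "alt_tables L n ?e b \<noteq> 0" using c by (auto simp: C_def f_def)
    have inj: "inj_on ?e {..<L}" using ne by (rule alt_tables_inj_on)
    \<comment> \<open>With one column less, the induction hypothesis covers both \<open>j\<close>
      and \<open>j + 1\<close>, so both values must occur in \<open>?e\<close> for the count to be
      nonzero.\<close>
    obtain p where p: "p < L" "?e p = int j" using Suc.IH[of j ?e] Suc.prems(1) ne by fastforce
    obtain q where q: "q < L" "?e q = int j + 1" using Suc.IH[of "j + 1" ?e] Suc.prems(1) ne by fastforce
    have pq: "p \<noteq> q" using p q by auto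
    \<comment> \<open>Since \<open>?e\<close> is injective, exchanging the values amounts to
      exchanging the positions \<open>p\<close> and \<open>q\<close>, which negates the
      count.\<close>
    have e': "a i - \<iota> c i = (?e \<circ> transpose p q) i" for i
    proof -
      consider "i = p" | "i = q" | "i < L" "i \<noteq> p" "i \<noteq> q" | "i \<ge> L" by linarith
      then show ?thesis
      proof cases
        case 3
        then have "?e i \<noteq> int j" "?e i \<noteq> int j + 1" using inj_onD[OF inj, of i p] inj_onD[OF inj, of i q] p q by auto
        then show ?thesis using 3 by (simp add: \<iota>_def transpose_def)
      qed (use p q in \<open>auto simp: \<iota>_def transpose_def\<close>)
    qed
    have "f (\<iota> c) = alt_tables L n (?e \<circ> transpose p q) b" unfolding f_def e' by (simp add: o_def)
    also have "\<dots> = - f c" using alt_tables_transpose[OF p(1) q(1) pq] by (simp add: f_def)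
    finally have 1: "f (\<iota> c) = - f c" .
    have inv: "\<iota> (\<iota> c) = c" by (simp add: \<iota>_def fun_eq_iff)
    have "\<iota> c i = a i - (?e \<circ> transpose p q) i" for i using e'[of i] by simp
    then have i2: "\<iota> c = (\<lambda>i. a i - (?e \<circ> transpose p q) i)" by blast
    have nonneg: "\<iota> c i \<ge> 0" for i
    proof -
      \<comment> \<open>The new column loses 1 at \<open>p\<close>. Its entry there was positive
        because \<open>a p\<close> differs from \<open>j\<close>: this is where the missing value
        enters.\<close>
      have "a p \<noteq> int j" using Suc.prems(2) p(1) by blast
      moreover have "c p \<ge> 0" "c q \<ge> 0" "c i \<ge> 0" using cc by (auto simp: comps_def)
      ultimately show ?thesis using p q by (auto simp: i2 transpose_def)
    qed
    have "(\<Sum>i<L. \<iota> c i) = (\<Sum>i<L. a i) - (\<Sum>i<L. ?e i)"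
      using sum.permute[of "transpose p q" "{..<L}" ?e] p q
      by (simp add: i2 sum_subtractf permutes_swap_id)
    also have "\<dots> = b n" using cc by (simp add: sum_subtractf comps_def)
    finally have "\<iota> c \<in> comps L (b n)" using nonneg cc by (auto simp: comps_def \<iota>_def)
    with 1 inv show ?thesis by blast
  qed
  have "(\<Sum>c\<in>C. f c) = (\<Sum>c\<in>C. f (\<iota> c))"
    by (rule sum.reindex_bij_witness[where i = \<iota> and j = \<iota>]) (use key in \<open>auto simp: C_def\<close>)
  also have "\<dots> = - (\<Sum>c\<in>C. f c)" using key by (simp add: sum_negf)
  finally have "(\<Sum>c\<in>C. f c) = 0" by simp
  moreover have "alt_tables L (Suc n) a b = (\<Sum>c\<in>C. f c)"
    unfolding alt_tables_Suc C_def f_def by (rule sum.mono_neutral_right) auto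
  ultimately show ?case by simp
qed

text \<open>A nonzero sum has a nonzero summand, so the columns from \<open>n\<close> on can be
  peeled off one by one; \<open>c\<close> is their sum. The fewer columns remain, the more values
  the row vector is forced to contain.\<close>

lemma alt_tables_remove_columns:
  assumes "alt_tables L (n + d) a b \<noteq> 0"
  shows "\<exists>c. (\<forall>i. c i \<ge> 0) \<and> alt_tables L n (\<lambda>i. a i - c i) b \<noteq> 0"
  using assms
proof (induction d arbitrary: a)
  case 0
  then show ?case by (intro exI[of _ "\<lambda>_. 0"]) simp
next
  case (Suc d)
  then have "(\<Sum>c\<in>comps L (b (n + d)). alt_tables L (n + d) (\<lambda>i. a i - c i) b) \<noteq> 0"
    by (simp add: alt_tables_Suc)
  then obtain c where c: "c \<in> comps L (b (n + d))" "alt_tables L (n + d) (\<lambda>i. a i - c i) b \<noteq> 0"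
    by (rule sum.not_neutral_contains_not_neutral)
  from Suc.IH[OF c(2)] obtain c' where c': "\<forall>i. c' i \<ge> 0" "alt_tables L n (\<lambda>i. a i - c i - c' i) b \<noteq> 0"
    by blast
  then show ?case using c(1)
    by (intro exI[of _ "\<lambda>i. c i + c' i"]) (auto simp: comps_def diff_diff_eq)
qed

text \<open>\<open>R\<close> and the initial segment of the same size \<open>n\<close> differ by
  equally many indices on either side, and \<open>a n\<close> separates the values on the two
  sides.\<close>

lemma sum_le_sum_initial:
  fixes a :: "nat \<Rightarrow> int"
  assumes mono: "\<And>i j. i \<le> j \<Longrightarrow> j < L \<Longrightarrow> a j \<le> a i" and R: "R \<subseteq> {..<L}"
  shows "(\<Sum>i\<in>R. a i) \<le> (\<Sum>i<card R. a i)"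
proof -
  define n where "n = card R"
  have fin: "finite R" using R finite_subset by blast
  have nL: "n \<le> L" using card_mono[OF _ R] by (simp add: n_def)
  show ?thesis
  proof (cases "n = L")
    case True
    then have "R = {..<L}" using R by (intro card_subset_eq) (auto simp: n_def)
    then show ?thesis by simp
  next
    case False
    then have n: "n < L" using nL by simp
    let ?A = "R - {..<n}" and ?B = "{..<n} - R"
    have "card ?A = card ?B"
    proof -
      have "card R = card (R \<inter> {..<n}) + card ?A" using fin by (metis card_Int_Diff)
      moreover have "card {..<n} = card ({..<n} \<inter> R) + card ?B" by (metis card_Int_Diff finite_lessThan)
      ultimately show ?thesis by (simp add: n_def Int_commute)
    qed
    moreover have "(\<Sum>i\<in>?A. a i) \<le> of_nat (card ?A) * a n"
      by (rule sum_bounded_above) (use mono R in auto)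
    moreover have "of_nat (card ?B) * a n \<le> (\<Sum>i\<in>?B. a i)"
      by (rule sum_bounded_below) (use mono n in auto)
    ultimately have "(\<Sum>i\<in>?A. a i) \<le> (\<Sum>i\<in>?B. a i)" by simp
    moreover have "(\<Sum>i\<in>R. a i) = (\<Sum>i\<in>R \<inter> {..<n}. a i) + (\<Sum>i\<in>?A. a i)"
      using fin by (metis sum.Int_Diff)
    moreover have "(\<Sum>i<n. a i) = (\<Sum>i\<in>R \<inter> {..<n}. a i) + (\<Sum>i\<in>?B. a i)"
      by (metis sum.Int_Diff finite_lessThan Int_commute)
    ultimately show ?thesis by (simp add: n_def)
  qed
qed

text \<open>When only \<open>n\<close> columns are left, the row vector still contains the values 0
  to \<open>L - n - 1\<close>, which add up to the tail of \<delta>. The total of the other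
  \<open>n\<close> entries is then the left-hand side, and it is at most the sum of the
  \<open>n\<close> largest entries of \<open>a\<close>.\<close>

lemma alt_tables_dominance:
  assumes mono: "\<And>i j. i \<le> j \<Longrightarrow> j < L \<Longrightarrow> a j \<le> a i" and n: "n \<le> m" "n \<le> L"
    and ne: "alt_tables L m a b \<noteq> 0"
  shows "(\<Sum>j<n. b j) + (\<Sum>i<n. del L i) \<le> (\<Sum>i<n. a i)"
proof -
  obtain c where c: "\<forall>i. c i \<ge> 0" and ne': "alt_tables L n (\<lambda>i. a i - c i) b \<noteq> 0"
    using alt_tables_remove_columns[of L n "m - n" a b] ne n by auto
  define e where "e i = a i - c i" for i
  have ne: "alt_tables L n e b \<noteq> 0" using ne' unfolding e_def .
  have "\<exists>i<L. e i = int v" if "v < L - n" for v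
    using alt_tables_missing_value[of v n L e b] ne that by force
  then obtain pos where pos: "\<And>v. v < L - n \<Longrightarrow> pos v < L \<and> e (pos v) = int v" by metis
  have inj: "inj_on pos {..<L - n}"
    by (rule inj_onI) (metis pos lessThan_iff of_nat_eq_iff)
  define Q where "Q = pos ` {..<L - n}"
  have QL: "Q \<subseteq> {..<L}" using pos by (auto simp: Q_def)
  have cQ: "card Q = L - n" by (simp add: Q_def card_image inj)
  have "(\<Sum>i\<in>Q. e i) = (\<Sum>v<L - n. int v)"
    using pos by (simp add: Q_def sum.reindex inj)
  also have "\<dots> = (\<Sum>i\<in>{n..<L}. del L i)"
    by (rule sum.reindex_bij_witness[where i = "\<lambda>i. L - 1 - i" and j = "\<lambda>i. L - 1 - i"])
      (use n in \<open>auto simp: del_def\<close>)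
  finally have Qe: "(\<Sum>i\<in>Q. e i) = (\<Sum>i\<in>{n..<L}. del L i)" .
  let ?R = "{..<L} - Q"
  have cR: "card ?R = n" using cQ QL n by (simp add: card_Diff_subset finite_subset)
  have "(\<Sum>i\<in>?R. e i) \<le> (\<Sum>i\<in>?R. a i)" by (rule sum_mono) (use c in \<open>auto simp: e_def\<close>)
  also have "\<dots> \<le> (\<Sum>i<n. a i)" using sum_le_sum_initial[of L a ?R] mono cR by simp
  finally have Re: "(\<Sum>i\<in>?R. e i) \<le> (\<Sum>i<n. a i)" .
  have "(\<Sum>i<L. e i) = (\<Sum>i\<in>?R. e i) + (\<Sum>i\<in>Q. e i)" by (rule sum.subset_diff[OF QL]) simp
  moreover have "(\<Sum>i<L. del L i) = (\<Sum>i<n. del L i) + (\<Sum>i\<in>{n..<L}. del L i)"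
    using n by (metis atLeast0LessThan le0 sum.atLeastLessThan_concat)
  ultimately show ?thesis using alt_tables_total[OF ne] Qe Re by linarith
qed

lemma sum_del_le:
  assumes w: "w permutes {..<L}" and n: "n \<le> L"
  shows "(\<Sum>i<n. del L (w i)) \<le> (\<Sum>i<n. del L i)"
proof -
  have inj: "inj_on w {..<n}" using permutes_inj_on[OF w] .
  have "(\<Sum>i<n. del L (w i)) = (\<Sum>i\<in>w ` {..<n}. del L i)" by (simp add: sum.reindex inj)
  also have "\<dots> \<le> (\<Sum>i<card (w ` {..<n}). del L i)"
  proof (rule sum_le_sum_initial)
    show "w ` {..<n} \<subseteq> {..<L}" 
    proof (rule image_subsetI)
      fix i assume "i \<in> {..<n}"
      then have "i \<in> {..<L}" using n by simp
      then show "w i \<in> {..<L}" by (simp only: permutes_in_image[OF w])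
    qed
  qed (auto simp: del_def)
  finally show ?thesis by (simp add: card_image inj)
qed

text \<open>At the least index \<open>i\<close> that \<open>w\<close> moves, all smaller values are
  already taken by fixed points. So \<open>w i > i\<close>, and \<delta> loses there;
  \<open>n\<close> is \<open>i + 1\<close>.\<close>

lemma sum_del_less:
  assumes w: "w permutes {..<L}" and "w \<noteq> id"
  obtains n where "n \<le> L" "(\<Sum>i<n. del L (w i)) < (\<Sum>i<n. del L i)"
proof -
  define i where "i = (LEAST i. w i \<noteq> i)"
  have "\<exists>i. w i \<noteq> i" using assms(2) by (auto simp: fun_eq_iff)
  then have i: "w i \<noteq> i" unfolding i_def by (rule LeastI_ex)
  have lt: "w i' = i'" if "i' < i" for i' using that not_less_Least unfolding i_def by blast
  have iL: "i < L" using i permutes_not_in[OF w, of i] by (cases "i < L") auto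
  have wiL: "w i < L" using permutes_in_image[OF w, of i] iL by simp
  have "w i > i"
    using i lt permutes_inj[OF w] by (metis injD linorder_neqE_nat)
  then have "del L (w i) < del L i" using wiL by (simp add: del_def)
  then have "(\<Sum>i'<Suc i. del L (w i')) < (\<Sum>i'<Suc i. del L i')" using lt by simp
  then show thesis using that[of "Suc i"] iL by simp
qed

text \<open>By induction on the number of columns: only one last column contributes, namely
  \<open>c0\<close>, which puts all of \<open>\<alpha> n\<close> into row \<open>n\<close>.\<close>

lemma alt_tables_diagonal:
  assumes "n \<le> L" "\<And>i. \<alpha> i \<ge> 0" "\<And>i j. i \<le> j \<Longrightarrow> \<alpha> j \<le> \<alpha> i" "\<And>i. i \<ge> n \<Longrightarrow> \<alpha> i = 0"
  shows "alt_tables L n (\<lambda>i. \<alpha> i + del L i) \<alpha> = 1"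
  using assms
proof (induction n arbitrary: \<alpha>)
  case 0
  have "(\<forall>i\<in>{..<L}. \<alpha> i + del L i - del L (u i) = 0) \<longleftrightarrow> u = id" if u: "u permutes {..<L}" for u
  proof
    assume *: "\<forall>i\<in>{..<L}. \<alpha> i + del L i - del L (u i) = 0"
    show "u = id"
    proof
      fix i show "u i = id i"
      proof (cases "i < L")
        case True
        then show ?thesis
          using * 0(4) permutes_in_image[OF u, of i] by (auto simp: del_def dest!: bspec[of _ _ i])
      qed (use permutes_not_in[OF u] in auto)
    qed
  qed (use 0 in auto)
  then have "alt_tables L 0 (\<lambda>i. \<alpha> i + del L i) \<alpha> = (\<Sum>u\<in>rowperms L. if u = id then 1 else 0)"
    unfolding alt_tables_def by (intro sum.cong) (auto simp: tables_empty)
  then show ?case by (simp add: permutes_id)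
next
  case (Suc n)
  define c0 where "c0 = (\<lambda>i. if i = n then \<alpha> n else 0)"
  have nL: "n < L" using Suc.prems(1) by simp
  have c0: "c0 \<in> comps L (\<alpha> n)" using Suc.prems nL by (auto simp: comps_def c0_def)
  have uniq: "c = c0" if c: "c \<in> comps L (\<alpha> n)" and ne: "alt_tables L n (\<lambda>i. \<alpha> i + del L i - c i) \<alpha> \<noteq> 0" for c
  proof -
    \<comment> \<open>With \<open>n\<close> columns left, \<open>L - 1 - n\<close> is the largest
      value that must occur, and it equals \<delta> at \<open>n\<close>. Rows after \<open>n\<close>
      start below it; rows before \<open>n\<close> stay above it, since a column entry is at most
      \<open>\<alpha> n\<close>.\<close>
    have "\<exists>p<L. \<alpha> p + del L p - c p = int (L - 1 - n)"
      using alt_tables_missing_value[of "L - 1 - n" n L "\<lambda>i. \<alpha> i + del L i - c i" \<alpha>] ne nL by force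
    then obtain p where p: "p < L" "\<alpha> p + del L p - c p = del L n" by (auto simp: del_def)
    have cp: "c p \<ge> 0" using c by (simp add: comps_def)
    have csum: "(\<Sum>i<L. c i) = \<alpha> n" using c by (simp add: comps_def)
    have cle: "c p \<le> \<alpha> n" unfolding csum[symmetric] using c p
      by (intro member_le_sum) (auto simp: comps_def)
    have "p \<le> n"
    proof (rule ccontr)
      assume "\<not> p \<le> n"
      then have "\<alpha> p = 0" "del L p < del L n" using Suc.prems(4)[of p] p(1) by (auto simp: del_def)
      then show False using p cp by simp
    qed
    then have "\<alpha> n \<le> \<alpha> p" using Suc.prems by blast
    have "del L p \<le> del L n" using p(2) cle \<open>\<alpha> n \<le> \<alpha> p\<close> by linarith
    then have pn: "p = n" using \<open>p \<le> n\<close> nL by (auto simp: del_def)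
    then have cn: "c n = \<alpha> n" using p(2) by simp
    have "(\<Sum>i<L. c i) = c n + (\<Sum>i\<in>{..<L} - {n}. c i)" using nL by (simp add: sum.remove)
    then have "(\<Sum>i\<in>{..<L} - {n}. c i) = 0" using csum cn by simp
    moreover have "\<forall>i. c i \<ge> 0" "\<forall>i\<ge>L. c i = 0" using c by (auto simp: comps_def)
    ultimately have "\<forall>i\<in>{..<L} - {n}. c i = 0" by (subst (asm) sum_nonneg_eq_0_iff) auto
    then have "c i = 0" if "i \<noteq> n" for i
      using that \<open>\<forall>i\<ge>L. c i = 0\<close> by (cases "i < L") auto
    then show ?thesis using cn by (auto simp: c0_def fun_eq_iff)
  qed
  have "alt_tables L (Suc n) (\<lambda>i. \<alpha> i + del L i) \<alpha> = (\<Sum>c\<in>{c0}. alt_tables L n (\<lambda>i. \<alpha> i + del L i - c i) \<alpha>)"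
    unfolding alt_tables_Suc using c0 uniq by (intro sum.mono_neutral_right) auto
  also have "\<dots> = alt_tables L n (\<lambda>i. \<alpha> i + del L i - c0 i) \<alpha>" by simp
  also have "\<dots> = alt_tables L n (\<lambda>i. (if i < n then \<alpha> i else 0) + del L i) (\<lambda>i. if i < n then \<alpha> i else 0)"
    using Suc.prems(4) by (intro alt_tables_cong) (auto simp: c0_def)
  also have "\<dots> = 1"
    using Suc.prems by (intro Suc.IH) auto
  finally show ?case .
qed

text \<open>The determinant is now expanded in both margins, which will turn out to be the inner
  product of two determinantal characters. It alternates in either argument, so that arbitrary
  vectors can be reduced to sorted ones.\<close>

definition alt_tables2 :: "nat \<Rightarrow> (nat \<Rightarrow> int) \<Rightarrow> (nat \<Rightarrow> int) \<Rightarrow> int" where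
  "alt_tables2 L a b = (\<Sum>v\<in>rowperms L. sign v * alt_tables L L a (\<lambda>i. b i - del L (v i)))"

lemma alt_tables2_altdef:
  "alt_tables2 L a b = (\<Sum>u\<in>rowperms L. \<Sum>v\<in>rowperms L. sign u * sign v *
     int (card (tables {..<L} {..<L} (\<lambda>i. a i - del L (u i)) (\<lambda>i. b i - del L (v i)))))"
  unfolding alt_tables2_def alt_tables_def
  by (subst sum.swap) (simp add: sum_distrib_left algebra_simps)

lemma alt_tables2_commute: "alt_tables2 L a b = alt_tables2 L b a"
  unfolding alt_tables2_altdef
  by (subst sum.swap) (simp add: card_tables_swap[of "{..<L}" "{..<L}"] mult.commute)

lemma alt_tables2_cong:
  assumes "\<And>i. i < L \<Longrightarrow> a i = a' i" "\<And>i. i < L \<Longrightarrow> b i = b' i"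
  shows "alt_tables2 L a b = alt_tables2 L a' b'"
proof -
  have "alt_tables L L a (\<lambda>i. b i - del L (v i)) = alt_tables L L a' (\<lambda>i. b' i - del L (v i))" for v
    by (rule alt_tables_cong) (use assms in auto)
  then show ?thesis by (simp add: alt_tables2_def)
qed

lemma alt_tables2_compose_left:
  assumes "\<pi> permutes {..<L}"
  shows "alt_tables2 L (a \<circ> \<pi>) b = sign \<pi> * alt_tables2 L a b"
  by (simp add: alt_tables2_def alt_tables_compose[OF assms] sum_distrib_left algebra_simps)

text \<open>A nonzero term has column content \<beta> + \<delta> - v\<delta>, whose partial sums are
  at least those of \<beta>. Dominance for \<open>alt_tables\<close> therefore passes to \<beta>
  itself.\<close>

lemma alt_tables2_dominance:
  assumes "\<And>i j. i \<le> j \<Longrightarrow> j < L \<Longrightarrow> \<alpha> j \<le> \<alpha> i" "n \<le> L"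
    and "alt_tables2 L (\<lambda>i. \<alpha> i + del L i) (\<lambda>i. \<beta> i + del L i) \<noteq> 0"
  shows "(\<Sum>i<n. \<beta> i) \<le> (\<Sum>i<n. \<alpha> i)"
proof -
  obtain v where v: "v permutes {..<L}"
    and ne: "alt_tables L L (\<lambda>i. \<alpha> i + del L i) (\<lambda>i. \<beta> i + del L i - del L (v i)) \<noteq> 0"
    using assms(3) unfolding alt_tables2_def
    by (metis (no_types, lifting) mem_Collect_eq mult_zero_right sum.neutral)
  have "(\<Sum>i<n. \<beta> i + del L i - del L (v i)) + (\<Sum>i<n. del L i) \<le> (\<Sum>i<n. \<alpha> i + del L i)"
  proof (rule alt_tables_dominance[OF _ _ _ ne])
    fix i j assume "i \<le> j" "j < L"
    then show "\<alpha> j + del L j \<le> \<alpha> i + del L i" using assms(1)[of i j] by (auto simp: del_def)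
  qed (use assms in auto)
  then show ?thesis using sum_del_le[OF v assms(2)] by (simp add: sum.distrib sum_subtractf)
qed

text \<open>If both partitions are \<alpha>, any \<open>v\<close> other than the identity makes some
  partial sum of \<alpha> + \<delta> - v\<delta> too large for dominance, and the identity gives the
  diagonal Kostka number. For different partitions, symmetry of \<open>alt_tables2\<close> would
  give dominance in both directions and hence equal partial sums.\<close>

lemma alt_tables2_orthonormal:
  assumes a: "\<And>i. \<alpha> i \<ge> 0" "\<And>i j. i \<le> j \<Longrightarrow> \<alpha> j \<le> \<alpha> i" "\<And>i. i \<ge> L \<Longrightarrow> \<alpha> i = 0"
    and b: "\<And>i. \<beta> i \<ge> 0" "\<And>i j. i \<le> j \<Longrightarrow> \<beta> j \<le> \<beta> i" "\<And>i. i \<ge> L \<Longrightarrow> \<beta> i = 0"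
  shows "alt_tables2 L (\<lambda>i. \<alpha> i + del L i) (\<lambda>i. \<beta> i + del L i) = of_bool (\<alpha> = \<beta>)"
proof (cases "\<alpha> = \<beta>")
  case True
  have "alt_tables L L (\<lambda>i. \<alpha> i + del L i) (\<lambda>i. \<alpha> i + del L i - del L (v i)) = of_bool (v = id)"
    if v: "v permutes {..<L}" for v
  proof (cases "v = id")
    case True
    then show ?thesis using alt_tables_diagonal[of L L \<alpha>] a by simp
  next
    case False
    then obtain n where n: "n \<le> L" "(\<Sum>i<n. del L (v i)) < (\<Sum>i<n. del L i)"
      using sum_del_less[OF v] by blast
    have "alt_tables L L (\<lambda>i. \<alpha> i + del L i) (\<lambda>i. \<alpha> i + del L i - del L (v i)) = 0"
    proof (rule ccontr)
      assume ne: "alt_tables L L (\<lambda>i. \<alpha> i + del L i) (\<lambda>i. \<alpha> i + del L i - del L (v i)) \<noteq> 0"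
      have "(\<Sum>i<n. \<alpha> i + del L i - del L (v i)) + (\<Sum>i<n. del L i) \<le> (\<Sum>i<n. \<alpha> i + del L i)"
      proof (rule alt_tables_dominance[OF _ _ _ ne])
        fix i j assume "i \<le> j" "j < L"
        then show "\<alpha> j + del L j \<le> \<alpha> i + del L i" using a(2)[of i j] by (auto simp: del_def)
      qed (use n in auto)
      then show False using n by (simp add: sum.distrib sum_subtractf)
    qed
    then show ?thesis using False by simp
  qed
  then have "alt_tables2 L (\<lambda>i. \<alpha> i + del L i) (\<lambda>i. \<alpha> i + del L i) = (\<Sum>v\<in>rowperms L. if v = id then 1 else 0)"
    unfolding alt_tables2_def by (intro sum.cong) auto
  then show ?thesis using True by (simp add: permutes_id)
next
  case False
  have "alt_tables2 L (\<lambda>i. \<alpha> i + del L i) (\<lambda>i. \<beta> i + del L i) = 0"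
  proof (rule ccontr)
    assume ne: "alt_tables2 L (\<lambda>i. \<alpha> i + del L i) (\<lambda>i. \<beta> i + del L i) \<noteq> 0"
    then have ne': "alt_tables2 L (\<lambda>i. \<beta> i + del L i) (\<lambda>i. \<alpha> i + del L i) \<noteq> 0"
      by (simp add: alt_tables2_commute)
    have eq: "(\<Sum>i<n. \<alpha> i) = (\<Sum>i<n. \<beta> i)" if "n \<le> L" for n
      using alt_tables2_dominance[OF a(2) that ne] alt_tables2_dominance[OF b(2) that ne'] by linarith
    have "\<alpha> i = \<beta> i" for i
    proof (cases "i < L")
      case True
      then show ?thesis using eq[of i] eq[of "Suc i"] by simp
    qed (use a(3)[of i] b(3)[of i] in simp)
    then show False using False by blast
  qed
  then show ?thesis using False by simp
qed

section \<open>Determinantal characters\<close>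

text \<open>
  For \<open>a = \<alpha> + \<delta>\<close> this is the Jacobi-Trudi determinant of \<open>\<alpha>\<close>, with permutation
  characters in place of products of complete symmetric functions.
\<close>

definition psi :: "nat \<Rightarrow> nat \<Rightarrow> (nat \<Rightarrow> int) \<Rightarrow> (nat \<Rightarrow> nat) \<Rightarrow> int" where
  "psi L N a \<sigma> = (\<Sum>w\<in>rowperms L. sign w * phi N (\<lambda>i. a i - del L (w i)) \<sigma>)"

definition shifted :: "nat \<Rightarrow> parts \<Rightarrow> nat \<Rightarrow> int" where
  "shifted L \<alpha> i = int (\<alpha> i) + del L i"

text \<open>Under these conditions every vector \<open>a i - del L (w i)\<close> in the determinant
  is supported on \<open>{..<L}\<close> and has total \<open>N\<close>, as the product formulas for
  \<open>phi\<close> require.\<close>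

definition balanced :: "nat \<Rightarrow> nat \<Rightarrow> (nat \<Rightarrow> int) \<Rightarrow> bool" where
  "balanced L N a \<longleftrightarrow> (\<forall>i\<ge>L. a i = 0) \<and> (\<Sum>i<L. a i) = int N + (\<Sum>i<L. del L i)"

lemma del_eq_0: "i \<ge> L \<Longrightarrow> del L i = 0"
  by (simp add: del_def)

lemma balanced_minus_del_outside:
  assumes "balanced L N a" "w permutes {..<L}" "i \<notin> {..<L}"
  shows "a i - del L (w i) = 0"
  using assms permutes_not_in[OF assms(2,3)] by (simp add: balanced_def del_eq_0)

lemma sum_del_permute: "w permutes {..<L} \<Longrightarrow> (\<Sum>i<L. del L (w i)) = (\<Sum>i<L. del L i)"
  using sum.permute[of w "{..<L}" "del L"] by (simp add: o_def)

lemma balanced_minus_del_sum: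
  assumes "balanced L N a" "w permutes {..<L}"
  shows "(\<Sum>i<L. a i - del L (w i)) = int N"
  using assms by (simp add: balanced_def sum_subtractf sum_del_permute)

lemma sum_psi_times_psi:
  assumes a: "balanced L N a" and b: "balanced L N b"
  shows "(\<Sum>\<sigma>\<in>perms N. psi L N a \<sigma> * psi L N b \<sigma>) = fact N * alt_tables2 L a b"
proof -
  let ?a = "\<lambda>u i. a i - del L (u i)" and ?b = "\<lambda>v i. b i - del L (v i)"
  have "(\<Sum>\<sigma>\<in>perms N. psi L N a \<sigma> * psi L N b \<sigma>) =
    (\<Sum>\<sigma>\<in>perms N. \<Sum>u\<in>rowperms L. \<Sum>v\<in>rowperms L. sign u * sign v * (phi N (?a u) \<sigma> * phi N (?b v) \<sigma>))"
    by (simp add: psi_def sum_product algebra_simps)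
  also have "\<dots> = (\<Sum>u\<in>rowperms L. \<Sum>\<sigma>\<in>perms N. \<Sum>v\<in>rowperms L. sign u * sign v * (phi N (?a u) \<sigma> * phi N (?b v) \<sigma>))"
    by (rule sum.swap)
  also have "\<dots> = (\<Sum>u\<in>rowperms L. \<Sum>v\<in>rowperms L. \<Sum>\<sigma>\<in>perms N. sign u * sign v * (phi N (?a u) \<sigma> * phi N (?b v) \<sigma>))"
    by (intro sum.cong refl sum.swap)
  also have "\<dots> = (\<Sum>u\<in>rowperms L. \<Sum>v\<in>rowperms L. sign u * sign v *
      (fact N * int (card (tables {..<L} {..<L} (?a u) (?b v)))))"
  proof (intro sum.cong refl)
    fix u v assume "u \<in> rowperms L" "v \<in> rowperms L"
    then have u: "u permutes {..<L}" and v: "v permutes {..<L}" by auto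
    have "(\<Sum>\<sigma>\<in>perms N. phi N (?a u) \<sigma> * phi N (?b v) \<sigma>) = fact N * int (card (tables {..<L} {..<L} (?a u) (?b v)))"
      by (rule sum_phi_times_phi)
        (simp_all only: finite_lessThan balanced_minus_del_outside[OF a u] balanced_minus_del_outside[OF b v]
          balanced_minus_del_sum[OF a u] simp_thms)
    then show "(\<Sum>\<sigma>\<in>perms N. sign u * sign v * (phi N (?a u) \<sigma> * phi N (?b v) \<sigma>)) =
      sign u * sign v * (fact N * int (card (tables {..<L} {..<L} (?a u) (?b v))))"
      by (simp flip: sum_distrib_left)
  qed
  also have "\<dots> = fact N * alt_tables2 L a b"
    unfolding alt_tables2_altdef by (simp add: sum_distrib_left algebra_simps)
  finally show ?thesis .
qed

section \<open>Three-dimensional tables and triple products\<close>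

text \<open>A three-dimensional table without its slice at third coordinate 0.\<close>

definition slices :: "nat \<Rightarrow> (nat \<Rightarrow> int) \<Rightarrow> ((nat \<times> nat) \<times> nat \<Rightarrow> int) set" where
  "slices L c = {B. (\<forall>x. B x \<ge> 0) \<and> (\<forall>x. x \<notin> ({..<L} \<times> {..<L}) \<times> {1..<L} \<longrightarrow> B x = 0) \<and>
     (\<forall>k\<in>{1..<L}. (\<Sum>x\<in>{..<L} \<times> {..<L}. B (x, k)) = c k)}"

definition fst_margin :: "nat \<Rightarrow> ((nat \<times> nat) \<times> nat \<Rightarrow> int) \<Rightarrow> nat \<Rightarrow> int" where
  "fst_margin L B i = (\<Sum>j<L. \<Sum>k\<in>{1..<L}. B ((i, j), k))"

definition snd_margin :: "nat \<Rightarrow> ((nat \<times> nat) \<times> nat \<Rightarrow> int) \<Rightarrow> nat \<Rightarrow> int" where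
  "snd_margin L B j = (\<Sum>i<L. \<Sum>k\<in>{1..<L}. B ((i, j), k))"

lemma sum_fst_margin:
  assumes "B \<in> slices L c" shows "(\<Sum>i<L. fst_margin L B i) = (\<Sum>k\<in>{1..<L}. c k)"
proof -
  have "(\<Sum>i<L. fst_margin L B i) = (\<Sum>x\<in>{..<L} \<times> {..<L}. \<Sum>k\<in>{1..<L}. B (x, k))"
    unfolding fst_margin_def by (subst sum.cartesian_product) (simp add: case_prod_unfold)
  also have "\<dots> = (\<Sum>k\<in>{1..<L}. \<Sum>x\<in>{..<L} \<times> {..<L}. B (x, k))" by (rule sum.swap)
  also have "\<dots> = (\<Sum>k\<in>{1..<L}. c k)" using assms by (simp add: slices_def)
  finally show ?thesis .
qed

lemma sum_snd_margin:
  assumes "B \<in> slices L c" shows "(\<Sum>i<L. snd_margin L B i) = (\<Sum>k\<in>{1..<L}. c k)"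
proof -
  have "(\<Sum>i<L. snd_margin L B i) = (\<Sum>i<L. fst_margin L B i)"
    unfolding fst_margin_def snd_margin_def by (rule sum.swap)
  then show ?thesis using sum_fst_margin[OF assms] by simp
qed

lemma margin_nonneg: "B \<in> slices L c \<Longrightarrow> fst_margin L B i \<ge> 0" "B \<in> slices L c \<Longrightarrow> snd_margin L B i \<ge> 0"
  by (auto simp: slices_def fst_margin_def snd_margin_def intro!: sum_nonneg)

lemma finite_slices [simp]: "finite (slices L c)"
proof -
  let ?F = "{B :: (nat \<times> nat) \<times> nat \<Rightarrow> int. \<forall>x. (x \<in> ({..<L} \<times> {..<L}) \<times> {1..<L} \<longrightarrow> B x \<in> {0..(\<Sum>k\<in>{1..<L}. \<bar>c k\<bar>)}) \<and>
    (x \<notin> ({..<L} \<times> {..<L}) \<times> {1..<L} \<longrightarrow> B x = 0)}"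
  have "finite ?F" by (intro finite_set_of_finite_funs) auto
  moreover have "slices L c \<subseteq> ?F"
  proof
    fix B assume B: "B \<in> slices L c"
    have "B (x, k) \<le> (\<Sum>k\<in>{1..<L}. \<bar>c k\<bar>)" if x: "x \<in> {..<L} \<times> {..<L}" and k: "k \<in> {1..<L}" for x k
    proof -
      have "B (x, k) \<le> (\<Sum>x\<in>{..<L} \<times> {..<L}. B (x, k))"
        using B x by (intro member_le_sum) (auto simp: slices_def)
      also have "\<dots> = c k" using B k by (simp add: slices_def)
      also have "\<dots> \<le> \<bar>c k\<bar>" by simp
      also have "\<dots> \<le> (\<Sum>k\<in>{1..<L}. \<bar>c k\<bar>)" using k by (intro member_le_sum) auto
      finally show ?thesis .
    qed
    then show "B \<in> ?F" using B unfolding slices_def by auto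
  qed
  ultimately show ?thesis by (rule finite_subset[rotated])
qed

text \<open>Both sides count three-dimensional tables. On the left such a table \<open>P\<close>
  refines its sum \<open>M\<close> along the third direction; on the right it is split into the
  slice at 0 and the rest \<open>B\<close>, and the slice at 0 has the margins that \<open>B\<close>
  leaves over. \<open>M\<close> can be recovered by adding up all slices.\<close>

lemma sum_card_tables_slices:
  assumes L: "L > 0" and eq: "(\<Sum>i<L. a i) = (\<Sum>i<L. c i)"
  shows "(\<Sum>M\<in>tables {..<L} {..<L} a b. card (tables ({..<L} \<times> {..<L}) {..<L} M c)) =
    (\<Sum>B\<in>slices L c. card (tables {..<L} {..<L} (\<lambda>i. a i - fst_margin L B i) (\<lambda>i. b i - snd_margin L B i)))"
proof -
  let ?S = "SIGMA M:tables {..<L} {..<L} a b. tables ({..<L} \<times> {..<L}) {..<L} M c"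
  let ?T = "SIGMA B:slices L c. tables {..<L} {..<L} (\<lambda>i. a i - fst_margin L B i) (\<lambda>i. b i - snd_margin L B i)"
  let ?f = "\<lambda>(M :: nat \<times> nat \<Rightarrow> int, P). (\<lambda>(x, k). if k = (0::nat) then 0 else P (x, k) :: int, \<lambda>x. P (x, 0))"
  let ?g = "\<lambda>(B, M). (\<lambda>x :: nat \<times> nat. M x + (\<Sum>k\<in>{1..<L}. B (x, k)) :: int, \<lambda>(x, k). if k = (0::nat) then M x else B (x, k))"
  have split0: "(\<Sum>k<L. h k) = h 0 + (\<Sum>k\<in>{1..<L}. h k)" for h :: "nat \<Rightarrow> int"
    using L by (metis One_nat_def lessThan_atLeast0 sum.atLeast_Suc_lessThan)
  have drop0: "(\<Sum>k\<in>{1..<L}. if k = 0 then u else h k) = (\<Sum>k\<in>{1..<L}. h k)" for u :: int and h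
    by (rule sum.cong) auto
  have "bij_betw ?f ?S ?T"
  proof (rule bij_betw_byWitness[where f' = ?g])
    show "\<forall>y\<in>?S. ?g (?f y) = y"
    proof
      fix y assume y: "y \<in> ?S"
      obtain M P where y_eq: "y = (M, P)" by (cases y)
      have M: "M \<in> tables {..<L} {..<L} a b" and P: "P \<in> tables ({..<L} \<times> {..<L}) {..<L} M c"
        using y by (auto simp: y_eq)
      have "P (x, 0) + (\<Sum>k\<in>{1..<L}. P (x, k)) = M x" for x
      proof (cases "x \<in> {..<L} \<times> {..<L}")
        case True
        then have "(\<Sum>k<L. P (x, k)) = M x" using P unfolding tables_def by blast
        then show ?thesis by (simp add: split0)
      next
        case False
        then have "M x = 0" "\<And>k. P (x, k) = 0" using M P unfolding tables_def by blast+
        then show ?thesis by simp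
      qed
      then show "?g (?f y) = y" by (auto simp: y_eq drop0 fun_eq_iff)
    qed
    show "\<forall>y\<in>?T. ?f (?g y) = y" by (auto simp: slices_def fun_eq_iff)
    show "?f ` ?S \<subseteq> ?T"
    proof (rule image_subsetI)
      fix y assume y: "y \<in> ?S"
      obtain M P where y_eq: "y = (M, P)" by (cases y)
      have M: "M \<in> tables {..<L} {..<L} a b" and P: "P \<in> tables ({..<L} \<times> {..<L}) {..<L} M c"
        using y by (auto simp: y_eq)
      let ?B = "\<lambda>(x, k). if k = (0::nat) then 0 else P (x, k)"
      have Pnn: "P x \<ge> 0" for x using P unfolding tables_def by blast
      have P0: "P (x, k) = 0" if "x \<notin> {..<L} \<times> {..<L} \<or> k \<notin> {..<L}" for x k
        using P that unfolding tables_def by blast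
      have Pr: "P (x, 0) = M x - (\<Sum>k\<in>{1..<L}. P (x, k))" if "x \<in> {..<L} \<times> {..<L}" for x
        
      proof -
        have "(\<Sum>k<L. P (x, k)) = M x" using P that unfolding tables_def by blast
        then show ?thesis by (simp add: split0)
      qed
      have Pc: "(\<Sum>x\<in>{..<L} \<times> {..<L}. P (x, k)) = c k" if "k < L" for k
        using P that by (simp add: tables_def)
      have "?B \<in> slices L c"
        using Pnn Pc P0 by (auto simp: slices_def split: if_splits)
      moreover have "(\<lambda>x. P (x, 0)) \<in> tables {..<L} {..<L} (\<lambda>i. a i - fst_margin L ?B i) (\<lambda>i. b i - snd_margin L ?B i)"
      proof -
        have "(\<Sum>j<L. P ((i, j), 0)) = a i - fst_margin L ?B i" if "i < L" for i
          using M that by (simp add: Pr tables_def sum_subtractf fst_margin_def drop0)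
        moreover have "(\<Sum>i<L. P ((i, j), 0)) = b j - snd_margin L ?B j" if "j < L" for j
          using M that by (simp add: Pr tables_def sum_subtractf snd_margin_def drop0)
        ultimately show ?thesis using Pnn P0 unfolding tables_def by blast
      qed
      ultimately show "?f y \<in> ?T" by (simp add: y_eq)
    qed
    show "?g ` ?T \<subseteq> ?S"
    proof (rule image_subsetI)
      fix y assume y: "y \<in> ?T"
      obtain B M where y_eq: "y = (B, M)" by (cases y)
      have B: "B \<in> slices L c"
        and M: "M \<in> tables {..<L} {..<L} (\<lambda>i. a i - fst_margin L B i) (\<lambda>i. b i - snd_margin L B i)"
        using y by (auto simp: y_eq)
      let ?M = "\<lambda>x. M x + (\<Sum>k\<in>{1..<L}. B (x, k))" and ?P = "\<lambda>(x, k). if k = (0::nat) then M x else B (x, k)"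
      have Mnn: "M x \<ge> 0" and Bnn: "B z \<ge> 0" for x z using M B unfolding tables_def slices_def by blast+
      have M0: "M x = 0" if "x \<notin> {..<L} \<times> {..<L}" for x using M that unfolding tables_def by blast
      have B0: "B (x, k) = 0" if "x \<notin> {..<L} \<times> {..<L} \<or> k \<notin> {1..<L}" for x k
        using B that unfolding slices_def by blast
      have r: "(\<Sum>j<L. ?M (i, j)) = a i" if "i < L" for i
        using M that by (simp add: tables_def sum.distrib fst_margin_def)
      have s: "(\<Sum>i<L. ?M (i, j)) = b j" if "j < L" for j
        using M that by (simp add: tables_def sum.distrib snd_margin_def)
      have nn: "?M x \<ge> 0" for x by (intro add_nonneg_nonneg sum_nonneg Mnn Bnn)
      have z: "?M x = 0" if "x \<notin> {..<L} \<times> {..<L}" for x using M0[OF that] B0 that by simp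
      have "?M \<in> tables {..<L} {..<L} a b" using r s nn z unfolding tables_def by blast
      moreover have "?P \<in> tables ({..<L} \<times> {..<L}) {..<L} ?M c"
      proof -
        have "(\<Sum>k<L. ?P (x, k)) = ?M x" for x by (simp add: split0 drop0)
        moreover have "(\<Sum>x\<in>{..<L} \<times> {..<L}. ?P (x, k)) = c k" if k: "k < L" for k
        proof (cases "k = 0")
          case True
          \<comment> \<open>The total of the slice at 0 is not prescribed directly: it is what
            \<open>B\<close> leaves of the total of \<open>a\<close>, which equals that of
            \<open>c\<close>.\<close>
          have "(\<Sum>x\<in>{..<L} \<times> {..<L}. M x) = (\<Sum>i<L. c i) - (\<Sum>k\<in>{1..<L}. c k)"
            using sum_tables[OF M] sum_fst_margin[OF B] eq by (simp add: sum_subtractf)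
          also have "\<dots> = c 0" by (simp add: split0)
          finally show ?thesis using True by simp
        qed (use B k in \<open>auto simp: slices_def\<close>)
        moreover have "?P y \<ge> 0" for y by (cases y) (simp add: Mnn Bnn del: split_paired_All)
        moreover have "?P y = 0" if "y \<notin> ({..<L} \<times> {..<L}) \<times> {..<L}" for y
          using that M0 B0 L by (cases y) (auto split: if_splits)
        ultimately show ?thesis unfolding tables_def by blast
      qed
      ultimately show "?g y \<in> ?S" by (simp add: y_eq)
    qed
  qed
  then have "card ?S = card ?T" by (rule bij_betw_same_card)
  then show ?thesis by (simp add: card_SigmaI)
qed

lemma sum_phi_times_phi_times_phi:
  assumes L: "L > 0" and a: "\<And>i. i \<notin> {..<L} \<Longrightarrow> a i = 0" "(\<Sum>i<L. a i) = int N"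
    and b: "\<And>i. i \<notin> {..<L} \<Longrightarrow> b i = 0" and c: "\<And>i. i \<notin> {..<L} \<Longrightarrow> c i = 0" "(\<Sum>i<L. c i) = int N"
  shows "(\<Sum>\<sigma>\<in>perms N. phi N a \<sigma> * phi N b \<sigma> * phi N c \<sigma>) = fact N *
    (\<Sum>B\<in>slices L c. int (card (tables {..<L} {..<L} (\<lambda>i. a i - fst_margin L B i) (\<lambda>i. b i - snd_margin L B i))))"
proof -
  have "(\<Sum>\<sigma>\<in>perms N. phi N a \<sigma> * phi N b \<sigma> * phi N c \<sigma>) =
    (\<Sum>\<sigma>\<in>perms N. \<Sum>M\<in>tables {..<L} {..<L} a b. phi N M \<sigma> * phi N c \<sigma>)"
  proof (intro sum.cong refl)
    fix \<sigma> assume \<sigma>: "\<sigma> \<in> perms N"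
    have "phi N a \<sigma> * phi N b \<sigma> = (\<Sum>M\<in>tables {..<L} {..<L} a b. phi N M \<sigma>)"
      using phi_times_phi[of "{..<L}" a "{..<L}" b \<sigma> N] a(1) b \<sigma> by blast
    then show "phi N a \<sigma> * phi N b \<sigma> * phi N c \<sigma> = (\<Sum>M\<in>tables {..<L} {..<L} a b. phi N M \<sigma> * phi N c \<sigma>)"
      by (simp add: sum_distrib_right)
  qed
  also have "\<dots> = (\<Sum>M\<in>tables {..<L} {..<L} a b. \<Sum>\<sigma>\<in>perms N. phi N M \<sigma> * phi N c \<sigma>)"
    by (rule sum.swap)
  also have "\<dots> = (\<Sum>M\<in>tables {..<L} {..<L} a b. fact N * int (card (tables ({..<L} \<times> {..<L}) {..<L} M c)))"
  proof (intro sum.cong refl)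
    fix M assume M: "M \<in> tables {..<L} {..<L} a b"
    show "(\<Sum>\<sigma>\<in>perms N. phi N M \<sigma> * phi N c \<sigma>) = fact N * int (card (tables ({..<L} \<times> {..<L}) {..<L} M c))"
    proof (rule sum_phi_times_phi)
      show "M x = 0" if "x \<notin> {..<L} \<times> {..<L}" for x using M that unfolding tables_def by blast
      show "(\<Sum>x\<in>{..<L} \<times> {..<L}. M x) = int N" using sum_tables[OF M] a by simp
    qed (use c in simp_all)
  qed
  also have "\<dots> = fact N * int (\<Sum>M\<in>tables {..<L} {..<L} a b. card (tables ({..<L} \<times> {..<L}) {..<L} M c))"
    by (simp add: sum_distrib_left)
  also have "(\<Sum>M\<in>tables {..<L} {..<L} a b. card (tables ({..<L} \<times> {..<L}) {..<L} M c)) =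
    (\<Sum>B\<in>slices L c. card (tables {..<L} {..<L} (\<lambda>i. a i - fst_margin L B i) (\<lambda>i. b i - snd_margin L B i)))"
    using L a(2) c(2) by (intro sum_card_tables_slices) simp_all
  finally show ?thesis by simp
qed

text \<open>The determinants of the first two factors are expanded innermost, so that for fixed
  \<open>w\<close> and \<open>B\<close> they combine to \<open>alt_tables2\<close> of the reduced
  margins.\<close>

definition triple :: "nat \<Rightarrow> (nat \<Rightarrow> int) \<Rightarrow> (nat \<Rightarrow> int) \<Rightarrow> (nat \<Rightarrow> int) \<Rightarrow> int" where
  "triple L a b c = (\<Sum>w\<in>rowperms L. sign w * (\<Sum>B\<in>slices L (\<lambda>i. c i - del L (w i)).
     alt_tables2 L (\<lambda>i. a i - fst_margin L B i) (\<lambda>i. b i - snd_margin L B i)))"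

lemma sum_psi_times_psi_times_psi:
  assumes L: "L > 0" and a: "balanced L N a" and b: "balanced L N b" and c: "balanced L N c"
  shows "(\<Sum>\<sigma>\<in>perms N. psi L N a \<sigma> * psi L N b \<sigma> * psi L N c \<sigma>) = fact N * triple L a b c"
proof -
  let ?a = "\<lambda>u i. a i - del L (u i)" and ?b = "\<lambda>v i. b i - del L (v i)" and ?c = "\<lambda>w i. c i - del L (w i)"
  let ?R = "rowperms L"
  let ?t = "\<lambda>u v B. tables {..<L} {..<L} (\<lambda>i. a i - fst_margin L B i - del L (u i)) (\<lambda>i. b i - snd_margin L B i - del L (v i))"
  have "(\<Sum>\<sigma>\<in>perms N. psi L N a \<sigma> * psi L N b \<sigma> * psi L N c \<sigma>) =
    (\<Sum>\<sigma>\<in>perms N. \<Sum>w\<in>?R. \<Sum>u\<in>?R. \<Sum>v\<in>?R. sign w * (sign u * sign v) *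
      (phi N (?a u) \<sigma> * phi N (?b v) \<sigma> * phi N (?c w) \<sigma>))"
  proof (rule sum.cong)
    fix \<sigma>
    have "psi L N a \<sigma> * psi L N b \<sigma> * psi L N c \<sigma> = (\<Sum>w\<in>?R. sign w * phi N (?c w) \<sigma> *
      (\<Sum>u\<in>?R. \<Sum>v\<in>?R. (sign u * phi N (?a u) \<sigma>) * (sign v * phi N (?b v) \<sigma>)))"
      unfolding psi_def sum_product[symmetric] by (subst sum_distrib_right[symmetric]) (rule mult.commute)
    also have "\<dots> = (\<Sum>w\<in>?R. \<Sum>u\<in>?R. \<Sum>v\<in>?R. sign w * (sign u * sign v) *
      (phi N (?a u) \<sigma> * phi N (?b v) \<sigma> * phi N (?c w) \<sigma>))"
      unfolding sum_distrib_left by (simp only: ac_simps)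
    finally show "psi L N a \<sigma> * psi L N b \<sigma> * psi L N c \<sigma> = \<dots>" .
  qed simp
  also have "\<dots> = (\<Sum>w\<in>?R. \<Sum>u\<in>?R. \<Sum>v\<in>?R. \<Sum>\<sigma>\<in>perms N. sign w * (sign u * sign v) *
      (phi N (?a u) \<sigma> * phi N (?b v) \<sigma> * phi N (?c w) \<sigma>))"
    by (simp add: sum.swap[of _ "perms N"])
  also have "\<dots> = (\<Sum>w\<in>?R. \<Sum>u\<in>?R. \<Sum>v\<in>?R. sign w * (sign u * sign v) *
      (fact N * (\<Sum>B\<in>slices L (?c w). int (card (?t u v B)))))"
  proof (intro sum.cong refl)
    fix w u v assume "w \<in> ?R" "u \<in> ?R" "v \<in> ?R"
    then have w: "w permutes {..<L}" and u: "u permutes {..<L}" and v: "v permutes {..<L}" by auto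
    have "(\<Sum>\<sigma>\<in>perms N. phi N (?a u) \<sigma> * phi N (?b v) \<sigma> * phi N (?c w) \<sigma>) = fact N *
      (\<Sum>B\<in>slices L (?c w). int (card (tables {..<L} {..<L} (\<lambda>i. ?a u i - fst_margin L B i) (\<lambda>i. ?b v i - snd_margin L B i))))"
      by (rule sum_phi_times_phi_times_phi[OF L])
        (simp_all only: balanced_minus_del_outside[OF a u] balanced_minus_del_outside[OF b v]
          balanced_minus_del_outside[OF c w] balanced_minus_del_sum[OF a u] balanced_minus_del_sum[OF c w] simp_thms)
    also have "\<dots> = fact N * (\<Sum>B\<in>slices L (?c w). int (card (?t u v B)))"
      by (simp add: algebra_simps)
    finally show "(\<Sum>\<sigma>\<in>perms N. sign w * (sign u * sign v) * (phi N (?a u) \<sigma> * phi N (?b v) \<sigma> * phi N (?c w) \<sigma>)) =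
      sign w * (sign u * sign v) * (fact N * (\<Sum>B\<in>slices L (?c w). int (card (?t u v B))))"
      by (simp only: flip: sum_distrib_left)
  qed
  also have "\<dots> = (\<Sum>w\<in>?R. fact N * (sign w * (\<Sum>u\<in>?R. \<Sum>v\<in>?R. \<Sum>B\<in>slices L (?c w).
      sign u * sign v * int (card (?t u v B)))))"
    by (simp add: sum_distrib_left algebra_simps)
  also have "\<dots> = (\<Sum>w\<in>?R. fact N * (sign w * (\<Sum>B\<in>slices L (?c w). \<Sum>u\<in>?R. \<Sum>v\<in>?R.
      sign u * sign v * int (card (?t u v B)))))"
    by (simp add: sum.swap[of _ "slices L _"])
  also have "\<dots> = fact N * triple L a b c"
    by (simp add: triple_def alt_tables2_altdef sum_distrib_left)
  finally show ?thesis .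
qed

section \<open>Raising the first entries of both margins\<close>

lemma strictly_decreasing_gap:
  fixes a :: "nat \<Rightarrow> int"
  assumes "\<And>i j. i < j \<Longrightarrow> j < L \<Longrightarrow> a j < a i" "i \<le> j" "j < L"
  shows "a j + int (j - i) \<le> a i"
  using assms(2,3)
proof (induction j rule: dec_induct)
  case (step j)
  then show ?case using assms(1)[of j "Suc j"] by (simp add: Suc_diff_le)
qed simp

text \<open>Subtracting \<delta> from a strictly decreasing nonnegative vector leaves a partition,
  and orthonormality applies. Entries from \<open>L\<close> on are reset to 0:
  \<open>alt_tables2\<close> does not see them, but equality of partitions does.\<close>

lemma alt_tables2_strictly_decreasing:
  assumes a: "\<And>i. i < L \<Longrightarrow> a i \<ge> 0" "\<And>i j. i < j \<Longrightarrow> j < L \<Longrightarrow> a j < a i"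
    and b: "\<And>i. i < L \<Longrightarrow> b i \<ge> 0" "\<And>i j. i < j \<Longrightarrow> j < L \<Longrightarrow> b j < b i"
  shows "alt_tables2 L a b = of_bool (\<forall>i<L. a i = b i)"
proof -
  define part where "part x i = (if i < L then x i - del L i else 0)" for x :: "nat \<Rightarrow> int" and i
  have nonneg: "part x i \<ge> 0" if "\<And>i. i < L \<Longrightarrow> x i \<ge> 0" "\<And>i j. i < j \<Longrightarrow> j < L \<Longrightarrow> x j < x i" for x i
    using strictly_decreasing_gap[of L x i "L - 1"] that(1)[of "L - 1"] that(2) by (fastforce simp: part_def del_def)
  have mono: "part x j \<le> part x i" if "\<And>i. i < L \<Longrightarrow> x i \<ge> 0" "\<And>i j. i < j \<Longrightarrow> j < L \<Longrightarrow> x j < x i" "i \<le> j" for x i j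
  proof (cases "j < L")
    case True
    then show ?thesis using strictly_decreasing_gap[of L x i j] that(2,3) by (auto simp: part_def del_def)
  next
    case False
    then show ?thesis using nonneg[of x i] that(1,2) by (simp add: part_def)
  qed
  have out: "part x i = 0" if "i \<ge> L" for x i using that by (simp add: part_def)
  have "alt_tables2 L a b = alt_tables2 L (\<lambda>i. part a i + del L i) (\<lambda>i. part b i + del L i)"
    by (rule alt_tables2_cong) (auto simp: part_def)
  also have "\<dots> = of_bool (part a = part b)"
    by (rule alt_tables2_orthonormal) (use nonneg mono out a b in blast)+
  also have "part a = part b \<longleftrightarrow> (\<forall>i<L. a i = b i)"
    by (auto simp: part_def fun_eq_iff)
  finally show ?thesis .
qed

lemma ex_sorting_permutation:
  fixes a :: "nat \<Rightarrow> int"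
  assumes "inj_on a {..<L}"
  obtains \<pi> where "\<pi> permutes {..<L}" "\<And>i j. i < j \<Longrightarrow> j < L \<Longrightarrow> (a \<circ> \<pi>) j < (a \<circ> \<pi>) i"
proof -
  define ys where "ys = sort_key (\<lambda>i. - a i) [0..<L]"
  have ys: "set ys = {..<L}" "distinct ys" "length ys = L" by (auto simp: ys_def)
  define \<pi> where "\<pi> i = (if i < L then ys ! i else i)" for i
  have "bij_betw (\<lambda>i. ys ! i) {..<L} {..<L}" 
    by (rule bij_betw_nth) (simp_all add: ys)
  then have "bij_betw \<pi> {..<L} {..<L}" by (rule bij_betw_cong[THEN iffD1, rotated]) (simp add: \<pi>_def)
  then have p: "\<pi> permutes {..<L}" by (rule bij_imp_permutes) (simp add: \<pi>_def)
  have "a (\<pi> j) < a (\<pi> i)" if "i < j" "j < L" for i j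
  proof -
    have "map (\<lambda>i. - a i) ys ! i \<le> map (\<lambda>i. - a i) ys ! j"
      using that ys by (intro sorted_nth_mono) (auto simp: ys_def)
    then have "a (\<pi> j) \<le> a (\<pi> i)" using that ys by (simp add: \<pi>_def)
    moreover have "\<pi> i \<noteq> \<pi> j" using permutes_inj[OF p] that by (auto dest: injD)
    then have "a (\<pi> i) \<noteq> a (\<pi> j)"
      using assms that ys by (auto simp: \<pi>_def inj_on_def) (metis lessThan_iff nth_mem order.strict_trans ys(1))
    ultimately show ?thesis by simp
  qed
  then show thesis using that[OF p] by simp
qed

text \<open>If \<open>\<pi> i \<ge> k\<close> for some \<open>i < k\<close>, then each of the
  \<open>k\<close> indices below \<open>k\<close> carries a larger value than \<open>\<pi> i\<close>
  and must be sorted to a place before \<open>i\<close>; but there are only \<open>i\<close> such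
  places.\<close>

lemma sorting_permutation_preserves_initial:
  fixes a :: "nat \<Rightarrow> int"
  assumes p: "\<pi> permutes {..<L}" and sorted: "\<And>i j. i < j \<Longrightarrow> j < L \<Longrightarrow> (a \<circ> \<pi>) j < (a \<circ> \<pi>) i"
    and k: "k \<le> L" and sep: "\<And>i j. i < k \<Longrightarrow> k \<le> j \<Longrightarrow> j < L \<Longrightarrow> a j < a i"
  shows "\<pi> i < k \<longleftrightarrow> i < k"
proof -
  have pL: "\<pi> i < L \<longleftrightarrow> i < L" for i using permutes_in_image[OF p, of i] by simp
  have lt: "\<pi> i < k" if i: "i < k" for i
  proof (rule ccontr)
    assume ge: "\<not> \<pi> i < k"
    have "inv \<pi> ` {..<k} \<subseteq> {..<i}"
    proof (rule image_subsetI)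
      fix x assume x: "x \<in> {..<k}"
      have xx: "\<pi> (inv \<pi> x) = x" using permutes_inverses(1)[OF p] .
      then have xL: "inv \<pi> x < L" using pL[of "inv \<pi> x"] x k by simp
      have "a (\<pi> i) < a x" using sep[of x "\<pi> i"] x ge pL[of i] i k by auto
      then have "\<not> i \<le> inv \<pi> x"
        using sorted[of i "inv \<pi> x"] xL xx by (cases "i = inv \<pi> x") auto
      then show "inv \<pi> x \<in> {..<i}" by simp
    qed
    then have "card (inv \<pi> ` {..<k}) \<le> i" using card_mono[of "{..<i}" "inv \<pi> ` {..<k}"] by simp
    moreover have "card (inv \<pi> ` {..<k}) = k"
      using permutes_inj_on[OF permutes_inv[OF p]] by (simp add: card_image)
    ultimately show False using i by simp
  qed
  have "\<pi> ` {..<k} = {..<k}"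
    using lt permutes_inj_on[OF p] by (intro card_subset_eq) (auto simp: card_image)
  then show ?thesis using lt permutes_inj[OF p] by (metis imageE injD lessThan_iff)
qed

lemma alt_tables2_inj_on: "alt_tables2 L a b \<noteq> 0 \<Longrightarrow> inj_on a {..<L}"
  unfolding alt_tables2_def
  by (metis (no_types, lifting) alt_tables_inj_on mult_zero_right sum.neutral)

text \<open>Subtracting an entry of \<delta> keeps a negative entry negative, so it cannot be a row
  sum.\<close>

lemma alt_tables2_nonneg:
  assumes "alt_tables2 L a b \<noteq> 0" "i < L"
  shows "a i \<ge> 0"
proof (rule ccontr)
  assume neg: "\<not> a i \<ge> 0"
  have "tables {..<L} {..<L} (\<lambda>i. a i - del L (u i)) c = {}" for u c
  proof (rule ccontr)
    assume "tables {..<L} {..<L} (\<lambda>i. a i - del L (u i)) c \<noteq> {}"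
    then obtain M where M: "M \<in> tables {..<L} {..<L} (\<lambda>i. a i - del L (u i)) c" by blast
    then have "a i - del L (u i) = (\<Sum>j<L. M (i, j))" using assms(2) by (simp add: tables_def)
    also have "\<dots> \<ge> 0" using M by (intro sum_nonneg) (simp add: tables_def)
    finally show False using neg by (simp add: del_def)
  qed
  then show False using assms(1) by (simp add: alt_tables2_altdef)
qed

definition raise :: "nat \<Rightarrow> nat \<Rightarrow> (nat \<Rightarrow> int) \<Rightarrow> nat \<Rightarrow> int" where
  "raise t k a i = (if i < k then a i + int t else a i)"

text \<open>Both sides vanish unless both vectors are injective and nonnegative, which is unaffected
  by raising. Otherwise both vectors are sorted; the sorted vectors agree exactly if the raised ones
  do, and the signs of the sorting permutations are the same on both sides.\<close>

lemma alt_tables2_raise: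
  assumes k: "k \<le> L"
    and a: "\<And>i. i < k \<Longrightarrow> a i \<ge> 0" "\<And>i j. i < k \<Longrightarrow> k \<le> j \<Longrightarrow> j < L \<Longrightarrow> a j < a i"
    and b: "\<And>i. i < k \<Longrightarrow> b i \<ge> 0" "\<And>i j. i < k \<Longrightarrow> k \<le> j \<Longrightarrow> j < L \<Longrightarrow> b j < b i"
  shows "alt_tables2 L (raise t k a) (raise t k b) = alt_tables2 L a b"
proof -
  define good where "good x \<longleftrightarrow> inj_on x {..<L} \<and> (\<forall>i<L. x i \<ge> 0)" for x :: "nat \<Rightarrow> int"
  have bad: "alt_tables2 L x y = 0" if "\<not> good x \<or> \<not> good y" for x y
  proof (rule ccontr)
    assume ne: "alt_tables2 L x y \<noteq> 0"
    then have ne': "alt_tables2 L y x \<noteq> 0" by (simp add: alt_tables2_commute)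
    show False using that alt_tables2_inj_on[OF ne] alt_tables2_inj_on[OF ne']
      alt_tables2_nonneg[OF ne] alt_tables2_nonneg[OF ne'] by (auto simp: good_def)
  qed
  have good_raise: "good (raise t k x) \<longleftrightarrow> good x"
    if x: "\<And>i. i < k \<Longrightarrow> x i \<ge> 0" "\<And>i j. i < k \<Longrightarrow> k \<le> j \<Longrightarrow> j < L \<Longrightarrow> x j < x i" for x
  proof -
    have "raise t k x i = raise t k x j \<longleftrightarrow> x i = x j" if "i < L" "j < L" for i j
      using x(2)[of i j] x(2)[of j i] that by (auto simp: raise_def)
    then have "inj_on (raise t k x) {..<L} \<longleftrightarrow> inj_on x {..<L}" by (simp add: inj_on_def)
    moreover have "raise t k x i \<ge> 0 \<longleftrightarrow> x i \<ge> 0" for i using x(1)[of i] by (auto simp: raise_def)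
    ultimately show ?thesis by (simp add: good_def)
  qed
  show ?thesis
  proof (cases "good a \<and> good b")
    case False
    then show ?thesis using good_raise[of a] good_raise[of b] a b bad by metis
  next
    case True
    obtain \<pi> where \<pi>: "\<pi> permutes {..<L}" "\<And>i j. i < j \<Longrightarrow> j < L \<Longrightarrow> (a \<circ> \<pi>) j < (a \<circ> \<pi>) i"
      using ex_sorting_permutation True by (metis good_def)
    obtain \<rho> where \<rho>: "\<rho> permutes {..<L}" "\<And>i j. i < j \<Longrightarrow> j < L \<Longrightarrow> (b \<circ> \<rho>) j < (b \<circ> \<rho>) i"
      using ex_sorting_permutation True by (metis good_def)
    have \<pi>k: "\<pi> i < k \<longleftrightarrow> i < k" for i
      using sorting_permutation_preserves_initial[OF \<pi> k] a(2) by blast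
    have \<rho>k: "\<rho> i < k \<longleftrightarrow> i < k" for i
      using sorting_permutation_preserves_initial[OF \<rho> k] b(2) by blast
    \<comment> \<open>A permutation that preserves the set of the first \<open>k\<close> indices
      commutes with \<open>raise\<close>, so the same permutations sort the raised vectors.\<close>
    have r\<pi>: "raise t k x \<circ> \<pi> = raise t k (x \<circ> \<pi>)" for x by (simp add: fun_eq_iff raise_def \<pi>k)
    have r\<rho>: "raise t k x \<circ> \<rho> = raise t k (x \<circ> \<rho>)" for x by (simp add: fun_eq_iff raise_def \<rho>k)
    have nn: "(x \<circ> p) i \<ge> 0" if "good x" "p permutes {..<L}" "i < L" for x p i
      using that permutes_in_image[OF that(2), of i] by (simp add: good_def)
    have cmp: "alt_tables2 L (x \<circ> \<pi>) (y \<circ> \<rho>) = sign \<pi> * (sign \<rho> * alt_tables2 L x y)" for x y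
      by (metis alt_tables2_commute alt_tables2_compose_left \<pi>(1) \<rho>(1))
    have sd: "raise t k x j < raise t k x i" if "\<And>i j. i < j \<Longrightarrow> j < L \<Longrightarrow> x j < x i" "i < j" "j < L" for x i j
      using that(1)[OF that(2,3)] that(2) by (auto simp: raise_def)
    have rn: "raise t k x i \<ge> 0" if "x i \<ge> 0" for x i using that by (simp add: raise_def)
    have "alt_tables2 L (raise t k (a \<circ> \<pi>)) (raise t k (b \<circ> \<rho>)) =
      of_bool (\<forall>i<L. raise t k (a \<circ> \<pi>) i = raise t k (b \<circ> \<rho>) i)"
    proof (rule alt_tables2_strictly_decreasing)
      fix i assume i: "i < L"
      show "raise t k (a \<circ> \<pi>) i \<ge> 0" "raise t k (b \<circ> \<rho>) i \<ge> 0"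
        using True \<pi>(1) \<rho>(1) i by (blast intro: rn nn)+
    next
      fix i j :: nat assume "i < j" "j < L"
      then show "raise t k (a \<circ> \<pi>) j < raise t k (a \<circ> \<pi>) i" "raise t k (b \<circ> \<rho>) j < raise t k (b \<circ> \<rho>) i"
        using sd[of "a \<circ> \<pi>" i j] sd[of "b \<circ> \<rho>" i j] \<pi>(2) \<rho>(2) by blast+
    qed
    also have "\<dots> = of_bool (\<forall>i<L. (a \<circ> \<pi>) i = (b \<circ> \<rho>) i)" by (simp add: raise_def)
    also have "\<dots> = alt_tables2 L (a \<circ> \<pi>) (b \<circ> \<rho>)"
    proof (rule alt_tables2_strictly_decreasing[symmetric])
      fix i assume i: "i < L"
      show "(a \<circ> \<pi>) i \<ge> 0" "(b \<circ> \<rho>) i \<ge> 0"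
        using True \<pi>(1) \<rho>(1) i by (blast intro: nn)+
    qed (use \<pi>(2) \<rho>(2) in blast)+
    finally have "sign \<pi> * (sign \<rho> * alt_tables2 L (raise t k a) (raise t k b)) = sign \<pi> * (sign \<rho> * alt_tables2 L a b)"
      by (simp only: flip: r\<pi> r\<rho> cmp)
    moreover have "sign \<pi> \<noteq> 0" "sign \<rho> \<noteq> 0" by (simp_all add: sign_def)
    ultimately show ?thesis by simp
  qed
qed

section \<open>Partitions and stability of the signed count\<close>

lemma partitions_antimono: "\<alpha> \<in> partitions n \<Longrightarrow> i \<le> j \<Longrightarrow> \<alpha> j \<le> \<alpha> i"
  by (auto simp: partitions_def antimono_def)

lemma partitions_psize: "\<alpha> \<in> partitions n \<Longrightarrow> psize \<alpha> = n"
  by (simp add: partitions_def)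

text \<open>A nonzero part at \<open>i\<close> forces \<open>i + 1\<close> parts to be at least 1,
  which exceeds the size. Thus \<open>N \<le> L\<close> makes the determinant large enough for every
  partition of \<open>N\<close>.\<close>

lemma partitions_zero:
  assumes "\<alpha> \<in> partitions n" "i \<ge> n"
  shows "\<alpha> i = 0"
proof (rule ccontr)
  assume ne: "\<alpha> i \<noteq> 0"
  have fin: "finite {i. \<alpha> i \<noteq> 0}" using assms by (simp add: partitions_def)
  have "{..i} \<subseteq> {i. \<alpha> i \<noteq> 0}" 
  proof
    fix j assume "j \<in> {..i}"
    then show "j \<in> {i. \<alpha> i \<noteq> 0}" using ne partitions_antimono[OF assms(1), of j i] by auto
  qed
  then have "(\<Sum>j\<le>i. \<alpha> j) \<le> psize \<alpha>" unfolding psize_def using fin by (intro sum_mono2) auto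
  moreover have "(\<Sum>j\<le>i. 1) \<le> (\<Sum>j\<le>i. \<alpha> j)"
    using \<open>{..i} \<subseteq> {i. \<alpha> i \<noteq> 0}\<close> by (intro sum_mono) (auto simp: Suc_le_eq)
  ultimately show False using assms by (simp add: partitions_psize)
qed

lemma psize_eq_sum:
  assumes "\<And>i. i \<ge> L \<Longrightarrow> \<alpha> i = 0" shows "psize \<alpha> = (\<Sum>i<L. \<alpha> i)"
  unfolding psize_def
proof (rule sum.mono_neutral_left)
  show "{i. \<alpha> i \<noteq> 0} \<subseteq> {..<L}"
  proof
    fix i assume "i \<in> {i. \<alpha> i \<noteq> 0}"
    then show "i \<in> {..<L}" using assms[of i] by (cases "i < L") auto
  qed
qed auto

lemma partitions_sum:
  assumes "\<alpha> \<in> partitions n" "\<And>i. i \<ge> L \<Longrightarrow> \<alpha> i = 0"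
  shows "(\<Sum>i<L. \<alpha> i) = n"
  using psize_eq_sum[of L \<alpha>] assms by (simp add: partitions_psize)

lemma balanced_shifted:
  assumes "\<alpha> \<in> partitions n" "\<And>i. i \<ge> L \<Longrightarrow> \<alpha> i = 0"
  shows "balanced L n (shifted L \<alpha>)"
  using partitions_sum[OF assms] assms(2)
  by (simp add: balanced_def shifted_def sum.distrib del_eq_0 flip: of_nat_sum)

lemma sum_psi_orthonormal:
  assumes L: "N \<le> L" and \<alpha>: "\<alpha> \<in> partitions N" and \<beta>: "\<beta> \<in> partitions N"
  shows "(\<Sum>\<sigma>\<in>perms N. psi L N (shifted L \<alpha>) \<sigma> * psi L N (shifted L \<beta>) \<sigma>) = fact N * of_bool (\<alpha> = \<beta>)"
proof -
  have z: "\<alpha> i = 0" "\<beta> i = 0" if "i \<ge> L" for i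
    using partitions_zero[OF \<alpha>, of i] partitions_zero[OF \<beta>, of i] L that by simp_all
  have "alt_tables2 L (\<lambda>i. int (\<alpha> i) + del L i) (\<lambda>i. int (\<beta> i) + del L i) =
    of_bool ((\<lambda>i. int (\<alpha> i)) = (\<lambda>i. int (\<beta> i)))"
    by (rule alt_tables2_orthonormal) (use partitions_antimono[OF \<alpha>] partitions_antimono[OF \<beta>] z in auto)
  moreover have "(\<lambda>i. int (\<alpha> i)) = (\<lambda>i. int (\<beta> i)) \<longleftrightarrow> \<alpha> = \<beta>" by (auto simp: fun_eq_iff)
  ultimately have "alt_tables2 L (shifted L \<alpha>) (shifted L \<beta>) = of_bool (\<alpha> = \<beta>)" by (simp add: shifted_def[abs_def])
  then show ?thesis
    using sum_psi_times_psi[OF balanced_shifted[OF \<alpha> z(1)] balanced_shifted[OF \<beta> z(2)]] by simp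
qed

lemma triple_raise:
  assumes lam: "lam \<in> partitions n" and mu: "mu \<in> partitions n" and nu: "nu \<in> partitions n"
    and L: "n \<le> L" "k < L" and k: "k \<ge> 1"
    and gap: "min (lam (k - 1)) (mu (k - 1)) \<ge> max (lam k) (mu k) + (n - nu 0)"
  shows "triple L (raise t k (shifted L lam)) (raise t k (shifted L mu)) (raise (t * k) 1 (shifted L nu)) =
    triple L (shifted L lam) (shifted L mu) (shifted L nu)"
proof -
  let ?s = "int n - int (nu 0)"
  have nz: "nu i = 0" if "i \<ge> L" for i using partitions_zero[OF nu] L that by simp
  have nsum: "(\<Sum>i<L. int (nu i)) = int n" using partitions_sum[OF nu nz] by (simp flip: of_nat_sum)
  have L0: "{..<L} = insert 0 {1..<L}" using L k by auto
  have n0: "nu 0 \<le> n"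
  proof -
    have "nu 0 \<le> (\<Sum>i<L. nu i)" using L by (intro member_le_sum) auto
    then show ?thesis using partitions_sum[OF nu nz] by simp
  qed
  \<comment> \<open>\<open>slices\<close> reads the third margin only at indices from 1 on, while
    the raised entry is the one at 0. Both sides thus sum over the same tables
    \<open>B\<close>.\<close>
  have slices_eq: "slices L (\<lambda>i. raise (t * k) 1 (shifted L nu) i - del L (w i)) = slices L (\<lambda>i. shifted L nu i - del L (w i))" for w
    by (simp add: slices_def raise_def)
  have "alt_tables2 L (\<lambda>i. raise t k (shifted L lam) i - fst_margin L B i) (\<lambda>i. raise t k (shifted L mu) i - snd_margin L B i) =
    alt_tables2 L (\<lambda>i. shifted L lam i - fst_margin L B i) (\<lambda>i. shifted L mu i - snd_margin L B i)"
    if w: "w permutes {..<L}" and B: "B \<in> slices L (\<lambda>i. shifted L nu i - del L (w i))" for w B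
  proof -
    have "(\<Sum>i\<in>{1..<L}. shifted L nu i - del L (w i)) \<le> ?s"
    proof -
      have "(\<Sum>i<L. shifted L nu i - del L (w i)) = int n"
        using balanced_minus_del_sum[OF balanced_shifted[OF nu nz] w] by simp
      moreover have "(\<Sum>i<L. shifted L nu i - del L (w i)) =
        (shifted L nu 0 - del L (w 0)) + (\<Sum>i\<in>{1..<L}. shifted L nu i - del L (w i))"
        unfolding L0 by (subst sum.insert) auto
      \<comment> \<open>\<delta> is largest at 0, so the first slice keeps at least
        \<open>nu 0\<close> whatever \<open>w\<close> is, and the other slices total at most
        \<open>n - nu 0\<close>. This is the origin of the size of the gap.\<close>
      moreover have "shifted L nu 0 - del L (w 0) \<ge> int (nu 0)" by (simp add: shifted_def del_def)
      ultimately show ?thesis by linarith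
    qed
    then have sf: "(\<Sum>i<L. fst_margin L B i) \<le> ?s" and ss: "(\<Sum>i<L. snd_margin L B i) \<le> ?s"
      using sum_fst_margin[OF B] sum_snd_margin[OF B] by auto
    have bf: "fst_margin L B i \<le> ?s" if "i < L" for i
      using member_le_sum[of i "{..<L}" "fst_margin L B"] that margin_nonneg(1)[OF B] sf by force
    have bs: "snd_margin L B i \<le> ?s" if "i < L" for i
      using member_le_sum[of i "{..<L}" "snd_margin L B"] that margin_nonneg(2)[OF B] ss by force
    \<comment> \<open>The gap between \<open>\<alpha> (k - 1)\<close> and \<open>\<alpha> k\<close>
      absorbs the loss \<open>p i \<le> ?s\<close>; strictness comes from \<delta>.\<close>
    have sep: "x i - p i \<ge> 0" "k \<le> j \<Longrightarrow> j < L \<Longrightarrow> x j - p j < x i - p i"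
      if \<alpha>: "\<alpha> \<in> partitions n" "\<alpha> (k - 1) \<ge> \<alpha> k + (n - nu 0)" and x: "x = shifted L \<alpha>"
        and p: "\<And>i. p i \<ge> 0" "\<And>i. i < L \<Longrightarrow> p i \<le> ?s" and i: "i < k" for \<alpha> x p i j
    proof -
      have "\<alpha> (k - 1) \<le> \<alpha> i" using partitions_antimono[OF \<alpha>(1), of i "k - 1"] i by simp
      then have 1: "int (\<alpha> i) \<ge> int (\<alpha> k) + ?s" using \<alpha>(2) n0 by simp
      have "p i \<le> ?s" using p(2) i L by simp
      then show "x i - p i \<ge> 0" using 1 by (simp add: x shifted_def del_def)
      assume j: "k \<le> j" "j < L"
      have "\<alpha> j \<le> \<alpha> k" using partitions_antimono[OF \<alpha>(1) j(1)] .
      moreover have "del L j < del L i" using i j by (simp add: del_def)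
      ultimately show "x j - p j < x i - p i" using 1 p(1)[of j] \<open>p i \<le> ?s\<close> by (simp add: x shifted_def)
    qed
    have g1: "lam (k - 1) \<ge> lam k + (n - nu 0)" and g2: "mu (k - 1) \<ge> mu k + (n - nu 0)" using gap by auto
    have "alt_tables2 L (raise t k (\<lambda>i. shifted L lam i - fst_margin L B i)) (raise t k (\<lambda>i. shifted L mu i - snd_margin L B i)) =
      alt_tables2 L (\<lambda>i. shifted L lam i - fst_margin L B i) (\<lambda>i. shifted L mu i - snd_margin L B i)"
      by (rule alt_tables2_raise)
        (use L sep[OF lam g1 refl, of "fst_margin L B"] sep[OF mu g2 refl, of "snd_margin L B"]
          margin_nonneg[OF B] bf bs in auto)
    moreover have "raise t k (\<lambda>i. x i - p i) = (\<lambda>i. raise t k x i - p i)" for x p by (auto simp: raise_def)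
    ultimately show ?thesis by simp
  qed
  then show ?thesis
    unfolding triple_def slices_eq by (intro sum.cong arg_cong2[where f = "(*)"] refl) auto
qed

lemma shifted_add_rectangle: "shifted L (\<alpha> + rectangle t k) = raise t k (shifted L \<alpha>)"
  by (auto simp: shifted_def raise_def rectangle_def fun_eq_iff)

section \<open>Traces and matrix representations\<close>

lemma sum_fun_apply: "(\<Sum>a\<in>S. g a) x = (\<Sum>a\<in>S. g a x)" for g :: "'a \<Rightarrow> 'b \<Rightarrow> complex"
  by (induction S rule: infinite_finite_induct) (auto simp: plus_fun_def zero_fun_def)

abbreviation endo :: "(('a \<Rightarrow> complex) \<Rightarrow> 'a \<Rightarrow> complex) \<Rightarrow> bool" where
  "endo \<equiv> module_hom scale_fun scale_fun"

lemma endoI: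
  assumes "\<And>f g. F (\<lambda>x. f x + g x) = (\<lambda>x. F f x + F g x)" "\<And>c f. F (\<lambda>x. c * f x) = (\<lambda>x. c * F f x)"
  shows "endo F"
proof (rule module_hom.intro)
  show "module scale_fun" by unfold_locales
  show "module scale_fun" by unfold_locales
  show "module_hom_axioms scale_fun scale_fun F"
    using assms by (simp add: module_hom_axioms_def plus_fun_def scale_fun_def)
qed

lemma representation_endo:
  assumes B: "cfun.independent B" and C: "cfun.independent C" "finite C" "v \<in> cfun.span C"
    and F: "endo F" "\<And>c. c \<in> C \<Longrightarrow> F c \<in> cfun.span B"
  shows "cfun.representation B (F v) b = (\<Sum>c\<in>C. cfun.representation C v c * cfun.representation B (F c) b)"
proof -
  have "F v = F (\<Sum>c\<in>C. scale_fun (cfun.representation C v c) c)"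
    using C by (simp add: cfun.sum_representation_eq)
  also have "\<dots> = (\<Sum>c\<in>C. scale_fun (cfun.representation C v c) (F c))"
    by (simp add: module_hom.sum[OF F(1)] module_hom.scale[OF F(1)])
  finally have "F v = (\<Sum>c\<in>C. scale_fun (cfun.representation C v c) (F c))" .
  then show ?thesis
    using F(2) by (simp add: cfun.representation_sum[OF B] cfun.representation_scale[OF B] cfun.span_scale)
qed

text \<open>The identity tr(XY) = tr(YX) in coordinates: \<open>b\<close> is expanded in
  \<open>C\<close>, the two sums are exchanged, and the inner sum becomes a coordinate with respect
  to \<open>C\<close>.\<close>

lemma sum_diagonal_basis_independent:
  assumes B: "cfun.independent B" "finite B" and C: "cfun.independent C" "finite C"
    and sp: "cfun.span B = cfun.span C" and F: "endo F" "\<And>v. v \<in> cfun.span B \<Longrightarrow> F v \<in> cfun.span B"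
  shows "(\<Sum>b\<in>B. cfun.representation B (F b) b) = (\<Sum>c\<in>C. cfun.representation C (F c) c)"
proof -
  have FC: "F c \<in> cfun.span B" if "c \<in> C" for c using F(2) sp cfun.span_base[OF that] by simp
  have bC: "b \<in> cfun.span C" if "b \<in> B" for b using sp cfun.span_base[OF that] by simp
  have "(\<Sum>b\<in>B. cfun.representation B (F b) b) =
    (\<Sum>b\<in>B. \<Sum>c\<in>C. cfun.representation C b c * cfun.representation B (F c) b)"
    using representation_endo[OF B(1) C bC F(1) FC] by (intro sum.cong) auto
  also have "\<dots> = (\<Sum>c\<in>C. \<Sum>b\<in>B. cfun.representation B (F c) b * cfun.representation C b c)"
    by (subst sum.swap) (simp add: mult.commute)
  also have "\<dots> = (\<Sum>c\<in>C. cfun.representation C (\<lambda>x. F c x) c)"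
  proof (rule sum.cong)
    fix c assume c: "c \<in> C"
    \<comment> \<open>Applied to the identity map, \<open>representation_endo\<close> is the change
      of coordinates from \<open>B\<close> to \<open>C\<close>.\<close>
    have id: "endo (\<lambda>v. v)" by (rule endoI) auto
    show "(\<Sum>b\<in>B. cfun.representation B (F c) b * cfun.representation C b c) = cfun.representation C (F c) c"
      using representation_endo[OF C(1) B FC[OF c] id bC] by simp
  qed simp
  finally show ?thesis by simp
qed

text \<open>The basis chosen by \<open>trace_on\<close> is finite, being independent in the span of
  the finite set \<open>B\<close>, and the choice is then immaterial.\<close>

lemma trace_on_basis:
  assumes B: "cfun.independent B" "finite B" "cfun.span B = V"
    and F: "endo F" "\<And>v. v \<in> V \<Longrightarrow> F v \<in> V"
  shows "trace_on V F = (\<Sum>b\<in>B. cfun.representation B (F b) b)"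
proof -
  define C where "C = (SOME B. cfun.independent B \<and> cfun.span B = V)"
  have "\<exists>B. cfun.independent B \<and> cfun.span B = V" using B by blast
  then have C: "cfun.independent C" "cfun.span C = V" unfolding C_def by (metis (mono_tags, lifting) someI_ex)+
  have "finite C"
    using cfun.independent_span_bound[OF B(2) C(1)] B(3) C(2) cfun.span_superset[of C] by auto
  then have "(\<Sum>c\<in>C. cfun.representation C (F c) c) = (\<Sum>b\<in>B. cfun.representation B (F b) b)"
    using B C F by (intro sum_diagonal_basis_independent) auto
  then show ?thesis by (simp add: trace_on_def C_def[symmetric])
qed

section \<open>Functions on a finite set\<close>

definition point :: "'a \<Rightarrow> 'a \<Rightarrow> complex" where
  "point x = (\<lambda>y. of_bool (y = x))"

definition supported :: "'a set \<Rightarrow> ('a \<Rightarrow> complex) set" where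
  "supported X = {f. \<forall>x. f x \<noteq> 0 \<longrightarrow> x \<in> X}"

lemma inj_point: "inj_on point X"
  by (rule inj_onI) (metis (full_types) of_bool_eq_iff point_def)

lemma point_eq_iff: "point x = point y \<longleftrightarrow> x = y"
  by (rule inj_eq[OF inj_point])

lemma point_sum: "finite X \<Longrightarrow> (\<Sum>x\<in>X. scale_fun (c x) (point x)) = (\<lambda>y. if y \<in> X then c y else 0)"
  by (rule ext) (simp add: sum_fun_apply scale_fun_def point_def of_bool_def if_distrib cong: if_cong)

lemma independent_points:
  assumes "finite X" shows "cfun.independent (point ` X)"
proof (rule cfun.independent_if_scalars_zero)
  fix f :: "('a \<Rightarrow> complex) \<Rightarrow> complex" and v :: "'a \<Rightarrow> complex"
  assume s: "(\<Sum>v\<in>point ` X. scale_fun (f v) v) = 0" and v: "v \<in> point ` X"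
  have "(\<Sum>x\<in>X. scale_fun (f (point x)) (point x)) = 0"
    using s by (simp add: sum.reindex inj_point)
  then have "(if x \<in> X then f (point x) else 0) = 0" for x
    unfolding point_sum[OF assms] by (simp add: fun_eq_iff)
  then show "f v = 0" using v by (metis imageE)
qed (use assms in simp)

lemma subspace_supported: "cfun.subspace (supported X)"
  by (auto simp: cfun.subspace_def supported_def scale_fun_def plus_fun_def zero_fun_def) (metis add.right_neutral)

lemma span_points:
  assumes "finite X" shows "cfun.span (point ` X) = supported X"
proof
  show "cfun.span (point ` X) \<subseteq> supported X"
    by (rule cfun.span_minimal) (auto simp: subspace_supported, auto simp: supported_def point_def split: if_splits)
  show "supported X \<subseteq> cfun.span (point ` X)"
  proof
    fix f :: "'a \<Rightarrow> complex" assume "f \<in> supported X"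
    then have "f = (\<Sum>x\<in>X. scale_fun (f x) (point x))"
      unfolding point_sum[OF assms] by (auto simp: supported_def fun_eq_iff)
    also have "\<dots> \<in> cfun.span (point ` X)"
      by (intro cfun.span_sum cfun.span_scale cfun.span_base) auto
    finally show "f \<in> cfun.span (point ` X)" .
  qed
qed

lemma representation_points:
  assumes "finite X" "f \<in> supported X" "x \<in> X"
  shows "cfun.representation (point ` X) f (point x) = f x"
proof -
  have f: "f = (\<Sum>x\<in>X. scale_fun (f x) (point x))"
    unfolding point_sum[OF assms(1)] using assms(2) by (auto simp: supported_def fun_eq_iff)
  have "cfun.representation (point ` X) f (point x) =
    cfun.representation (point ` X) (\<Sum>x\<in>X. scale_fun (f x) (point x)) (point x)" using f by simp
  also have "\<dots> = (\<Sum>y\<in>X. f y * (if point x = point y then 1 else 0))"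
    by (simp add: cfun.representation_sum cfun.representation_scale cfun.representation_basis
      independent_points[OF assms(1)] cfun.span_scale cfun.span_base)
  also have "\<dots> = (\<Sum>y\<in>X. if y = x then f y else 0)"
    by (intro sum.cong) (auto simp: point_eq_iff)
  finally show ?thesis using assms by simp
qed

text \<open>In a basis extending a basis \<open>B1\<close> of the range, the idempotent fixes
  \<open>B1\<close> and sends every other basis vector into the span of \<open>B1\<close>. The
  diagonal entries are therefore 1 and 0, and the trace is the rank.\<close>

lemma trace_idempotent_Nats:
  fixes E :: "'i \<Rightarrow> 'i \<Rightarrow> complex"
  assumes fin: "finite I" and E: "\<And>i j. i \<in> I \<Longrightarrow> j \<in> I \<Longrightarrow> (\<Sum>k\<in>I. E i k * E k j) = E i j"
  shows "(\<Sum>i\<in>I. E i i) \<in> \<nat>"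
proof -
  define T where "T f = (\<lambda>i. if i \<in> I then \<Sum>k\<in>I. E i k * f k else 0)" for f :: "'i \<Rightarrow> complex"
  have T: "endo T"
    by (rule endoI) (auto simp: T_def fun_eq_iff algebra_simps sum.distrib sum_distrib_left)
  have Tin: "T f \<in> supported I" for f by (simp add: T_def supported_def)
  have idem: "T (T f) = T f" for f
  proof
    fix i show "T (T f) i = T f i"
    proof (cases "i \<in> I")
      case True
      have "T (T f) i = (\<Sum>k\<in>I. \<Sum>l\<in>I. E i k * E k l * f l)"
        using True by (simp add: T_def sum_distrib_left mult.assoc)
      also have "\<dots> = (\<Sum>l\<in>I. (\<Sum>k\<in>I. E i k * E k l) * f l)"
        by (subst sum.swap) (simp add: sum_distrib_right)
      also have "\<dots> = T f i" using True E by (simp add: T_def)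
      finally show ?thesis .
    qed (simp add: T_def)
  qed
  let ?D = "point ` I"
  have D: "cfun.independent ?D" "finite ?D" "cfun.span ?D = supported I"
    using fin by (simp_all add: independent_points span_points)
  have T_point: "T (point j) i = E i j" if "i \<in> I" "j \<in> I" for i j
    using that fin by (simp add: T_def point_def of_bool_def if_distrib cong: if_cong)
  have "(\<Sum>d\<in>?D. cfun.representation ?D (T d) d) = (\<Sum>i\<in>I. cfun.representation ?D (T (point i)) (point i))"
    by (simp add: sum.reindex inj_point)
  also have "\<dots> = (\<Sum>i\<in>I. E i i)"
    using representation_points[OF fin Tin] T_point by simp
  finally have tD: "(\<Sum>d\<in>?D. cfun.representation ?D (T d) d) = (\<Sum>i\<in>I. E i i)" .
  obtain B1 where B1: "B1 \<subseteq> range T" "cfun.independent B1" "range T \<subseteq> cfun.span B1"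
    using cfun.maximal_independent_subset by blast
  obtain B where B: "B1 \<subseteq> B" "B \<subseteq> supported I" "cfun.independent B" "supported I \<subseteq> cfun.span B"
    using cfun.maximal_independent_subset_extend[of B1 "supported I"] B1 Tin by blast
  have spB: "cfun.span B = supported I"
    using B cfun.span_minimal[OF B(2) subspace_supported] by blast
  have finB: "finite B" using cfun.independent_span_bound[OF D(2) B(3)] D(3) B(2) by simp
  have "(\<Sum>b\<in>B. cfun.representation B (T b) b) = (\<Sum>d\<in>?D. cfun.representation ?D (T d) d)"
    by (rule sum_diagonal_basis_independent) (use B(3) finB D spB T Tin in auto)
  moreover have "cfun.representation B (T b) b = of_bool (b \<in> B1)" if b: "b \<in> B" for b
  proof (cases "b \<in> B1")
    case True
    then have "T b = b" using B1(1) idem by auto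
    then show ?thesis using True b by (simp add: cfun.representation_basis[OF B(3)])
  next
    case False
    have "T b \<in> cfun.span B1" using B1(3) by blast
    then have "cfun.representation B (T b) b = cfun.representation B1 (T b) b"
      using cfun.representation_extend[OF B(3) _ B(1)] by simp
    then show ?thesis using False cfun.representation_ne_zero by auto
  qed
  ultimately have "(\<Sum>i\<in>I. E i i) = (\<Sum>b\<in>B. of_bool (b \<in> B1))" using tD by simp
  also have "\<dots> = of_nat (card {b \<in> B. b \<in> B1})" using finB by (simp add: of_bool_def sum.If_cases Int_def)
  finally show ?thesis by (simp add: Nats_def)
qed

section \<open>Matrix representations and their averages\<close>

definition mat_rep :: "nat \<Rightarrow> 'i set \<Rightarrow> ((nat \<Rightarrow> nat) \<Rightarrow> 'i \<Rightarrow> 'i \<Rightarrow> complex) \<Rightarrow> bool" where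
  "mat_rep N I R \<longleftrightarrow> finite I \<and> (\<forall>\<sigma>\<in>perms N. \<forall>\<tau>\<in>perms N. \<forall>i\<in>I. \<forall>j\<in>I.
     R (\<sigma> \<circ> \<tau>) i j = (\<Sum>k\<in>I. R \<sigma> i k * R \<tau> k j))"

lemma mat_rep_times:
  assumes "mat_rep N I R" "mat_rep N J S"
  shows "mat_rep N (I \<times> J) (\<lambda>\<sigma> x y. R \<sigma> (fst x) (fst y) * S \<sigma> (snd x) (snd y))"
proof -
  have "(\<Sum>k\<in>I \<times> J. R \<sigma> i (fst k) * S \<sigma> i' (snd k) * (R \<tau> (fst k) j * S \<tau> (snd k) j')) =
    (\<Sum>k\<in>I. R \<sigma> i k * R \<tau> k j) * (\<Sum>k\<in>J. S \<sigma> i' k * S \<tau> k j')" for \<sigma> \<tau> i j i' j'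
    unfolding sum_product sum.cartesian_product by (intro sum.cong) auto
  then show ?thesis using assms by (auto simp: mat_rep_def)
qed

lemma sum_diagonal_times:
  fixes R :: "'i \<Rightarrow> 'i \<Rightarrow> complex"
  shows "(\<Sum>x\<in>I \<times> J. R (fst x) (fst x) * S (snd x) (snd x)) = (\<Sum>i\<in>I. R i i) * (\<Sum>j\<in>J. S j j)"
  unfolding sum_product sum.cartesian_product by (intro sum.cong) auto

text \<open>The average \<open>E\<close> over the group is idempotent because left translation
  permutes the group. Its trace is the dimension of the space of invariants.\<close>

lemma mat_rep_average_trace:
  assumes R: "mat_rep N I R"
  shows "(\<Sum>\<sigma>\<in>perms N. \<Sum>i\<in>I. R \<sigma> i i) / fact N \<in> \<nat>"
proof -
  define E where "E i j = (\<Sum>\<sigma>\<in>perms N. R \<sigma> i j) / fact N" for i j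
  have "(\<Sum>k\<in>I. E i k * E k j) = E i j" if ij: "i \<in> I" "j \<in> I" for i j
  proof -
    have "(\<Sum>k\<in>I. E i k * E k j) = (\<Sum>k\<in>I. (\<Sum>\<sigma>\<in>perms N. \<Sum>\<tau>\<in>perms N. R \<sigma> i k * R \<tau> k j) / (fact N * fact N))"
      by (simp add: E_def sum_product)
    also have "\<dots> = (\<Sum>k\<in>I. \<Sum>\<sigma>\<in>perms N. \<Sum>\<tau>\<in>perms N. R \<sigma> i k * R \<tau> k j) / (fact N * fact N)"
      by (simp add: sum_divide_distrib)
    also have "(\<Sum>k\<in>I. \<Sum>\<sigma>\<in>perms N. \<Sum>\<tau>\<in>perms N. R \<sigma> i k * R \<tau> k j) =
        (\<Sum>\<sigma>\<in>perms N. \<Sum>k\<in>I. \<Sum>\<tau>\<in>perms N. R \<sigma> i k * R \<tau> k j)" by (rule sum.swap)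
    also have "\<dots> = (\<Sum>\<sigma>\<in>perms N. \<Sum>\<tau>\<in>perms N. \<Sum>k\<in>I. R \<sigma> i k * R \<tau> k j)"
      by (intro sum.cong refl sum.swap)
    also have "\<dots> = (\<Sum>\<sigma>\<in>perms N. \<Sum>\<tau>\<in>perms N. R (\<sigma> \<circ> \<tau>) i j)"
      using R ij by (simp add: mat_rep_def)
    also have "\<dots> = (\<Sum>\<sigma>\<in>perms N. \<Sum>\<tau>\<in>perms N. R \<tau> i j)"
      by (intro sum.cong refl sum_perms_compose_left[of _ N "\<lambda>\<rho>. R \<rho> i j"])
    also have "\<dots> / (fact N * fact N) = E i j" by (simp add: E_def)
    finally show ?thesis .
  qed
  then have "(\<Sum>i\<in>I. E i i) \<in> \<nat>" using R by (intro trace_idempotent_Nats) (auto simp: mat_rep_def)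
  moreover have "(\<Sum>i\<in>I. E i i) = (\<Sum>\<sigma>\<in>perms N. \<Sum>i\<in>I. R \<sigma> i i) / fact N"
    unfolding E_def by (subst sum.swap) (simp add: sum_divide_distrib)
  ultimately show ?thesis by simp
qed

definition act :: "(nat \<Rightarrow> nat) \<Rightarrow> ((nat \<Rightarrow> nat) \<Rightarrow> complex) \<Rightarrow> (nat \<Rightarrow> nat) \<Rightarrow> complex" where
  "act \<sigma> f = (\<lambda>r. f (r \<circ> \<sigma>))"

lemma endo_act: "endo (act \<sigma>)"
  by (rule endoI) (auto simp: act_def)

lemma act_compose: "act (\<sigma> \<circ> \<tau>) f = act \<sigma> (act \<tau> f)"
  by (simp add: act_def comp_assoc)

text \<open>For empty \<open>C\<close> this is the module spanned by \<open>B\<close>, in general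
  its quotient by the submodule spanned by \<open>C\<close>. Images of vectors of \<open>C\<close>
  have no coordinate outside \<open>C\<close>, so those vectors drop out of the matrix
  product.\<close>

lemma mat_rep_act:
  assumes B: "cfun.independent B" "finite B"
    and inv: "\<And>\<sigma> v. \<sigma> \<in> perms N \<Longrightarrow> v \<in> cfun.span B \<Longrightarrow> act \<sigma> v \<in> cfun.span B"
    and C: "C \<subseteq> B" and Cinv: "\<And>\<sigma> v. \<sigma> \<in> perms N \<Longrightarrow> v \<in> cfun.span C \<Longrightarrow> act \<sigma> v \<in> cfun.span C"
  shows "mat_rep N (B - C) (\<lambda>\<sigma> b c. cfun.representation B (act \<sigma> c) b)"
  unfolding mat_rep_def
proof (intro conjI ballI)
  fix \<sigma> \<tau> b c assume s: "\<sigma> \<in> perms N" and t: "\<tau> \<in> perms N" and b: "b \<in> B - C" and c: "c \<in> B - C"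
  have "cfun.representation B (act (\<sigma> \<circ> \<tau>) c) b = cfun.representation B (act \<sigma> (act \<tau> c)) b"
    by (simp add: act_compose)
  also have "\<dots> = (\<Sum>k\<in>B. cfun.representation B (act \<tau> c) k * cfun.representation B (act \<sigma> k) b)"
    using c by (intro representation_endo B endo_act inv[OF s] inv[OF t] cfun.span_base) auto
  also have "\<dots> = (\<Sum>k\<in>B - C. cfun.representation B (act \<tau> c) k * cfun.representation B (act \<sigma> k) b)"
  proof (rule sum.mono_neutral_right)
    have "cfun.representation B (act \<sigma> k) b = 0" if "k \<in> C" for k
    proof -
      have "act \<sigma> k \<in> cfun.span C" using Cinv[OF s] cfun.span_base[OF that] by blast
      then have "cfun.representation B (act \<sigma> k) b = cfun.representation C (act \<sigma> k) b"
        using cfun.representation_extend[OF B(1) _ C] by simp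
      then show ?thesis using b cfun.representation_ne_zero by auto
    qed
    then show "\<forall>k\<in>B - (B - C). cfun.representation B (act \<tau> c) k * cfun.representation B (act \<sigma> k) b = 0"
      by auto
  qed (use B in auto)
  finally show "cfun.representation B (act (\<sigma> \<circ> \<tau>) c) b =
    (\<Sum>k\<in>B - C. cfun.representation B (act \<sigma> k) b * cfun.representation B (act \<tau> c) k)"
    by (simp add: mult.commute)
qed (use B in simp)

lemma act_supported:
  assumes \<sigma>: "\<sigma> \<in> perms N" and v: "v \<in> supported (fillings N a)"
  shows "act \<sigma> v \<in> supported (fillings N a)"
  unfolding supported_def mem_Collect_eq
proof (intro allI impI)
  fix r assume "act \<sigma> v r \<noteq> 0"
  then have "r \<circ> \<sigma> \<in> fillings N a" using v by (simp add: act_def supported_def)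
  then have "r \<circ> \<sigma> \<circ> inv \<sigma> \<in> fillings N a" using perms_inv[OF \<sigma>] by (rule fillings_compose)
  moreover have "\<sigma> \<circ> inv \<sigma> = id" using \<sigma> by (auto simp: perms_def permutes_inv_o)
  ultimately show "r \<in> fillings N a" by (simp add: comp_assoc)
qed

lemma trace_on_supported:
  assumes \<sigma>: "\<sigma> \<in> perms N"
  shows "trace_on (supported (fillings N a)) (act \<sigma>) = of_int (phi N a \<sigma>)"
proof -
  let ?X = "fillings N a"
  have "trace_on (supported ?X) (act \<sigma>) = (\<Sum>b\<in>point ` ?X. cfun.representation (point ` ?X) (act \<sigma> b) b)"
    by (intro trace_on_basis independent_points span_points act_supported[OF \<sigma>] endo_act finite_imageI finite_fillings)
  also have "\<dots> = (\<Sum>x\<in>?X. cfun.representation (point ` ?X) (act \<sigma> (point x)) (point x))"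
    by (simp add: sum.reindex inj_point)
  also have "\<dots> = (\<Sum>x\<in>?X. of_bool (x \<circ> \<sigma> = x))"
  proof (rule sum.cong)
    fix x assume x: "x \<in> ?X"
    then have "act \<sigma> (point x) \<in> supported ?X" by (intro act_supported[OF \<sigma>]) (auto simp: supported_def point_def)
    then show "cfun.representation (point ` ?X) (act \<sigma> (point x)) (point x) = of_bool (x \<circ> \<sigma> = x)"
      using x by (simp add: representation_points) (simp add: act_def point_def)
  qed simp
  also have "\<dots> = of_nat (card {x \<in> ?X. x \<circ> \<sigma> = x})" by (simp add: of_bool_def sum.If_cases Int_def)
  finally show ?thesis by (simp add: phi_def fixed_fillings_def)
qed

section \<open>Specht modules\<close>

locale partition_of =
  fixes \<alpha> :: parts and N :: nat
  assumes part: "\<alpha> \<in> partitions N"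
begin

lemma psize [simp]: "psize \<alpha> = N"
  using part by (rule partitions_psize)

lemma finite_diagram: "finite (diagram \<alpha>)" and card_diagram: "card (diagram \<alpha>) = N"
proof -
  have eq: "diagram \<alpha> = (SIGMA i:{..<N}. {..<\<alpha> i})"
  proof (intro equalityI subsetI)
    fix x assume "x \<in> diagram \<alpha>"
    then obtain i j where x: "x = (i, j)" "j < \<alpha> i" by (auto simp: diagram_def)
    then have "i < N" using partitions_zero[OF part, of i] by (cases "i < N") auto
    then show "x \<in> (SIGMA i:{..<N}. {..<\<alpha> i})" using x by simp
  qed (auto simp: diagram_def)
  show "finite (diagram \<alpha>)" unfolding eq by simp
  show "card (diagram \<alpha>) = N"
    unfolding eq using partitions_sum[OF part, of N] partitions_zero[OF part] by simp
qed

lemma tableau_bij: "T \<in> tableaux \<alpha> \<Longrightarrow> bij_betw T {1..N} (diagram \<alpha>)"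
  by (simp add: tableaux_def)

lemma tableau_inj: "T \<in> tableaux \<alpha> \<Longrightarrow> x \<in> {1..N} \<Longrightarrow> y \<in> {1..N} \<Longrightarrow> T x = T y \<Longrightarrow> x = y"
  using tableau_bij[of T] unfolding bij_betw_def inj_on_def by blast

lemma tableau_compose: "T \<in> tableaux \<alpha> \<Longrightarrow> \<sigma> \<in> perms N \<Longrightarrow> T \<circ> \<sigma> \<in> tableaux \<alpha>"
  using bij_betw_trans[OF permutes_imp_bij[of \<sigma> "{1..N}"], of T "diagram \<alpha>"]
  by (simp add: tableaux_def perms_def)

lemma ex_tableau: obtains T where "T \<in> tableaux \<alpha>"
proof -
  have "card {1..N} = card (diagram \<alpha>)" by (simp add: card_diagram)
  then obtain T where "bij_betw T {1..N} (diagram \<alpha>)"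
    using finite_same_card_bij[OF _ finite_diagram] by blast
  then show thesis using that by (simp add: tableaux_def)
qed

lemma perms_in: "\<sigma> \<in> perms N \<Longrightarrow> \<sigma> x \<in> {1..N} \<longleftrightarrow> x \<in> {1..N}"
  unfolding perms_def mem_Collect_eq by (rule permutes_in_image)

lemma perms_out: "\<sigma> \<in> perms N \<Longrightarrow> x \<notin> {1..N} \<Longrightarrow> \<sigma> x = x"
  unfolding perms_def mem_Collect_eq by (rule permutes_not_in)

lemma perms_cancel:
  assumes "\<sigma> \<in> perms N"
  shows "\<sigma> (inv \<sigma> x) = x" "inv \<sigma> (\<sigma> x) = x" "\<sigma> \<circ> inv \<sigma> = id" "inv \<sigma> \<circ> \<sigma> = id" "inv (inv \<sigma>) = \<sigma>"
  using assms permutes_inverses[of \<sigma>] permutes_inv_o[of \<sigma>] permutes_inv_inv[of \<sigma>]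
  by (auto simp: perms_def)

lemma perms_permutation: "\<sigma> \<in> perms N \<Longrightarrow> permutation \<sigma>"
  unfolding perms_def permutation_permutes by auto

lemma tabloid_compose:
  assumes "\<sigma> \<in> perms N" shows "tabloid \<alpha> (T \<circ> \<sigma>) = tabloid \<alpha> T \<circ> \<sigma>"
proof
  fix x show "tabloid \<alpha> (T \<circ> \<sigma>) x = (tabloid \<alpha> T \<circ> \<sigma>) x"
    using perms_in[OF assms, of x] by (auto simp: tabloid_def restrict_def simp del: atLeastAtMost_iff)
qed

text \<open>Places the polytabloids in the permutation module on fillings of content \<alpha>, the
  module whose character is \<open>phi\<close>.\<close>

lemma tabloid_fillings:
  assumes T: "T \<in> tableaux \<alpha>" shows "tabloid \<alpha> T \<in> fillings N (\<lambda>i. int (\<alpha> i))"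
  unfolding fillings_def mem_Collect_eq
proof (intro conjI allI)
  show "tabloid \<alpha> T \<in> extensional {1..N}" by (simp add: tabloid_def)
  fix i
  have "T ` {x \<in> {1..N}. fst (T x) = i} = {z \<in> T ` {1..N}. fst z = i}" by blast
  moreover have "inj_on T {x \<in> {1..N}. fst (T x) = i}"
    using tableau_bij[OF T] unfolding bij_betw_def by (blast intro: inj_on_subset)
  ultimately have "bij_betw T {x \<in> {1..N}. fst (T x) = i} {z \<in> diagram \<alpha>. fst z = i}"
    using tableau_bij[OF T] by (simp only: bij_betw_def)
  then have "card {x \<in> {1..N}. fst (T x) = i} = card {z \<in> diagram \<alpha>. fst z = i}" by (rule bij_betw_same_card)
  also have "{z \<in> diagram \<alpha>. fst z = i} = {i} \<times> {..<\<alpha> i}" by (auto simp: diagram_def)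
  also have "{x \<in> {1..N}. fst (T x) = i} = {x \<in> {1..N}. tabloid \<alpha> T x = i}"
    by (auto simp: tabloid_def)
  finally show "int (card {x \<in> {1..N}. tabloid \<alpha> T x = i}) = int (\<alpha> i)" by (simp add: card_cartesian_product)
qed

lemma column_group_eq:
  "column_group \<alpha> T = {q \<in> perms N. \<forall>x\<in>{1..N}. snd (T (q x)) = snd (T x)}"
  by (auto simp: column_group_def perms_def)

lemma column_group_perms: "q \<in> column_group \<alpha> T \<Longrightarrow> q \<in> perms N"
  by (simp add: column_group_eq)

lemma column_group_inv:
  assumes "q \<in> column_group \<alpha> T" shows "inv q \<in> column_group \<alpha> T"
proof -
  have q: "q \<in> perms N" using assms by (rule column_group_perms)
  have "snd (T (inv q x)) = snd (T x)" if "x \<in> {1..N}" for x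
  proof -
    have "inv q x \<in> {1..N}" using perms_in[OF perms_inv[OF q]] that by blast
    then have "snd (T (q (inv q x))) = snd (T (inv q x))" using assms unfolding column_group_eq by blast
    then show ?thesis by (simp add: perms_cancel[OF q])
  qed
  then show ?thesis using perms_inv[OF q] by (simp add: column_group_eq)
qed

lemma column_group_compose:
  assumes "p \<in> column_group \<alpha> T" "q \<in> column_group \<alpha> T" shows "p \<circ> q \<in> column_group \<alpha> T"
proof -
  have "q x \<in> {1..N}" if "x \<in> {1..N}" for x using perms_in[OF column_group_perms[OF assms(2)]] that by blast
  then show ?thesis using assms unfolding column_group_eq
    by (simp add: perms_compose del: atLeastAtMost_iff)
qed

lemma column_group_invariant:
  assumes "q \<in> column_group \<alpha> T" shows "column_group \<alpha> (T \<circ> q) = column_group \<alpha> T"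
proof -
  have "snd (T (q x)) = snd (T x)" if "x \<in> {1..N}" for x using assms that unfolding column_group_eq by blast
  then have "p \<in> perms N \<Longrightarrow> (\<forall>x\<in>{1..N}. snd ((T \<circ> q) (p x)) = snd ((T \<circ> q) x)) \<longleftrightarrow>
      (\<forall>x\<in>{1..N}. snd (T (p x)) = snd (T x))" for p
    using perms_in[of p] by (simp del: atLeastAtMost_iff)
  then show ?thesis unfolding column_group_eq by blast
qed

lemma finite_column_group [simp]: "finite (column_group \<alpha> T)"
  by (rule finite_subset[OF _ finite_perms[of N]]) (auto simp: column_group_perms)

text \<open>Membership in \<open>tableaux\<close> leaves the values outside \<open>{1..N}\<close>
  free, so tableaux that arise in different ways can only be expected to agree on
  \<open>{1..N}\<close>.\<close>

lemma polytabloid_cong: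
  assumes "\<And>x. x \<in> {1..N} \<Longrightarrow> T x = U x"
  shows "polytabloid \<alpha> T = polytabloid \<alpha> U"
proof -
  have cg: "column_group \<alpha> T = column_group \<alpha> U"
    unfolding column_group_eq using assms perms_in by (auto simp del: atLeastAtMost_iff)
  have "tabloid \<alpha> (T \<circ> inv q) = tabloid \<alpha> (U \<circ> inv q)" if "q \<in> column_group \<alpha> U" for q
  proof
    fix x show "tabloid \<alpha> (T \<circ> inv q) x = tabloid \<alpha> (U \<circ> inv q) x"
      using assms[of "inv q x"] perms_in[OF perms_inv[OF column_group_perms[OF that]], of x]
      by (simp add: tabloid_def restrict_def del: atLeastAtMost_iff)
  qed
  then show ?thesis unfolding polytabloid_def cg by (intro ext sum.cong) auto
qed

text \<open>Conjugation by \<sigma> carries the column group of \<open>T\<close> to that of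
  \<open>T \<circ> inv \<sigma>\<close> and preserves signs.\<close>

lemma act_polytabloid:
  assumes \<sigma>: "\<sigma> \<in> perms N"
  shows "act \<sigma> (polytabloid \<alpha> T) = polytabloid \<alpha> (T \<circ> inv \<sigma>)"
proof
  fix r
  have i\<sigma>: "inv \<sigma> \<in> perms N" using \<sigma> by (rule perms_inv)
  note c = perms_cancel[OF \<sigma>]
  have cancel: "f \<circ> \<sigma> = g \<circ> \<sigma> \<longleftrightarrow> f = g" for f g :: "nat \<Rightarrow> nat"
  proof
    assume eq: "f \<circ> \<sigma> = g \<circ> \<sigma>"
    have "f x = g x" for x using fun_cong[OF eq, of "inv \<sigma> x"] by (simp add: c)
    then show "f = g" by blast
  qed simp
  have conj: "\<sigma> \<circ> q \<circ> inv \<sigma> \<in> column_group \<alpha> (T \<circ> inv \<sigma>)" if "q \<in> column_group \<alpha> T" "\<sigma> \<in> perms N" for q T \<sigma>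
  proof -
    have "snd (T (q (inv \<sigma> x))) = snd (T (inv \<sigma> x))" if "x \<in> {1..N}" for x
      using perms_in[OF perms_inv[OF \<open>\<sigma> \<in> perms N\<close>], of x] that \<open>q \<in> column_group \<alpha> T\<close> unfolding column_group_eq by blast
    then show ?thesis using that
      by (auto simp: column_group_eq perms_compose perms_inv perms_cancel)
  qed
  have "polytabloid \<alpha> (T \<circ> inv \<sigma>) r =
    (\<Sum>q\<in>column_group \<alpha> T. of_int (sign q) * of_bool (r \<circ> \<sigma> = tabloid \<alpha> (T \<circ> inv q)))"
    unfolding polytabloid_def
  proof (rule sum.reindex_bij_witness[where i = "\<lambda>q. \<sigma> \<circ> q \<circ> inv \<sigma>" and j = "\<lambda>q. inv \<sigma> \<circ> q \<circ> \<sigma>"])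
    fix q assume q: "q \<in> column_group \<alpha> (T \<circ> inv \<sigma>)"
    have qp: "q \<in> perms N" using q by (rule column_group_perms)
    show "\<sigma> \<circ> (inv \<sigma> \<circ> q \<circ> \<sigma>) \<circ> inv \<sigma> = q" by (simp add: fun_eq_iff c)
    have "T \<circ> inv \<sigma> \<circ> inv (inv \<sigma>) = T" by (simp add: fun_eq_iff c)
    then show "inv \<sigma> \<circ> q \<circ> \<sigma> \<in> column_group \<alpha> T"
      using conj[OF q i\<sigma>] by (simp add: c)
    have "inv (inv \<sigma> \<circ> q \<circ> \<sigma>) = inv \<sigma> \<circ> inv q \<circ> \<sigma>"
      using perms_cancel[OF qp] by (intro inv_unique_comp) (simp_all add: fun_eq_iff c)
    then have "tabloid \<alpha> (T \<circ> inv (inv \<sigma> \<circ> q \<circ> \<sigma>)) = tabloid \<alpha> (T \<circ> inv \<sigma> \<circ> inv q) \<circ> \<sigma>"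
      using \<sigma> by (simp add: o_assoc flip: tabloid_compose)
    then have "r \<circ> \<sigma> = tabloid \<alpha> (T \<circ> inv (inv \<sigma> \<circ> q \<circ> \<sigma>)) \<longleftrightarrow> r = tabloid \<alpha> (T \<circ> inv \<sigma> \<circ> inv q)"
      by (simp add: cancel)
    moreover have "sign (inv \<sigma> \<circ> q \<circ> \<sigma>) = sign q"
      using perms_permutation qp \<sigma> i\<sigma> by (simp add: sign_compose sign_inverse permutation_compose sign_idempotent mult.assoc mult.left_commute)
    ultimately show "of_int (sign (inv \<sigma> \<circ> q \<circ> \<sigma>)) * of_bool (r \<circ> \<sigma> = tabloid \<alpha> (T \<circ> inv (inv \<sigma> \<circ> q \<circ> \<sigma>))) =
      (of_int (sign q) * of_bool (r = tabloid \<alpha> (T \<circ> inv \<sigma> \<circ> inv q)) :: complex)" by simp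
  next
    fix q assume q: "q \<in> column_group \<alpha> T"
    show "inv \<sigma> \<circ> (\<sigma> \<circ> q \<circ> inv \<sigma>) \<circ> \<sigma> = q" by (simp add: fun_eq_iff c)
    show "\<sigma> \<circ> q \<circ> inv \<sigma> \<in> column_group \<alpha> (T \<circ> inv \<sigma>)" using q \<sigma> by (rule conj)
  qed
  then show "act \<sigma> (polytabloid \<alpha> T) r = polytabloid \<alpha> (T \<circ> inv \<sigma>) r"
    by (simp add: act_def polytabloid_def)
qed

text \<open>\<open>T \<circ> q\<close> has the same column group as \<open>T\<close>; shifting the
  summation index by \<open>q\<close> costs the sign of \<open>q\<close>.\<close>

lemma polytabloid_column:
  assumes q: "q \<in> column_group \<alpha> T"
  shows "polytabloid \<alpha> (T \<circ> q) = scale_fun (of_int (sign q)) (polytabloid \<alpha> T)"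
proof
  fix r
  have qp: "q \<in> perms N" using q by (rule column_group_perms)
  have "polytabloid \<alpha> (T \<circ> q) r =
    (\<Sum>p\<in>column_group \<alpha> T. of_int (sign q) * (of_int (sign p) * of_bool (r = tabloid \<alpha> (T \<circ> inv p))))"
    unfolding polytabloid_def column_group_invariant[OF q]
  proof (rule sum.reindex_bij_witness[where i = "\<lambda>p. p \<circ> q" and j = "\<lambda>p. p \<circ> inv q"])
    fix p assume p: "p \<in> column_group \<alpha> T"
    have pp: "p \<in> perms N" using p by (rule column_group_perms)
    show "p \<circ> inv q \<circ> q = p" by (simp add: fun_eq_iff perms_cancel[OF qp])
    show "p \<circ> inv q \<in> column_group \<alpha> T" using p q by (intro column_group_compose column_group_inv)
    have "inv (p \<circ> inv q) = q \<circ> inv p"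
      using perms_cancel[OF qp] perms_cancel[OF pp] by (intro inv_unique_comp) (simp_all add: fun_eq_iff)
    moreover have "sign q * sign (p \<circ> inv q) = sign p"
      using perms_permutation[OF pp] perms_permutation[OF qp]
      by (simp add: sign_compose sign_inverse permutation_inverse sign_idempotent mult.left_commute)
    then have "of_int (sign q) * of_int (sign (p \<circ> inv q)) = (of_int (sign p) :: complex)"
      by (simp flip: of_int_mult)
    ultimately show "of_int (sign q) * (of_int (sign (p \<circ> inv q)) * of_bool (r = tabloid \<alpha> (T \<circ> inv (p \<circ> inv q)))) =
      (of_int (sign p) * of_bool (r = tabloid \<alpha> (T \<circ> q \<circ> inv p)) :: complex)"
      by (simp add: o_assoc flip: mult.assoc)
  next
    fix p assume p: "p \<in> column_group \<alpha> T"
    show "p \<circ> q \<circ> inv q = p" by (simp add: fun_eq_iff perms_cancel[OF qp])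
    show "p \<circ> q \<in> column_group \<alpha> T" using p q by (intro column_group_compose)
  qed
  also have "\<dots> = scale_fun (of_int (sign q)) (polytabloid \<alpha> T) r"
    unfolding scale_fun_def polytabloid_def sum_distrib_left ..
  finally show "polytabloid \<alpha> (T \<circ> q) r = scale_fun (of_int (sign q)) (polytabloid \<alpha> T) r" .
qed

lemma polytabloid_supported:
  assumes T: "T \<in> tableaux \<alpha>" shows "polytabloid \<alpha> T \<in> supported (fillings N (\<lambda>i. int (\<alpha> i)))"
  unfolding supported_def mem_Collect_eq
proof (intro allI impI)
  fix r assume "polytabloid \<alpha> T r \<noteq> 0"
  then obtain q where q: "q \<in> column_group \<alpha> T"
    "(of_int (sign q) * of_bool (r = tabloid \<alpha> (T \<circ> inv q)) :: complex) \<noteq> 0"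
    unfolding polytabloid_def by (rule sum.not_neutral_contains_not_neutral)
  have "r = tabloid \<alpha> (T \<circ> inv q)" using q(2) by (cases "r = tabloid \<alpha> (T \<circ> inv q)") auto
  then show "r \<in> fillings N (\<lambda>i. int (\<alpha> i))"
    using tabloid_fillings[OF tableau_compose[OF T perms_inv[OF column_group_perms[OF q(1)]]]] by simp
qed

text \<open>A permutation that preserves rows and columns fixes every box, so only the identity
  contributes. In particular a polytabloid is not 0.\<close>

lemma polytabloid_own_tabloid:
  assumes T: "T \<in> tableaux \<alpha>" shows "polytabloid \<alpha> T (tabloid \<alpha> T) = 1"
proof -
  have "tabloid \<alpha> T = tabloid \<alpha> (T \<circ> inv q) \<longleftrightarrow> q = id" if q: "q \<in> column_group \<alpha> T" for q
  proof
    assume eq: "tabloid \<alpha> T = tabloid \<alpha> (T \<circ> inv q)"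
    have qp: "q \<in> perms N" using q by (rule column_group_perms)
    have "inv q x = x" for x
    proof (cases "x \<in> {1..N}")
      case True
      have "fst (T (inv q x)) = fst (T x)" using fun_cong[OF eq, of x] True by (simp add: tabloid_def)
      moreover have "snd (T (inv q x)) = snd (T x)" using column_group_inv[OF q] True unfolding column_group_eq by blast
      ultimately have "T (inv q x) = T x" by (rule prod_eqI)
      then show ?thesis using tableau_inj[OF T _ True] perms_in[OF perms_inv[OF qp]] True by blast
    qed (use perms_out[OF perms_inv[OF qp]] in blast)
    then have "inv q = id" by auto
    then show "q = id" using perms_cancel(3)[OF qp] by simp
  qed simp
  then have "polytabloid \<alpha> T (tabloid \<alpha> T) = (\<Sum>q\<in>column_group \<alpha> T. if q = id then 1 else 0)"
    unfolding polytabloid_def by (intro sum.cong) auto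
  moreover have "id \<in> column_group \<alpha> T" by (simp add: column_group_eq perms_def permutes_id)
  ultimately show ?thesis by simp
qed

lemma act_specht:
  assumes \<sigma>: "\<sigma> \<in> perms N" and v: "v \<in> specht \<alpha>" shows "act \<sigma> v \<in> specht \<alpha>"
  using v unfolding specht_def
proof (induction rule: cfun.span_induct_alt)
  case base
  then show ?case by (simp only: module_hom.zero[OF endo_act] cfun.span_zero)
next
  case (step c x y)
  then obtain T where T: "T \<in> tableaux \<alpha>" "x = polytabloid \<alpha> T" by blast
  have "act \<sigma> x \<in> polytabloid \<alpha> ` tableaux \<alpha>"
    using T tableau_compose[OF T(1) perms_inv[OF \<sigma>]] by (simp add: act_polytabloid[OF \<sigma>])
  then show ?case
    unfolding module_hom.add[OF endo_act] module_hom.scale[OF endo_act]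
    by (intro cfun.span_add cfun.span_scale cfun.span_base step)
qed

lemma specht_supported: "specht \<alpha> \<subseteq> supported (fillings N (\<lambda>i. int (\<alpha> i)))"
  unfolding specht_def using polytabloid_supported by (intro cfun.span_minimal subspace_supported) auto

section \<open>Column counts and dominance for tableaux\<close>

lemma column_sum: "(\<Sum>i<n. \<alpha> i) = (\<Sum>j<\<alpha> 0. card {i. i < n \<and> j < \<alpha> i})"
proof -
  have "\<alpha> i = (\<Sum>j<\<alpha> 0. of_bool (j < \<alpha> i))" for i
  proof -
    have "{j. j < \<alpha> 0 \<and> j < \<alpha> i} = {..<\<alpha> i}" using partitions_antimono[OF part, of 0 i] by auto
    then have "card {j \<in> {..<\<alpha> 0}. j < \<alpha> i} = \<alpha> i" by simp
    then show ?thesis by (simp add: of_bool_def sum.If_cases Int_def)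
  qed
  then have "(\<Sum>i<n. \<alpha> i) = (\<Sum>i<n. \<Sum>j<\<alpha> 0. of_bool (j < \<alpha> i))" by (rule sum.cong[OF refl])
  also have "\<dots> = (\<Sum>j<\<alpha> 0. \<Sum>i<n. of_bool (j < \<alpha> i))" by (rule sum.swap)
  also have "\<dots> = (\<Sum>j<\<alpha> 0. card {i. i < n \<and> j < \<alpha> i})" by (simp add: of_bool_def sum.If_cases Int_def)
  finally show ?thesis .
qed

text \<open>The values of \<open>h\<close> on a column of \<open>T\<close> are distinct, so at most
  \<open>n\<close> of them are below \<open>n\<close>; and there are no more of them than the length
  of the column. The right-hand side is the minimum of the two bounds.\<close>

lemma card_column_le:
  assumes T: "T \<in> tableaux \<alpha>"
    and transversal: "\<And>x y. x \<in> {1..N} \<Longrightarrow> y \<in> {1..N} \<Longrightarrow> h x = h y \<Longrightarrow> snd (T x) = snd (T y) \<Longrightarrow> x = y"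
  shows "card {x \<in> {1..N}. h x < n \<and> snd (T x) = j} \<le> card {i. i < n \<and> j < \<alpha> i}"
proof -
  let ?A = "{x \<in> {1..N}. h x < n \<and> snd (T x) = j}"
  have finD: "finite {i. j < \<alpha> i}"
    using part by (rule_tac finite_subset[of _ "{i. \<alpha> i \<noteq> 0}"]) (auto simp: partitions_def)
  have "card ?A \<le> n"
  proof -
    have "inj_on h ?A" using transversal by (auto simp: inj_on_def simp del: atLeastAtMost_iff)
    moreover have "h ` ?A \<subseteq> {..<n}" by auto
    ultimately have "card ?A \<le> card {..<n}" by (intro card_inj_on_le) auto
    then show ?thesis by simp
  qed
  moreover have "card ?A \<le> card {i. j < \<alpha> i}"
  proof (rule card_inj_on_le[where f = "\<lambda>x. fst (T x)"])
    show "inj_on (\<lambda>x. fst (T x)) ?A"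
      using tableau_inj[OF T] by (auto simp: inj_on_def prod_eq_iff simp del: atLeastAtMost_iff)
    show "(\<lambda>x. fst (T x)) ` ?A \<subseteq> {i. j < \<alpha> i}"
    proof (rule image_subsetI)
      fix x assume x: "x \<in> ?A"
      then have "T x \<in> diagram \<alpha>" using tableau_bij[OF T] by (auto simp: bij_betw_def simp del: atLeastAtMost_iff)
      then show "fst (T x) \<in> {i. j < \<alpha> i}" using x by (cases "T x") (auto simp: diagram_def)
    qed
  qed (rule finD)
  moreover have "card {i. i < n \<and> j < \<alpha> i} = min n (card {i. j < \<alpha> i})"
  proof -
    define c where "c = (LEAST i. \<not> j < \<alpha> i)"
    have "\<not> j < \<alpha> N" using partitions_zero[OF part, of N] by simp
    then have c: "\<not> j < \<alpha> c" unfolding c_def by (rule LeastI)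
    have iff: "i < c \<longleftrightarrow> j < \<alpha> i" for i
    proof
      assume "i < c" then show "j < \<alpha> i" using not_less_Least unfolding c_def by blast
    next
      assume "j < \<alpha> i" then show "i < c" using c partitions_antimono[OF part, of c i] by (cases "i < c") auto
    qed
    have "{i. j < \<alpha> i} = {..<c}" "{i. i < n \<and> j < \<alpha> i} = {..<min n c}"
      by (rule set_eqI, simp only: mem_Collect_eq lessThan_iff min_less_iff_conj iff)+
    then show ?thesis by (simp only: card_lessThan)
  qed
  ultimately show ?thesis by simp
qed

lemma card_rows_eq:
  fixes h :: "nat \<Rightarrow> nat"
  assumes "h \<in> fillings N \<gamma>" shows "int (card {x \<in> {1..N}. h x < n}) = (\<Sum>i<n. \<gamma> i)"
proof -
  have "{x \<in> {1..N}. h x < n} = (\<Union>i<n. {x \<in> {1..N}. h x = i})" by auto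
  then have "card {x \<in> {1..N}. h x < n} = card (\<Union>i<n. {x \<in> {1..N}. h x = i})" by (rule arg_cong)
  also have "\<dots> = (\<Sum>i<n. card {x \<in> {1..N}. h x = i})" by (rule card_UN_disjoint) auto
  finally have "card {x \<in> {1..N}. h x < n} = (\<Sum>i<n. card {x \<in> {1..N}. h x = i})" .
  then have "int (card {x \<in> {1..N}. h x < n}) = (\<Sum>i<n. int (card {x \<in> {1..N}. h x = i}))"
    by (simp only: of_nat_sum)
  then show ?thesis unfolding fillings_card[OF assms] .
qed

lemma tableau_in_diagram:
  assumes "T \<in> tableaux \<alpha>" "x \<in> {1..N}"
  shows "T x \<in> diagram \<alpha>" "snd (T x) < \<alpha> 0"
proof -
  show "T x \<in> diagram \<alpha>"
    using tableau_bij[OF assms(1)] assms(2) by (auto simp: bij_betw_def simp del: atLeastAtMost_iff)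
  then have "snd (T x) < \<alpha> (fst (T x))" by (cases "T x") (simp add: diagram_def)
  also have "\<dots> \<le> \<alpha> 0" using partitions_antimono[OF part] by simp
  finally show "snd (T x) < \<alpha> 0" .
qed

lemma card_rows_columns:
  fixes h :: "nat \<Rightarrow> nat"
  assumes T: "T \<in> tableaux \<alpha>"
  shows "card {x \<in> {1..N}. h x < n} = (\<Sum>j<\<alpha> 0. card {x \<in> {1..N}. h x < n \<and> snd (T x) = j})"
proof -
  have "snd (T x) < \<alpha> 0" if "x \<in> {1..N}" for x using tableau_in_diagram[OF T that] by blast
  then have "{x \<in> {1..N}. h x < n} = (\<Union>j<\<alpha> 0. {x \<in> {1..N}. h x < n \<and> snd (T x) = j})"
    by (auto simp del: atLeastAtMost_iff)
  then have "card {x \<in> {1..N}. h x < n} = card (\<Union>j<\<alpha> 0. {x \<in> {1..N}. h x < n \<and> snd (T x) = j})"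
    by (rule arg_cong)
  also have "\<dots> = (\<Sum>j<\<alpha> 0. card {x \<in> {1..N}. h x < n \<and> snd (T x) = j})"
    by (rule card_UN_disjoint) auto
  finally show ?thesis .
qed

text \<open>Adding up the column bounds bounds the number of entries with value below
  \<open>n\<close> by the number of boxes in the first \<open>n\<close> rows of \<alpha>. \<gamma>
  is arbitrary because the terms of a determinant are not sorted.\<close>

lemma dominance:
  assumes T: "T \<in> tableaux \<alpha>" and h: "h \<in> fillings N \<gamma>"
    and transversal: "\<And>x y. x \<in> {1..N} \<Longrightarrow> y \<in> {1..N} \<Longrightarrow> h x = h y \<Longrightarrow> snd (T x) = snd (T y) \<Longrightarrow> x = y"
  shows "(\<Sum>i<n. \<gamma> i) \<le> int (\<Sum>i<n. \<alpha> i)"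
proof -
  have "card {x \<in> {1..N}. h x < n} \<le> (\<Sum>i<n. \<alpha> i)"
    unfolding card_rows_columns[OF T] column_sum by (rule sum_mono) (rule card_column_le[OF T transversal])
  then show ?thesis using card_rows_eq[OF h, of n] by linarith
qed

text \<open>For content \<alpha> the column bounds add up to an equality, so each one is an
  equality. Hence a column of \<open>T\<close> carries exactly the row numbers that it meets in the
  diagram, and \<open>h\<close> may take the place of the row.\<close>

lemma straighten:
  assumes T: "T \<in> tableaux \<alpha>" and h: "h \<in> fillings N (\<lambda>i. int (\<alpha> i))"
    and transversal: "\<And>x y. x \<in> {1..N} \<Longrightarrow> y \<in> {1..N} \<Longrightarrow> h x = h y \<Longrightarrow> snd (T x) = snd (T y) \<Longrightarrow> x = y"
  shows "(\<lambda>x. (h x, snd (T x))) \<in> tableaux \<alpha>"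
proof -
  let ?c = "\<lambda>n j. card {x \<in> {1..N}. h x < n \<and> snd (T x) = j}" and ?d = "\<lambda>n j. card {i. i < n \<and> j < \<alpha> i}"
  have le: "?c n j \<le> ?d n j" for n j using card_column_le[OF T transversal] .
  have "card {x \<in> {1..N}. h x < n} = (\<Sum>i<n. \<alpha> i)" for n
    using card_rows_eq[OF h, of n] by (simp only: of_nat_eq_iff flip: of_nat_sum)
  then have sum_eq: "(\<Sum>j<\<alpha> 0. ?c n j) = (\<Sum>j<\<alpha> 0. ?d n j)" for n
    unfolding card_rows_columns[OF T] column_sum .
  have eq: "?c n j = ?d n j" if j: "j < \<alpha> 0" for n j
  proof (rule ccontr)
    assume "?c n j \<noteq> ?d n j"
    then have "?c n j < ?d n j" using le by (simp add: le_neq_implies_less)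
    then have "(\<Sum>j<\<alpha> 0. ?c n j) < (\<Sum>j<\<alpha> 0. ?d n j)" using le j by (intro sum_strict_mono_ex1) auto
    then show False using sum_eq by simp
  qed
  have in_diag: "(h x, snd (T x)) \<in> diagram \<alpha>" if x: "x \<in> {1..N}" for x
  proof -
    have j: "snd (T x) < \<alpha> 0" using tableau_in_diagram[OF T x] by blast
    \<comment> \<open>The entry \<open>x\<close> itself raises the count when the threshold passes
      \<open>h x\<close>; by equality the diagram must gain a box of this column in row
      \<open>h x\<close>.\<close>
    have "?c (h x) (snd (T x)) < ?c (Suc (h x)) (snd (T x))"
      using x by (intro psubset_card_mono) (auto intro!: exI[of _ x])
    then have lt: "?d (h x) (snd (T x)) < ?d (Suc (h x)) (snd (T x))" using eq[OF j] by simp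
    have "snd (T x) < \<alpha> (h x)"
    proof (rule ccontr)
      assume "\<not> snd (T x) < \<alpha> (h x)"
      then have "{i. i < Suc (h x) \<and> snd (T x) < \<alpha> i} = {i. i < h x \<and> snd (T x) < \<alpha> i}"
        by (auto simp: less_Suc_eq)
      then show False using lt by simp
    qed
    then show ?thesis by (simp add: diagram_def)
  qed
  have inj: "inj_on (\<lambda>x. (h x, snd (T x))) {1..N}" using transversal by (auto simp: inj_on_def simp del: atLeastAtMost_iff)
  moreover have "(\<lambda>x. (h x, snd (T x))) ` {1..N} = diagram \<alpha>"
    using in_diag finite_diagram card_diagram inj by (intro card_subset_eq) (auto simp: card_image simp del: atLeastAtMost_iff)
  ultimately show ?thesis by (simp add: tableaux_def bij_betw_def)
qed

lemma tableaux_transitive: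
  assumes T: "T \<in> tableaux \<alpha>" and U: "U \<in> tableaux \<alpha>"
  obtains p where "p \<in> perms N" "\<And>x. x \<in> {1..N} \<Longrightarrow> U x = T (p x)"
proof -
  define p where "p x = (if x \<in> {1..N} then the_inv_into {1..N} T (U x) else x)" for x
  have bT: "bij_betw T {1..N} (diagram \<alpha>)" and bU: "bij_betw U {1..N} (diagram \<alpha>)"
    using T U by (simp_all add: tableau_bij)
  have "bij_betw (the_inv_into {1..N} T \<circ> U) {1..N} {1..N}"
    using bij_betw_trans[OF bU bij_betw_the_inv_into[OF bT]] .
  then have "bij_betw p {1..N} {1..N}"
    by (rule bij_betw_cong[THEN iffD1, rotated]) (simp add: p_def)
  then have "p permutes {1..N}" by (rule bij_imp_permutes) (simp add: p_def del: atLeastAtMost_iff)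
  moreover have "U x = T (p x)" if x: "x \<in> {1..N}" for x
  proof -
    have "U x \<in> T ` {1..N}" using bT bU x unfolding bij_betw_def by blast
    then show ?thesis using bT x unfolding p_def bij_betw_def by (simp add: f_the_inv_into_f del: atLeastAtMost_iff)
  qed
  ultimately show thesis using that by (simp add: perms_def)
qed

end

section \<open>Symmetrizing over a Young subgroup\<close>

definition symmetrize :: "nat \<Rightarrow> (nat \<Rightarrow> nat) \<Rightarrow> ((nat \<Rightarrow> nat) \<Rightarrow> complex) \<Rightarrow> (nat \<Rightarrow> nat) \<Rightarrow> complex" where
  "symmetrize N h f = (\<lambda>r. \<Sum>\<sigma>\<in>stabilizer N h. f (r \<circ> \<sigma>))"

lemma endo_symmetrize: "endo (symmetrize N h)"
  by (rule endoI) (simp_all add: symmetrize_def sum.distrib sum_distrib_left)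

lemma symmetrize_eq_sum_act: "symmetrize N h f = (\<Sum>\<sigma>\<in>stabilizer N h. act \<sigma> f)"
  by (rule ext) (simp add: symmetrize_def sum_fun_apply act_def)

lemma stabilizer_perms: "\<sigma> \<in> stabilizer N h \<Longrightarrow> \<sigma> \<in> perms N"
  by (simp add: stabilizer_def)

lemma stabilizer_compose: "\<sigma> \<in> stabilizer N h \<Longrightarrow> \<tau> \<in> stabilizer N h \<Longrightarrow> \<sigma> \<circ> \<tau> \<in> stabilizer N h"
  by (simp add: stabilizer_def perms_compose o_assoc)

lemma stabilizer_inv:
  assumes "\<sigma> \<in> stabilizer N h" shows "inv \<sigma> \<in> stabilizer N h"
proof -
  have \<sigma>: "\<sigma> permutes {1..N}" "h \<circ> \<sigma> = h" using assms by (simp_all add: stabilizer_def perms_def)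
  have "h \<circ> inv \<sigma> = h \<circ> \<sigma> \<circ> inv \<sigma>" using \<sigma>(2) by simp
  also have "\<dots> = h" using permutes_inv_o(1)[OF \<sigma>(1)] by (simp add: comp_assoc)
  finally show ?thesis using assms by (simp add: stabilizer_def perms_inv)
qed

lemma stabilizer_cancel:
  assumes "\<tau> \<in> stabilizer N h"
  shows "\<tau> \<circ> (inv \<tau> \<circ> \<sigma>) = \<sigma>" "inv \<tau> \<circ> (\<tau> \<circ> \<sigma>) = \<sigma>" "(\<sigma> \<circ> \<tau>) \<circ> inv \<tau> = \<sigma>" "(\<sigma> \<circ> inv \<tau>) \<circ> \<tau> = \<sigma>"
  using permutes_inverses[of \<tau> "{1..N}"] assms
  by (simp_all add: fun_eq_iff stabilizer_def perms_def)

lemma symmetrize_act: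
  assumes \<tau>: "\<tau> \<in> stabilizer N h" shows "symmetrize N h (act \<tau> f) = symmetrize N h f"
proof
  fix r
  show "symmetrize N h (act \<tau> f) r = symmetrize N h f r"
    unfolding symmetrize_def act_def
    by (rule sum.reindex_bij_witness[where i = "\<lambda>\<sigma>. \<sigma> \<circ> inv \<tau>" and j = "\<lambda>\<sigma>. \<sigma> \<circ> \<tau>"])
      (simp_all add: stabilizer_cancel[OF \<tau>] stabilizer_compose stabilizer_inv \<tau> o_assoc)
qed

lemma symmetrize_symmetrize:
  "symmetrize N h (symmetrize N h f) = scale_fun (of_nat (card (stabilizer N h))) (symmetrize N h f)"
proof
  fix r
  have "(\<Sum>\<tau>\<in>stabilizer N h. f (r \<circ> \<sigma> \<circ> \<tau>)) = symmetrize N h f r" if \<sigma>: "\<sigma> \<in> stabilizer N h" for \<sigma>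
    unfolding symmetrize_def
    by (rule sum.reindex_bij_witness[where i = "\<lambda>\<tau>. inv \<sigma> \<circ> \<tau>" and j = "\<lambda>\<tau>. \<sigma> \<circ> \<tau>"])
      (simp_all add: stabilizer_cancel[OF \<sigma>] stabilizer_compose stabilizer_inv \<sigma> comp_assoc)
  then show "symmetrize N h (symmetrize N h f) r = scale_fun (of_nat (card (stabilizer N h))) (symmetrize N h f) r"
    unfolding symmetrize_def[of N h "symmetrize N h f"] scale_fun_def
    by (simp add: symmetrize_def)
qed

text \<open>Conjugating the coordinates gives a second expansion of the same real vector in the same
  real basis, and coordinates are unique.\<close>

lemma representation_cnj:
  assumes B: "cfun.independent B" "finite B" "\<And>b x. b \<in> B \<Longrightarrow> cnj (b x) = b x"
    and v: "v \<in> cfun.span B" "\<And>x. cnj (v x) = v x"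
  shows "cnj (cfun.representation B v b) = cfun.representation B v b"
proof (cases "b \<in> B")
  case True
  let ?c = "cfun.representation B v"
  have "v x = (\<Sum>b\<in>B. cnj (?c b) * b x)" for x
  proof -
    have "v x = (\<Sum>b\<in>B. scale_fun (?c b) b) x" using cfun.sum_representation_eq[OF B(1) v(1) B(2)] by simp
    then have "cnj (v x) = cnj (\<Sum>b\<in>B. ?c b * b x)" by (simp add: sum_fun_apply scale_fun_def)
    then show ?thesis using v(2) B(3) by (simp add: cnj_sum)
  qed
  then have "v = (\<Sum>b\<in>B. scale_fun (cnj (?c b)) b)" by (simp add: fun_eq_iff sum_fun_apply scale_fun_def)
  then have "?c b = cfun.representation B (\<Sum>b\<in>B. scale_fun (cnj (?c b)) b) b" by simp
  also have "\<dots> = (\<Sum>b'\<in>B. cnj (?c b') * (if b = b' then 1 else 0))"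
    by (simp add: cfun.representation_sum cfun.representation_scale cfun.representation_basis B(1)
      cfun.span_scale cfun.span_base)
  also have "\<dots> = cnj (?c b)" using True B(2) by (simp add: if_distrib cong: if_cong)
  finally show ?thesis by simp
next
  case False
  then have "cfun.representation B v b = 0" using cfun.representation_ne_zero by blast
  then show ?thesis by simp
qed

section \<open>Specht characters against permutation characters\<close>

context partition_of
begin

lemma specht_basis:
  obtains B where "B \<subseteq> polytabloid \<alpha> ` tableaux \<alpha>" "cfun.independent B" "finite B" "cfun.span B = specht \<alpha>"
proof -
  obtain B where B: "B \<subseteq> polytabloid \<alpha> ` tableaux \<alpha>" "cfun.independent B" "polytabloid \<alpha> ` tableaux \<alpha> \<subseteq> cfun.span B"
    using cfun.maximal_independent_subset by blast
  have sp: "cfun.span B = specht \<alpha>" unfolding specht_def using B cfun.span_superset[of "polytabloid \<alpha> ` tableaux \<alpha>"]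
    by (auto simp: cfun.span_eq)
  have "B \<subseteq> cfun.span (point ` fillings N (\<lambda>i. int (\<alpha> i)))"
    unfolding span_points[OF finite_fillings] using sp specht_supported cfun.span_superset[of B] by auto
  from cfun.independent_span_bound[OF _ B(2) this] have "finite B" by simp
  then show thesis using that B sp by blast
qed

lemma irr_char_basis:
  assumes "cfun.independent B" "finite B" "cfun.span B = specht \<alpha>" "\<sigma> \<in> perms N"
  shows "irr_char \<alpha> \<sigma> = (\<Sum>b\<in>B. cfun.representation B (act \<sigma> b) b)"
proof -
  have "irr_char \<alpha> \<sigma> = trace_on (specht \<alpha>) (act \<sigma>)" by (simp add: irr_char_def act_def[abs_def])
  also have "\<dots> = (\<Sum>b\<in>B. cfun.representation B (act \<sigma> b) b)"
    by (rule trace_on_basis[OF assms(1-3) endo_act act_specht[OF assms(4)]])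
  finally show ?thesis .
qed

lemma polytabloid_real: "cnj (polytabloid \<alpha> T r) = polytabloid \<alpha> T r"
  unfolding polytabloid_def cnj_sum by (rule sum.cong) auto

text \<open>Polytabloids have integer values, so a basis of polytabloids gives real matrices. This
  allows inner products of characters to be written without conjugation.\<close>

lemma irr_char_real:
  assumes \<sigma>: "\<sigma> \<in> perms N" shows "cnj (irr_char \<alpha> \<sigma>) = irr_char \<alpha> \<sigma>"
proof -
  obtain B where B: "B \<subseteq> polytabloid \<alpha> ` tableaux \<alpha>" "cfun.independent B" "finite B" "cfun.span B = specht \<alpha>"
    by (rule specht_basis)
  have real: "cnj (b x) = b x" if "b \<in> B" for b x using B(1) that polytabloid_real by auto
  have "cnj (cfun.representation B (act \<sigma> b) b) = cfun.representation B (act \<sigma> b) b" if b: "b \<in> B" for b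
  proof (rule representation_cnj[OF B(2,3)])
    show "act \<sigma> b \<in> cfun.span B" using act_specht[OF \<sigma>] cfun.span_base[OF b] B(4) by simp
    show "cnj (act \<sigma> b x) = act \<sigma> b x" for x using real[OF b] by (simp add: act_def)
    show "cnj (b' x) = b' x" if "b' \<in> B" for b' x using real[OF that] .
  qed
  then show ?thesis by (simp add: irr_char_basis[OF B(2-4) \<sigma>] cnj_sum)
qed

lemma mat_rep_specht:
  assumes "cfun.independent B" "finite B" "cfun.span B = specht \<alpha>"
  shows "mat_rep N B (\<lambda>\<sigma> b c. cfun.representation B (act \<sigma> c) b)"
proof -
  have "act \<sigma> 0 = 0" for \<sigma> by (rule module_hom.zero[OF endo_act])
  then have "mat_rep N (B - {}) (\<lambda>\<sigma> b c. cfun.representation B (act \<sigma> c) b)"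
    using assms act_specht by (intro mat_rep_act) auto
  then show ?thesis by simp
qed

lemma irr_char_mat_rep:
  obtains I :: "((nat \<Rightarrow> nat) \<Rightarrow> complex) set" and R where "mat_rep N I R"
    "\<And>\<sigma>. \<sigma> \<in> perms N \<Longrightarrow> irr_char \<alpha> \<sigma> = (\<Sum>i\<in>I. R \<sigma> i i)"
proof -
  obtain B where B: "cfun.independent B" "finite B" "cfun.span B = specht \<alpha>"
    using specht_basis by metis
  show thesis by (rule that[OF mat_rep_specht[OF B]]) (rule irr_char_basis[OF B])
qed

text \<open>
  The difference is the character of the quotient of the permutation module by the
  Specht module.
\<close>

lemma phi_minus_irr_char_mat_rep:
  obtains I :: "((nat \<Rightarrow> nat) \<Rightarrow> complex) set" and R where "mat_rep N I R"
    "\<And>\<sigma>. \<sigma> \<in> perms N \<Longrightarrow> of_int (phi N (\<lambda>i. int (\<alpha> i)) \<sigma>) - irr_char \<alpha> \<sigma> = (\<Sum>i\<in>I. R \<sigma> i i)"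
proof -
  let ?X = "fillings N (\<lambda>i. int (\<alpha> i))"
  obtain B where B: "B \<subseteq> polytabloid \<alpha> ` tableaux \<alpha>" "cfun.independent B" "finite B" "cfun.span B = specht \<alpha>"
    by (rule specht_basis)
  have BM: "B \<subseteq> supported ?X" using B(4) cfun.span_superset[of B] specht_supported by auto
  obtain D where D: "B \<subseteq> D" "D \<subseteq> supported ?X" "cfun.independent D" "supported ?X \<subseteq> cfun.span D"
    using cfun.maximal_independent_subset_extend[OF BM B(2)] by blast
  have spD: "cfun.span D = supported ?X"
    using D cfun.span_minimal[OF D(2) subspace_supported] by blast
  have finD: "finite D"
    using cfun.independent_span_bound[OF _ D(3), of "point ` ?X"] D(2) by (simp add: span_points)
  have "of_int (phi N (\<lambda>i. int (\<alpha> i)) \<sigma>) - irr_char \<alpha> \<sigma> = (\<Sum>b\<in>D - B. cfun.representation D (act \<sigma> b) b)"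
    if \<sigma>: "\<sigma> \<in> perms N" for \<sigma>
  proof -
    have "of_int (phi N (\<lambda>i. int (\<alpha> i)) \<sigma>) = (\<Sum>b\<in>D. cfun.representation D (act \<sigma> b) b)"
      unfolding trace_on_supported[OF \<sigma>, symmetric] by (rule trace_on_basis[OF D(3) finD spD endo_act act_supported[OF \<sigma>]])
    also have "\<dots> = (\<Sum>b\<in>D - B. cfun.representation D (act \<sigma> b) b) + (\<Sum>b\<in>B. cfun.representation D (act \<sigma> b) b)"
      by (rule sum.subset_diff[OF D(1) finD])
    also have "(\<Sum>b\<in>B. cfun.representation D (act \<sigma> b) b) = (\<Sum>b\<in>B. cfun.representation B (act \<sigma> b) b)"
    proof (rule sum.cong)
      fix b assume "b \<in> B"
      then have "act \<sigma> b \<in> cfun.span B" using act_specht[OF \<sigma>] cfun.span_base[of b B] B(4) by simp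
      then show "cfun.representation D (act \<sigma> b) b = cfun.representation B (act \<sigma> b) b"
        by (simp only: cfun.representation_extend[OF D(3) _ D(1)])
    qed simp
    finally show ?thesis by (simp add: irr_char_basis[OF B(2-4) \<sigma>])
  qed
  moreover have "mat_rep N (D - B) (\<lambda>\<sigma> b c. cfun.representation D (act \<sigma> c) b)"
    by (rule mat_rep_act) (simp_all only: D finD spD B(4) act_supported act_specht simp_thms)
  ultimately show thesis using that by blast
qed

text \<open>The sum over a Young subgroup becomes the trace of \<open>symmetrize\<close> on the
  Specht module; its value follows from what \<open>symmetrize\<close> does to polytabloids.\<close>

lemma sum_irr_char_stabilizer:
  assumes B: "cfun.independent B" "finite B" "cfun.span B = specht \<alpha>"
  shows "(\<Sum>\<sigma>\<in>stabilizer N h. irr_char \<alpha> \<sigma>) = (\<Sum>b\<in>B. cfun.representation B (symmetrize N h b) b)"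
proof -
  have "(\<Sum>\<sigma>\<in>stabilizer N h. irr_char \<alpha> \<sigma>) = (\<Sum>\<sigma>\<in>stabilizer N h. \<Sum>b\<in>B. cfun.representation B (act \<sigma> b) b)"
    by (intro sum.cong refl irr_char_basis B stabilizer_perms)
  also have "\<dots> = (\<Sum>b\<in>B. \<Sum>\<sigma>\<in>stabilizer N h. cfun.representation B (act \<sigma> b) b)" by (rule sum.swap)
  also have "\<dots> = (\<Sum>b\<in>B. cfun.representation B (symmetrize N h b) b)"
  proof (rule sum.cong)
    fix b assume b: "b \<in> B"
    have "act \<sigma> b \<in> cfun.span B" if "\<sigma> \<in> stabilizer N h" for \<sigma>
      using act_specht[OF stabilizer_perms[OF that]] cfun.span_base[OF b] B(3) by simp
    then show "(\<Sum>\<sigma>\<in>stabilizer N h. cfun.representation B (act \<sigma> b) b) = cfun.representation B (symmetrize N h b) b"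
      unfolding symmetrize_eq_sum_act by (simp only: cfun.representation_sum[OF B(1)])
  qed simp
  finally show ?thesis .
qed

text \<open>The transposition of \<open>x\<close> and \<open>y\<close> preserves \<open>h\<close>,
  so it is invisible to \<open>symmetrize\<close>; it also preserves columns, so it negates the
  polytabloid. The result equals its own negative.\<close>

lemma symmetrize_polytabloid_zero:
  assumes xy: "x \<in> {1..N}" "y \<in> {1..N}" "x \<noteq> y" "h x = h y" "snd (T x) = snd (T y)"
  shows "symmetrize N h (polytabloid \<alpha> T) = 0"
proof -
  let ?t = "transpose x y"
  have t: "?t \<in> perms N" using xy by (auto simp: perms_def permutes_swap_id simp del: atLeastAtMost_iff)
  have "h \<circ> ?t = h" using xy(4) by (auto simp: fun_eq_iff transpose_def)
  then have st: "?t \<in> stabilizer N h" using t by (simp add: stabilizer_def)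
  have "snd (T (?t z)) = snd (T z)" for z using xy(5) by (auto simp: transpose_def)
  then have col: "?t \<in> column_group \<alpha> T" using t by (simp add: column_group_eq)
  have "act ?t (polytabloid \<alpha> T) = polytabloid \<alpha> (T \<circ> ?t)"
    unfolding act_polytabloid[OF t] by (simp add: inv_transpose_eq)
  also have "\<dots> = scale_fun (- 1) (polytabloid \<alpha> T)"
    unfolding polytabloid_column[OF col] using xy(3) by (simp add: sign_swap_id)
  finally have "symmetrize N h (polytabloid \<alpha> T) = symmetrize N h (scale_fun (- 1) (polytabloid \<alpha> T))"
    using symmetrize_act[OF st] by metis
  also have "\<dots> = scale_fun (- 1) (symmetrize N h (polytabloid \<alpha> T))"
    by (rule module_hom.scale[OF endo_symmetrize])
  finally have eq: "symmetrize N h (polytabloid \<alpha> T) = scale_fun (- 1) (symmetrize N h (polytabloid \<alpha> T))" .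
  have "symmetrize N h (polytabloid \<alpha> T) r = 0" for r using fun_cong[OF eq, of r] by (simp add: scale_fun_def)
  then show ?thesis by (simp add: fun_eq_iff)
qed

text \<open>As \<gamma> exceeds \<alpha> in a partial sum, dominance forbids a filling of content
  \<gamma> that is injective on every column of a tableau. So \<open>symmetrize\<close> kills every
  polytabloid.\<close>

lemma sum_irr_char_phi_zero:
  assumes "(\<Sum>i<n. \<gamma> i) > int (\<Sum>i<n. \<alpha> i)"
  shows "(\<Sum>\<sigma>\<in>perms N. irr_char \<alpha> \<sigma> * of_int (phi N \<gamma> \<sigma>)) = 0"
  unfolding sum_phi_times
proof (rule sum.neutral, rule ballI)
  fix h assume h: "h \<in> fillings N \<gamma>"
  obtain B where B: "B \<subseteq> polytabloid \<alpha> ` tableaux \<alpha>" "cfun.independent B" "finite B" "cfun.span B = specht \<alpha>"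
    by (rule specht_basis)
  have "symmetrize N h b = 0" if b: "b \<in> B" for b
  proof -
    obtain T where T: "T \<in> tableaux \<alpha>" "b = polytabloid \<alpha> T" using B(1) b by blast
    have "\<exists>x\<in>{1..N}. \<exists>y\<in>{1..N}. h x = h y \<and> snd (T x) = snd (T y) \<and> x \<noteq> y"
    proof (rule ccontr)
      assume "\<not> ?thesis"
      then have "x = y" if "x \<in> {1..N}" "y \<in> {1..N}" "h x = h y" "snd (T x) = snd (T y)" for x y
        using that by blast
      then have "(\<Sum>i<n. \<gamma> i) \<le> int (\<Sum>i<n. \<alpha> i)" by (rule dominance[OF T(1) h])
      then show False using assms by linarith
    qed
    then show ?thesis unfolding T(2) using symmetrize_polytabloid_zero[of _ _ h T] by blast
  qed
  then show "(\<Sum>\<sigma>\<in>stabilizer N h. irr_char \<alpha> \<sigma>) = 0"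
    unfolding sum_irr_char_stabilizer[OF B(2-4)] by (simp add: cfun.representation_zero)
qed

text \<open>Unless the result is 0, the tableau \<open>?U\<close> with rows from \<open>h\<close>
  and columns from \<open>T\<close> links the two: it arises from \<open>T\<close> by a column
  permutation, which costs a sign, and from \<open>T0\<close> by an element of the stabilizer, which
  costs nothing.\<close>

lemma symmetrize_polytabloid_multiple:
  assumes T0: "T0 \<in> tableaux \<alpha>" "tabloid \<alpha> T0 = h" and T: "T \<in> tableaux \<alpha>"
  shows "\<exists>c. symmetrize N h (polytabloid \<alpha> T) = scale_fun c (symmetrize N h (polytabloid \<alpha> T0))"
proof (cases "\<exists>x\<in>{1..N}. \<exists>y\<in>{1..N}. h x = h y \<and> snd (T x) = snd (T y) \<and> x \<noteq> y")
  case True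
  then have "symmetrize N h (polytabloid \<alpha> T) = 0" using symmetrize_polytabloid_zero[of _ _ h T] by blast
  then show ?thesis by (intro exI[of _ 0]) simp
next
  case False
  let ?U = "\<lambda>x. (h x, snd (T x))"
  have h: "h \<in> fillings N (\<lambda>i. int (\<alpha> i))" using tabloid_fillings[OF T0(1)] T0(2) by simp
  have U: "?U \<in> tableaux \<alpha>" using False by (intro straighten[OF T h]) blast
  obtain p where p: "p \<in> perms N" "\<And>x. x \<in> {1..N} \<Longrightarrow> ?U x = T (p x)"
    using tableaux_transitive[OF T U] by blast
  have "snd (T (p x)) = snd (T x)" if "x \<in> {1..N}" for x
    using arg_cong[OF p(2)[OF that], of snd] by simp
  then have pc: "p \<in> column_group \<alpha> T" unfolding column_group_eq using p(1) by blast
  have eU: "polytabloid \<alpha> ?U = scale_fun (of_int (sign p)) (polytabloid \<alpha> T)"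
    unfolding polytabloid_column[OF pc, symmetric] by (rule polytabloid_cong) (use p in simp)
  obtain \<rho> where \<rho>: "\<rho> \<in> perms N" "\<And>x. x \<in> {1..N} \<Longrightarrow> ?U x = T0 (\<rho> x)"
    using tableaux_transitive[OF T0(1) U] by blast
  have "h (\<rho> x) = h x" for x
  proof (cases "x \<in> {1..N}")
    case True
    then have "\<rho> x \<in> {1..N}" using perms_in[OF \<rho>(1)] by blast
    then have "h (\<rho> x) = fst (T0 (\<rho> x))" unfolding T0(2)[symmetric] by (simp add: tabloid_def)
    also have "\<dots> = h x" using arg_cong[OF \<rho>(2)[OF True], of fst] by simp
    finally show ?thesis .
  next
    case False
    show ?thesis unfolding perms_out[OF \<rho>(1) False] ..
  qed
  then have st: "inv \<rho> \<in> stabilizer N h" using \<rho>(1) by (intro stabilizer_inv) (simp add: stabilizer_def fun_eq_iff)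
  have "act (inv \<rho>) (polytabloid \<alpha> T0) = polytabloid \<alpha> (T0 \<circ> \<rho>)"
    unfolding act_polytabloid[OF perms_inv[OF \<rho>(1)]] perms_cancel(5)[OF \<rho>(1)] ..
  also have "\<dots> = polytabloid \<alpha> ?U" by (rule polytabloid_cong) (simp only: comp_apply \<rho>(2))
  finally have actU: "act (inv \<rho>) (polytabloid \<alpha> T0) = polytabloid \<alpha> ?U" .
  have "symmetrize N h (polytabloid \<alpha> T0) = symmetrize N h (polytabloid \<alpha> ?U)"
    unfolding actU[symmetric] by (rule symmetrize_act[OF st, symmetric])
  also have "\<dots> = scale_fun (of_int (sign p)) (symmetrize N h (polytabloid \<alpha> T))"
    unfolding eU by (rule module_hom.scale[OF endo_symmetrize])
  finally have eq: "symmetrize N h (polytabloid \<alpha> T0) = scale_fun (of_int (sign p)) (symmetrize N h (polytabloid \<alpha> T))" .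
  have "scale_fun (of_int (sign p)) (symmetrize N h (polytabloid \<alpha> T0)) = symmetrize N h (polytabloid \<alpha> T)"
    unfolding eq by (simp add: sign_def scale_fun_def)
  then show ?thesis by (intro exI[of _ "of_int (sign p)"]) (rule sym)
qed

text \<open>\<open>symmetrize\<close> maps the Specht module into the line spanned by
  \<open>v\<close>, on which it acts as the order \<open>m\<close> of the stabilizer. So its trace
  is \<open>m\<close>, and these orders add up to the order of the group.\<close>

lemma sum_irr_char_phi_self:
  "(\<Sum>\<sigma>\<in>perms N. irr_char \<alpha> \<sigma> * of_int (phi N (\<lambda>i. int (\<alpha> i)) \<sigma>)) = fact N"
proof -
  let ?X = "fillings N (\<lambda>i. int (\<alpha> i))"
  have "(\<Sum>\<sigma>\<in>stabilizer N h. irr_char \<alpha> \<sigma>) = of_nat (card (stabilizer N h))" if h: "h \<in> ?X" for h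
  proof -
    obtain T1 where T1: "T1 \<in> tableaux \<alpha>" by (rule ex_tableau)
    obtain p where p: "p \<in> perms N" "h = tabloid \<alpha> T1 \<circ> p"
      using fillings_transitive[OF tabloid_fillings[OF T1] h] by blast
    define T0 where "T0 = T1 \<circ> p"
    have T0: "T0 \<in> tableaux \<alpha>" "tabloid \<alpha> T0 = h"
      using tableau_compose[OF T1 p(1)] tabloid_compose[OF p(1)] p(2) by (simp_all add: T0_def)
    define v where "v = symmetrize N h (polytabloid \<alpha> T0)"
    define m :: complex where "m = of_nat (card (stabilizer N h))"
    have "id \<in> stabilizer N h" by (simp add: stabilizer_def perms_def permutes_id)
    then have "card (stabilizer N h) \<noteq> 0" by (metis card_0_eq empty_iff finite_stabilizer)
    then have m: "m \<noteq> 0" by (simp add: m_def)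
    \<comment> \<open>The stabilizer fixes \<open>h\<close>, so each term is the coefficient 1 of
      the polytabloid at its own tabloid; thus \<open>v\<close> is not 0.\<close>
    have "v h = (\<Sum>\<sigma>\<in>stabilizer N h. polytabloid \<alpha> T0 h)"
      unfolding v_def symmetrize_def by (rule sum.cong) (auto simp: stabilizer_def)
    then have vh: "v h = m" using polytabloid_own_tabloid[OF T0(1)] T0(2) by (simp add: m_def)
    obtain B where B: "B \<subseteq> polytabloid \<alpha> ` tableaux \<alpha>" "cfun.independent B" "finite B" "cfun.span B = specht \<alpha>"
      by (rule specht_basis)
    have "\<exists>c. symmetrize N h b = scale_fun c v" if "b \<in> B" for b
      using symmetrize_polytabloid_multiple[OF T0] B(1) that unfolding v_def by blast
    then obtain c where c: "\<And>b. b \<in> B \<Longrightarrow> symmetrize N h b = scale_fun (c b) v" by metis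
    have "polytabloid \<alpha> T0 \<in> specht \<alpha>" unfolding specht_def using T0(1) by (intro cfun.span_base) blast
    then have v: "v \<in> cfun.span B"
      unfolding v_def symmetrize_eq_sum_act B(4)
      by (subst B(4)[symmetric], intro cfun.span_sum) (simp add: B(4) act_specht stabilizer_perms)
    \<comment> \<open>Expanded in the basis and evaluated at \<open>h\<close>, the eigenvalue
      equation for \<open>v\<close> says that the trace of \<open>symmetrize\<close> is
      \<open>m\<close>.\<close>
    have "symmetrize N h v = (\<Sum>b\<in>B. scale_fun (cfun.representation B v b) (symmetrize N h b))"
    proof -
      have "symmetrize N h v = symmetrize N h (\<Sum>b\<in>B. scale_fun (cfun.representation B v b) b)"
        using cfun.sum_representation_eq[OF B(2) v B(3)] by simp
      then show ?thesis by (simp only: module_hom.sum[OF endo_symmetrize] module_hom.scale[OF endo_symmetrize])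
    qed
    then have "scale_fun m v h = (\<Sum>b\<in>B. scale_fun (cfun.representation B v b) (symmetrize N h b)) h"
      unfolding v_def symmetrize_symmetrize m_def by (rule fun_cong)
    also have "\<dots> = (\<Sum>b\<in>B. cfun.representation B v b * (c b * v h))"
      unfolding sum_fun_apply by (intro sum.cong) (simp_all add: c scale_fun_def)
    finally have "m * m = (\<Sum>b\<in>B. c b * cfun.representation B v b) * m"
      unfolding scale_fun_def vh sum_distrib_right by (simp add: ac_simps)
    then have "(\<Sum>b\<in>B. c b * cfun.representation B v b) = m" using m by simp
    moreover have "(\<Sum>b\<in>B. cfun.representation B (symmetrize N h b) b) = (\<Sum>b\<in>B. c b * cfun.representation B v b)"
      by (intro sum.cong) (simp_all add: c cfun.representation_scale[OF B(2) v])
    ultimately show ?thesis unfolding sum_irr_char_stabilizer[OF B(2-4)] m_def by simp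
  qed
  then have "(\<Sum>\<sigma>\<in>perms N. irr_char \<alpha> \<sigma> * of_int (phi N (\<lambda>i. int (\<alpha> i)) \<sigma>)) = (\<Sum>h\<in>?X. of_nat (card (stabilizer N h)))"
    unfolding sum_phi_times by (intro sum.cong) auto
  also have "\<dots> = of_nat (\<Sum>h\<in>?X. card (stabilizer N h))" by simp
  also have "\<dots> = fact N"
  proof -
    obtain T1 where "T1 \<in> tableaux \<alpha>" by (rule ex_tableau)
    then have "?X \<noteq> {}" using tabloid_fillings by blast
    then show ?thesis by (simp add: sum_card_stabilizer)
  qed
  finally show ?thesis .
qed

text \<open>For \<open>w\<close> other than the identity, the content \<alpha> + \<delta> -
  w\<delta> exceeds \<alpha> in some partial sum, so its \<open>phi\<close> is orthogonal to the
  character. Only the term at the identity remains.\<close>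

lemma sum_irr_char_psi:
  assumes L: "N \<le> L"
  shows "(\<Sum>\<sigma>\<in>perms N. irr_char \<alpha> \<sigma> * of_int (psi L N (shifted L \<alpha>) \<sigma>)) = fact N"
proof -
  let ?g = "\<lambda>w i. shifted L \<alpha> i - del L (w i)"
  let ?s = "\<lambda>w. \<Sum>\<sigma>\<in>perms N. irr_char \<alpha> \<sigma> * of_int (phi N (?g w) \<sigma>)"
  have s: "?s w = (if w = id then fact N else 0)" if w: "w permutes {..<L}" for w
  proof (cases "w = id")
    case True
    have "?g id = (\<lambda>i. int (\<alpha> i))" by (simp add: shifted_def)
    then show ?thesis using True sum_irr_char_phi_self by simp
  next
    case False
    obtain n where n: "n \<le> L" "(\<Sum>i<n. del L (w i)) < (\<Sum>i<n. del L i)" using sum_del_less[OF w False] by blast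
    have "int (\<Sum>i<n. \<alpha> i) < (\<Sum>i<n. ?g w i)"
      using n(2) by (simp add: shifted_def sum.distrib sum_subtractf)
    then show ?thesis using False sum_irr_char_phi_zero by simp
  qed
  have "(\<Sum>\<sigma>\<in>perms N. irr_char \<alpha> \<sigma> * of_int (psi L N (shifted L \<alpha>) \<sigma>)) =
    (\<Sum>\<sigma>\<in>perms N. \<Sum>w\<in>rowperms L. of_int (sign w) * (irr_char \<alpha> \<sigma> * of_int (phi N (?g w) \<sigma>)))"
    by (simp add: psi_def sum_distrib_left mult.left_commute)
  also have "\<dots> = (\<Sum>w\<in>rowperms L. \<Sum>\<sigma>\<in>perms N. of_int (sign w) * (irr_char \<alpha> \<sigma> * of_int (phi N (?g w) \<sigma>)))"
    by (rule sum.swap)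
  also have "\<dots> = (\<Sum>w\<in>rowperms L. of_int (sign w) * ?s w)" by (simp add: sum_distrib_left)
  also have "\<dots> = (\<Sum>w\<in>rowperms L. if w = id then fact N else 0)"
    using s by (intro sum.cong) auto
  also have "\<dots> = fact N" by (simp add: permutes_id)
  finally show ?thesis .
qed

text \<open>The squared norm of \<chi> is 1 - m, where m is the average of \<chi>(\<phi> - \<chi>).
  Both factors are traces of matrix representations, so m is a natural number. The squared distance
  to \<open>psi\<close> comes out as -m and must be 0.\<close>

lemma irr_char_eq_psi:
  assumes L: "N \<le> L" and \<sigma>: "\<sigma> \<in> perms N"
  shows "irr_char \<alpha> \<sigma> = of_int (psi L N (shifted L \<alpha>) \<sigma>)"
proof -
  let ?\<phi> = "phi N (\<lambda>i. int (\<alpha> i))" and ?\<psi> = "psi L N (shifted L \<alpha>)"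
  define x where "x \<sigma> = Re (irr_char \<alpha> \<sigma>)" for \<sigma>
  have x: "irr_char \<alpha> \<sigma> = of_real (x \<sigma>)" if "\<sigma> \<in> perms N" for \<sigma>
    using irr_char_real[OF that] by (simp add: x_def complex_eq_iff)
  obtain I :: "((nat \<Rightarrow> nat) \<Rightarrow> complex) set" and R where R: "mat_rep N I R"
    "\<And>\<sigma>. \<sigma> \<in> perms N \<Longrightarrow> irr_char \<alpha> \<sigma> = (\<Sum>i\<in>I. R \<sigma> i i)"
    using irr_char_mat_rep by metis
  obtain J :: "((nat \<Rightarrow> nat) \<Rightarrow> complex) set" and S where S: "mat_rep N J S"
    "\<And>\<sigma>. \<sigma> \<in> perms N \<Longrightarrow> of_int (?\<phi> \<sigma>) - irr_char \<alpha> \<sigma> = (\<Sum>i\<in>J. S \<sigma> i i)"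
    using phi_minus_irr_char_mat_rep by metis
  have "(\<Sum>\<sigma>\<in>perms N. irr_char \<alpha> \<sigma> * (of_int (?\<phi> \<sigma>) - irr_char \<alpha> \<sigma>)) / fact N \<in> \<nat>"
  proof -
    have "(\<Sum>\<sigma>\<in>perms N. irr_char \<alpha> \<sigma> * (of_int (?\<phi> \<sigma>) - irr_char \<alpha> \<sigma>)) =
      (\<Sum>\<sigma>\<in>perms N. \<Sum>x\<in>I \<times> J. R \<sigma> (fst x) (fst x) * S \<sigma> (snd x) (snd x))"
      unfolding sum_diagonal_times by (intro sum.cong refl) (simp only: R(2)[symmetric] S(2)[symmetric])
    then show ?thesis using mat_rep_average_trace[OF mat_rep_times[OF R(1) S(1)]] by simp
  qed
  then obtain m where m: "(\<Sum>\<sigma>\<in>perms N. irr_char \<alpha> \<sigma> * (of_int (?\<phi> \<sigma>) - irr_char \<alpha> \<sigma>)) / fact N = of_nat m"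
    by (auto simp: Nats_def)
  have "(\<Sum>\<sigma>\<in>perms N. irr_char \<alpha> \<sigma> * irr_char \<alpha> \<sigma>) =
    (\<Sum>\<sigma>\<in>perms N. irr_char \<alpha> \<sigma> * of_int (?\<phi> \<sigma>)) - (\<Sum>\<sigma>\<in>perms N. irr_char \<alpha> \<sigma> * (of_int (?\<phi> \<sigma>) - irr_char \<alpha> \<sigma>))"
    by (simp add: right_diff_distrib sum_subtractf)
  also have "\<dots> = fact N - fact N * of_nat m"
    using m sum_irr_char_phi_self by (simp add: field_simps)
  finally have sq: "(\<Sum>\<sigma>\<in>perms N. irr_char \<alpha> \<sigma> * irr_char \<alpha> \<sigma>) = fact N - fact N * of_nat m" .
  have "complex_of_real (\<Sum>\<sigma>\<in>perms N. (x \<sigma> - of_int (?\<psi> \<sigma>))\<^sup>2) =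
    (\<Sum>\<sigma>\<in>perms N. irr_char \<alpha> \<sigma> * irr_char \<alpha> \<sigma>) - 2 * (\<Sum>\<sigma>\<in>perms N. irr_char \<alpha> \<sigma> * of_int (?\<psi> \<sigma>))
      + of_int (\<Sum>\<sigma>\<in>perms N. ?\<psi> \<sigma> * ?\<psi> \<sigma>)"
    by (simp add: x power2_eq_square algebra_simps sum.distrib sum_subtractf sum_distrib_left)
  also have "\<dots> = complex_of_real (- (fact N * of_nat m))"
    unfolding sq sum_irr_char_psi[OF L] sum_psi_orthonormal[OF L part part] by simp
  finally have "(\<Sum>\<sigma>\<in>perms N. (x \<sigma> - of_int (?\<psi> \<sigma>))\<^sup>2) = - (fact N * of_nat m)"
    by (simp only: of_real_eq_iff)
  moreover have "(\<Sum>\<sigma>\<in>perms N. (x \<sigma> - of_int (?\<psi> \<sigma>))\<^sup>2) \<ge> 0" by (intro sum_nonneg) simp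
  moreover have "(fact N * of_nat m :: real) \<ge> 0" by simp
  ultimately have "(\<Sum>\<sigma>\<in>perms N. (x \<sigma> - of_int (?\<psi> \<sigma>))\<^sup>2) = 0" by linarith
  then have "(x \<sigma> - of_int (?\<psi> \<sigma>))\<^sup>2 = 0" using \<sigma> by (subst (asm) sum_nonneg_eq_0_iff) auto
  then show ?thesis using x[OF \<sigma>] by simp
qed

end

section \<open>Kronecker coefficients\<close>

lemma partitionsI:
  assumes "\<And>i j. i \<le> j \<Longrightarrow> \<alpha> j \<le> \<alpha> i" "\<And>i. i \<ge> L \<Longrightarrow> \<alpha> i = 0" "(\<Sum>i<L. \<alpha> i) = N"
  shows "\<alpha> \<in> partitions N"
proof -
  have "{i. \<alpha> i \<noteq> 0} \<subseteq> {..<L}"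
  proof
    fix i assume "i \<in> {i. \<alpha> i \<noteq> 0}"
    then show "i \<in> {..<L}" using assms(2)[of i] by (cases "i < L") auto
  qed
  then have "finite {i. \<alpha> i \<noteq> 0}" using finite_subset by blast
  then show ?thesis using assms(1,3) psize_eq_sum[of L \<alpha>] assms(2)
    by (simp add: partitions_def antimono_def)
qed

lemma finite_partitions [simp]: "finite (partitions N)"
proof -
  let ?F = "{\<alpha> :: nat \<Rightarrow> nat. \<forall>i. (i \<in> {..<N} \<longrightarrow> \<alpha> i \<in> {..N}) \<and> (i \<notin> {..<N} \<longrightarrow> \<alpha> i = 0)}"
  have "finite ?F" by (intro finite_set_of_finite_funs) auto
  moreover have "partitions N \<subseteq> ?F"
  proof
    fix \<alpha> assume \<alpha>: "\<alpha> \<in> partitions N"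
    have "\<alpha> i \<le> N" if "i < N" for i
    proof -
      have "\<alpha> i \<le> (\<Sum>i<N. \<alpha> i)" using that by (intro member_le_sum) auto
      then show ?thesis using partitions_sum[OF \<alpha>, of N] partitions_zero[OF \<alpha>] by simp
    qed
    then show "\<alpha> \<in> ?F" using partitions_zero[OF \<alpha>] by auto
  qed
  ultimately show ?thesis by (rule finite_subset[rotated])
qed

text \<open>Renaming the values of fillings. It serves to sort a content and to number a content
  indexed by pairs.\<close>

lemma phi_bij:
  fixes \<pi> :: "'k \<Rightarrow> 'l"
  assumes \<pi>: "bij \<pi>" and \<sigma>: "\<sigma> \<in> perms N"
  shows "phi N (a \<circ> \<pi>) \<sigma> = phi N a \<sigma>"
proof -
  let ?f = "\<lambda>h. restrict (\<pi> \<circ> h) {1..N}" and ?g = "\<lambda>h. restrict (inv \<pi> \<circ> h) {1..N}"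
  have c: "inv \<pi> (\<pi> x) = x" "\<pi> (inv \<pi> y) = y" for x y
    using \<pi> by (simp_all add: bij_is_inj bij_is_surj surj_f_inv_f)
  have sin: "\<sigma> x \<in> {1..N} \<longleftrightarrow> x \<in> {1..N}" for x
    using \<sigma> unfolding perms_def mem_Collect_eq by (rule permutes_in_image)
  have *: "restrict (p \<circ> h) {1..N} \<in> fixed_fillings N b \<sigma>"
    if h: "h \<in> fixed_fillings N (b \<circ> p) \<sigma>" and q: "\<And>x. q (p x) = x" "\<And>y. p (q y) = y"
    for p :: "'u \<Rightarrow> 'v" and q h b
  proof -
    have "int (card {x \<in> {1..N}. restrict (p \<circ> h) {1..N} x = k}) = b k" for k
    proof -
      have "p u = k \<longleftrightarrow> u = q k" for u using q by metis
      then have "{x \<in> {1..N}. restrict (p \<circ> h) {1..N} x = k} = {x \<in> {1..N}. h x = q k}" by auto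
      then show ?thesis using h q(2)[of k] fillings_card[of h N "b \<circ> p" "q k"] by (simp add: fixed_fillings_def)
    qed
    moreover have "h (\<sigma> x) = h x" for x using h by (auto simp: fixed_fillings_def fun_eq_iff)
    then have "restrict (p \<circ> h) {1..N} \<circ> \<sigma> = restrict (p \<circ> h) {1..N}"
      using sin by (auto simp: restrict_def fun_eq_iff simp del: atLeastAtMost_iff)
    ultimately show ?thesis unfolding fixed_fillings_def fillings_def by blast
  qed
  have restrict_id: "restrict h {1..N} = h" if "h \<in> fixed_fillings N b \<sigma>" for h :: "nat \<Rightarrow> 'u" and b
    using that by (simp add: fixed_fillings_def fillings_def extensional_restrict)
  have "bij_betw ?f (fixed_fillings N (a \<circ> \<pi>) \<sigma>) (fixed_fillings N a \<sigma>)"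
  proof (rule bij_betw_byWitness[where f' = ?g])
    show "\<forall>h\<in>fixed_fillings N (a \<circ> \<pi>) \<sigma>. ?g (?f h) = h"
    proof
      fix h assume h: "h \<in> fixed_fillings N (a \<circ> \<pi>) \<sigma>"
      have "?g (?f h) = restrict h {1..N}" by (rule ext) (simp add: restrict_def c)
      then show "?g (?f h) = h" using restrict_id[OF h] by simp
    qed
    show "\<forall>h\<in>fixed_fillings N a \<sigma>. ?f (?g h) = h"
    proof
      fix h assume h: "h \<in> fixed_fillings N a \<sigma>"
      have "?f (?g h) = restrict h {1..N}" by (rule ext) (simp add: restrict_def c)
      then show "?f (?g h) = h" using restrict_id[OF h] by simp
    qed
    show "?f ` fixed_fillings N (a \<circ> \<pi>) \<sigma> \<subseteq> fixed_fillings N a \<sigma>"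
      using *[of _ a \<pi> "inv \<pi>"] c by blast
    have "(a \<circ> \<pi>) \<circ> inv \<pi> = a" by (simp add: fun_eq_iff c)
    then show "?g ` fixed_fillings N a \<sigma> \<subseteq> fixed_fillings N (a \<circ> \<pi>) \<sigma>"
      using *[of _ "a \<circ> \<pi>" "inv \<pi>" \<pi>] c by (simp add: image_subset_iff)
  qed
  then show ?thesis by (simp add: phi_def bij_betw_same_card)
qed

text \<open>The coefficients may have either sign; for a product of two irreducible characters they
  are shown to be nonnegative separately, by means of representations.\<close>

definition int_span :: "nat \<Rightarrow> nat \<Rightarrow> ((nat \<Rightarrow> nat) \<Rightarrow> int) \<Rightarrow> bool" where
  "int_span L N f \<longleftrightarrow> (\<exists>c. \<forall>\<sigma>\<in>perms N. f \<sigma> = (\<Sum>\<delta>\<in>partitions N. c \<delta> * psi L N (shifted L \<delta>) \<sigma>))"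

lemma int_span_cong: "int_span L N f \<Longrightarrow> (\<And>\<sigma>. \<sigma> \<in> perms N \<Longrightarrow> g \<sigma> = f \<sigma>) \<Longrightarrow> int_span L N g"
  by (simp add: int_span_def)

lemma int_span_zero: "int_span L N (\<lambda>_. 0)"
  unfolding int_span_def by (rule exI[of _ "\<lambda>_. 0"]) simp

lemma int_span_add:
  assumes "int_span L N f" "int_span L N g" shows "int_span L N (\<lambda>\<sigma>. f \<sigma> + g \<sigma>)"
proof -
  obtain c d where "\<forall>\<sigma>\<in>perms N. f \<sigma> = (\<Sum>\<delta>\<in>partitions N. c \<delta> * psi L N (shifted L \<delta>) \<sigma>)"
    "\<forall>\<sigma>\<in>perms N. g \<sigma> = (\<Sum>\<delta>\<in>partitions N. d \<delta> * psi L N (shifted L \<delta>) \<sigma>)"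
    using assms unfolding int_span_def by blast
  then show ?thesis unfolding int_span_def
    by (intro exI[of _ "\<lambda>\<delta>. c \<delta> + d \<delta>"]) (simp add: distrib_right sum.distrib)
qed

lemma int_span_scale:
  assumes "int_span L N f" shows "int_span L N (\<lambda>\<sigma>. x * f \<sigma>)"
proof -
  obtain c where "\<forall>\<sigma>\<in>perms N. f \<sigma> = (\<Sum>\<delta>\<in>partitions N. c \<delta> * psi L N (shifted L \<delta>) \<sigma>)"
    using assms unfolding int_span_def by blast
  then show ?thesis unfolding int_span_def
    by (intro exI[of _ "\<lambda>\<delta>. x * c \<delta>"]) (simp add: sum_distrib_left mult.assoc)
qed

lemma int_span_sum:
  assumes "\<And>i. i \<in> I \<Longrightarrow> int_span L N (f i)" shows "int_span L N (\<lambda>\<sigma>. \<Sum>i\<in>I. f i \<sigma>)"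
  using assms
proof (induction I rule: infinite_finite_induct)
  case (insert i I)
  then show ?case using int_span_add[of L N "f i" "\<lambda>\<sigma>. \<Sum>i\<in>I. f i \<sigma>"] by simp
qed (simp_all add: int_span_zero)

lemma int_span_psi:
  assumes "\<alpha> \<in> partitions N" shows "int_span L N (psi L N (shifted L \<alpha>))"
proof -
  have "psi L N (shifted L \<alpha>) \<sigma> = (\<Sum>\<delta>\<in>partitions N. of_bool (\<delta> = \<alpha>) * psi L N (shifted L \<delta>) \<sigma>)" for \<sigma>
    using assms by (simp add: of_bool_def if_distrib[of "\<lambda>x. x * _"] cong: if_cong)
  then show ?thesis
    unfolding int_span_def by (intro exI[of _ "\<lambda>\<delta>. of_bool (\<delta> = \<alpha>)"] ballI)
qed

lemma phi_negative:
  assumes "a i < 0" shows "phi N a \<sigma> = 0"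
proof -
  have "fixed_fillings N a \<sigma> = {}"
    using fillings_card[of _ N a i] assms unfolding fixed_fillings_def by fastforce
  then show ?thesis by (simp add: phi_def)
qed

text \<open>As \<open>del L i - del L (w i)\<close> is \<open>w i - i\<close>, the sum is minus half
  the sum of the squares of \<open>i - w i\<close>, and some index is moved.\<close>

lemma weighted_sum_del:
  assumes w: "w permutes {..<L}" and "w \<noteq> id"
  shows "(\<Sum>i<L. int i * (del L i - del L (w i))) < 0"
proof -
  have wL: "w i < L" if "i < L" for i using permutes_in_image[OF w, of i] that by simp
  have "(\<Sum>i<L. int i * (del L i - del L (w i))) = (\<Sum>i<L. int i * int (w i) - int i * int i)"
  proof (rule sum.cong)
    fix i assume "i \<in> {..<L}"
    then have "del L i - del L (w i) = int (w i) - int i" using wL[of i] by (simp add: del_def)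
    then show "int i * (del L i - del L (w i)) = int i * int (w i) - int i * int i"
      by (simp only: right_diff_distrib)
  qed simp
  moreover have "(\<Sum>i<L. (int i - int (w i)) * (int i - int (w i))) =
    (\<Sum>i<L. int i * int i) + (\<Sum>i<L. int (w i) * int (w i)) - 2 * (\<Sum>i<L. int i * int (w i))"
    by (simp add: algebra_simps sum.distrib sum_subtractf sum_distrib_left)
  moreover have "(\<Sum>i<L. int (w i) * int (w i)) = (\<Sum>i<L. int i * int i)"
    using sum.permute[OF w, of "\<lambda>i. int i * int i"] by (simp add: o_def)
  moreover have "(\<Sum>i<L. (int i - int (w i)) * (int i - int (w i))) > 0"
  proof -
    obtain i where i: "w i \<noteq> i" using assms(2) by (auto simp: fun_eq_iff)
    then have "i \<in> {..<L}" using permutes_not_in[OF w] by blast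
    moreover have "(int i - int (w i)) * (int i - int (w i)) > 0" using i by (simp add: zero_less_mult_iff) linarith
    ultimately show ?thesis by (intro sum_pos2[of _ i]) auto
  qed
  ultimately show ?thesis by (simp add: sum_subtractf)
qed

text \<open>
  Induction on \<open>\<Sum>i a\<^sub>i\<close>, which drops when an ascent of \<open>a\<close> is sorted away, and also in
  every term other than \<open>w = id\<close> of the determinant that defines \<open>psi\<close>.
\<close>

lemma int_span_phi:
  assumes "N \<le> L" "L \<le> m" "\<And>i. a i \<ge> 0" "\<And>i. i \<ge> m \<Longrightarrow> a i = 0" "(\<Sum>i<m. a i) = int N"
  shows "int_span L N (phi N a)"
  using assms(3-5)
proof (induction a rule: measure_induct_rule[of "\<lambda>a. nat (\<Sum>i<m. int i * a i)"])
  case (less a)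
  have pos: "(\<Sum>i<m. int i * a i) \<ge> 0" using less.prems by (intro sum_nonneg) simp
  show ?case
  proof (cases "\<exists>i. a i < a (Suc i)")
    case True
    then obtain i where i: "a i < a (Suc i)" by blast
    let ?t = "transpose i (Suc i)" and ?b = "a \<circ> transpose i (Suc i)"
    have im: "Suc i < m"
    proof (rule ccontr)
      assume "\<not> Suc i < m"
      then have "a (Suc i) = 0" using less.prems(2) by simp
      then show False using i less.prems(1)[of i] by simp
    qed
    have t: "?t permutes {..<m}" using im by (intro permutes_swap_id) auto
    have b0: "?b j = 0" if "j \<ge> m" for j
      using less.prems(2)[OF that] that im by (simp add: transpose_def)
    have bs: "(\<Sum>j<m. ?b j) = int N" using sum.permute[OF t, of a] less.prems(3) by simp
    have "(\<Sum>j<m. int j * ?b j) = (\<Sum>j<m. int (?t j) * a j)"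
      using sum.permute[OF t, of "\<lambda>j. int j * ?b j"] by (simp add: o_def)
    also have "\<dots> < (\<Sum>j<m. int j * a j)"
    proof -
      have "(\<Sum>j<m. int j * a j) - (\<Sum>j<m. int (?t j) * a j) = (\<Sum>j<m. (int j - int (?t j)) * a j)"
        by (simp add: sum_subtractf left_diff_distrib)
      also have "\<dots> = (\<Sum>j\<in>{i, Suc i}. (int j - int (?t j)) * a j)"
        using im by (intro sum.mono_neutral_right) (auto simp: transpose_def)
      also have "\<dots> = a (Suc i) - a i" by simp
      finally show ?thesis using i by simp
    qed
    finally have lt: "(\<Sum>j<m. int j * ?b j) < (\<Sum>j<m. int j * a j)" .
    have "(\<Sum>j<m. int j * ?b j) \<ge> 0" using less.prems(1) by (intro sum_nonneg) simp
    then have "int_span L N (phi N ?b)"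
      using lt less.prems(1) b0 bs by (intro less.IH) auto
    then show ?thesis by (rule int_span_cong) (simp add: phi_bij)
  next
    case False
    have mono: "a j \<le> a i" if "i \<le> j" for i j
      using False by (intro lift_Suc_antimono_le[OF _ that]) (simp add: not_less)
    define \<alpha> where "\<alpha> i = nat (a i)" for i
    have a: "a i = int (\<alpha> i)" for i using less.prems(1) by (simp add: \<alpha>_def)
    have \<alpha>: "\<alpha> \<in> partitions N"
    proof (rule partitionsI)
      show "(\<Sum>i<m. \<alpha> i) = N" using less.prems(3) unfolding a by (simp flip: of_nat_sum)
    qed (use mono less.prems(2) in \<open>auto simp: \<alpha>_def nat_mono\<close>)
    \<comment> \<open>Once sorted, a content of total \<open>N\<close> has at most \<open>N\<close>
      nonzero entries, so its length shrinks from \<open>m\<close> to \<open>L\<close> and the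
      determinant of size \<open>L\<close> applies.\<close>
    have \<alpha>0: "\<alpha> i = 0" if "i \<ge> L" for i using partitions_zero[OF \<alpha>] that assms(1) by simp
    have bal: "balanced L N (shifted L \<alpha>)" by (rule balanced_shifted[OF \<alpha> \<alpha>0])
    let ?b = "\<lambda>w i. shifted L \<alpha> i - del L (w i)"
    have summand: "int_span L N (phi N (?b w))" if w: "w permutes {..<L}" "w \<noteq> id" for w
    proof (cases "\<exists>i. ?b w i < 0")
      case True
      then obtain i where "?b w i < 0" by blast
      then show ?thesis by (intro int_span_cong[OF int_span_zero] phi_negative)
    next
      case False
      have out: "?b w i = 0" if "i \<ge> L" for i using balanced_minus_del_outside[OF bal w(1)] that by simp
      have "(\<Sum>i<m. f i) = (\<Sum>i<L. f i)" if "\<And>i. i \<ge> L \<Longrightarrow> f i = 0" for f :: "nat \<Rightarrow> int"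
        using assms(2) that by (intro sum.mono_neutral_right) auto
      note restrict_sum = this
      have s: "(\<Sum>i<m. ?b w i) = int N"
      proof -
        have "(\<Sum>i<m. ?b w i) = (\<Sum>i<L. ?b w i)" by (rule restrict_sum) (rule out)
        also have "\<dots> = int N" by (rule balanced_minus_del_sum[OF bal w(1)])
        finally show ?thesis .
      qed
      have "(\<Sum>i<m. int i * ?b w i) = (\<Sum>i<L. int i * ?b w i)" by (rule restrict_sum) (simp add: out)
      also have "\<dots> = (\<Sum>i<L. int i * a i) + (\<Sum>i<L. int i * (del L i - del L (w i)))"
        by (simp add: shifted_def a algebra_simps sum.distrib sum_subtractf)
      also have "(\<Sum>i<L. int i * a i) = (\<Sum>i<m. int i * a i)"
        by (rule restrict_sum[symmetric]) (simp add: a \<alpha>0)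
      finally have lt: "(\<Sum>i<m. int i * ?b w i) < (\<Sum>i<m. int i * a i)" using weighted_sum_del[OF w] by simp
      have nn: "?b w i \<ge> 0" for i using False by (simp add: not_less)
      then have "(\<Sum>i<m. int i * ?b w i) \<ge> 0" by (intro sum_nonneg mult_nonneg_nonneg) auto
      then show ?thesis using lt nn s out assms(2) by (intro less.IH) auto
    qed
    \<comment> \<open>The determinant is solved for its term at the identity, which is
      \<open>phi N a\<close>; the induction hypothesis covers the others.\<close>
    have "phi N a \<sigma> = psi L N (shifted L \<alpha>) \<sigma> + (\<Sum>w\<in>rowperms L - {id}. - sign w * phi N (?b w) \<sigma>)" for \<sigma>
    proof -
      have "?b id = a" by (simp add: shifted_def a fun_eq_iff)
      then have "psi L N (shifted L \<alpha>) \<sigma> = phi N a \<sigma> + (\<Sum>w\<in>rowperms L - {id}. sign w * phi N (?b w) \<sigma>)"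
        unfolding psi_def by (subst sum.remove[of _ id]) (simp_all add: permutes_id)
      then show ?thesis by (simp add: sum_negf)
    qed
    moreover have "int_span L N (\<lambda>\<sigma>. psi L N (shifted L \<alpha>) \<sigma> + (\<Sum>w\<in>rowperms L - {id}. - sign w * phi N (?b w) \<sigma>))"
      using summand by (intro int_span_add int_span_psi[OF \<alpha>] int_span_sum int_span_scale) auto
    ultimately show ?thesis by (auto intro: int_span_cong)
  qed
qed

text \<open>The product is a sum of \<open>phi\<close> over tables. A table is a content indexed by
  pairs, and numbering the pairs makes \<open>int_span_phi\<close> applicable.\<close>

lemma int_span_phi_times_phi:
  assumes L: "N \<le> L" and a: "\<And>i. i \<notin> {..<L} \<Longrightarrow> a i = 0" "(\<Sum>i<L. a i) = int N" and b: "\<And>i. i \<notin> {..<L} \<Longrightarrow> b i = 0"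
  shows "int_span L N (\<lambda>\<sigma>. phi N a \<sigma> * phi N b \<sigma>)"
proof -
  let ?S = "{..<L} \<times> {..<L}"
  have "int_span L N (phi N M)" if M: "M \<in> tables {..<L} {..<L} a b" for M
  proof -
    let ?b = "M \<circ> prod_decode"
    \<comment> \<open>Large enough to exceed the codes of all pairs and to be at least
      \<open>L\<close>; \<open>insert 0\<close> keeps \<open>Max\<close> meaningful if there are no
      pairs.\<close>
    define m where "m = L + Suc (Max (insert 0 (prod_encode ` ?S)))"
    have in_m: "prod_encode ` ?S \<subseteq> {..<m}"
    proof
      fix x assume "x \<in> prod_encode ` ?S"
      then have "x \<le> Max (insert 0 (prod_encode ` ?S))" by (intro Max_ge) auto
      then show "x \<in> {..<m}" by (simp add: m_def)
    qed
    have out: "?b i = 0" if "i \<notin> prod_encode ` ?S" for i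
    proof -
      have "prod_decode i \<notin> ?S" using that by (metis image_eqI prod_decode_inverse)
      then have "M (prod_decode i) = 0" using M unfolding tables_def by blast
      then show ?thesis by simp
    qed
    have "(\<Sum>i<m. ?b i) = (\<Sum>i\<in>prod_encode ` ?S. ?b i)"
      using in_m out by (intro sum.mono_neutral_right) auto
    also have "\<dots> = (\<Sum>x\<in>?S. M x)"
      by (subst sum.reindex) (simp_all add: inj_prod_encode)
    also have "\<dots> = int N" using sum_tables[OF M] a(2) by simp
    finally have s: "(\<Sum>i<m. ?b i) = int N" .
    have "int_span L N (phi N ?b)"
    proof (rule int_span_phi[OF L])
      show "L \<le> m" by (simp add: m_def)
      show "?b i \<ge> 0" for i using M unfolding tables_def comp_def by blast
      show "?b i = 0" if "i \<ge> m" for i using that in_m by (intro out) auto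
    qed (rule s)
    then show ?thesis by (rule int_span_cong) (simp add: phi_bij bij_prod_decode)
  qed
  then have "int_span L N (\<lambda>\<sigma>. \<Sum>M\<in>tables {..<L} {..<L} a b. phi N M \<sigma>)" by (rule int_span_sum)
  then show ?thesis
  proof (rule int_span_cong)
    fix \<sigma> assume "\<sigma> \<in> perms N"
    then show "phi N a \<sigma> * phi N b \<sigma> = (\<Sum>M\<in>tables {..<L} {..<L} a b. phi N M \<sigma>)"
      using phi_times_phi[of "{..<L}" a "{..<L}" b \<sigma> N] a(1) b by blast
  qed
qed

lemma int_span_psi_times_psi:
  assumes L: "N \<le> L" and a: "balanced L N a" and b: "balanced L N b"
  shows "int_span L N (\<lambda>\<sigma>. psi L N a \<sigma> * psi L N b \<sigma>)"
proof -
  have "psi L N a \<sigma> * psi L N b \<sigma> = (\<Sum>u\<in>rowperms L. \<Sum>v\<in>rowperms L. sign u * sign v *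
     (phi N (\<lambda>i. a i - del L (u i)) \<sigma> * phi N (\<lambda>i. b i - del L (v i)) \<sigma>))" for \<sigma>
    by (simp add: psi_def sum_product algebra_simps)
  moreover have "int_span L N (\<lambda>\<sigma>. \<Sum>u\<in>rowperms L. \<Sum>v\<in>rowperms L. sign u * sign v *
     (phi N (\<lambda>i. a i - del L (u i)) \<sigma> * phi N (\<lambda>i. b i - del L (v i)) \<sigma>))"
  proof (intro int_span_sum int_span_scale)
    fix u v assume "u \<in> rowperms L" "v \<in> rowperms L"
    then have u: "u permutes {..<L}" and v: "v permutes {..<L}" by auto
    show "int_span L N (\<lambda>\<sigma>. phi N (\<lambda>i. a i - del L (u i)) \<sigma> * phi N (\<lambda>i. b i - del L (v i)) \<sigma>)"
      by (rule int_span_phi_times_phi[OF L balanced_minus_del_outside[OF a u] balanced_minus_del_sum[OF a u]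
        balanced_minus_del_outside[OF b v]])
  qed
  ultimately show ?thesis by (auto intro: int_span_cong)
qed

lemma sum_combination_times_psi:
  assumes L: "N \<le> L" and \<gamma>: "\<gamma> \<in> partitions N"
    and f: "\<And>\<sigma>. \<sigma> \<in> perms N \<Longrightarrow> f \<sigma> = (\<Sum>\<delta>\<in>partitions N. c \<delta> * psi L N (shifted L \<delta>) \<sigma>)"
  shows "(\<Sum>\<sigma>\<in>perms N. f \<sigma> * psi L N (shifted L \<gamma>) \<sigma>) = fact N * c \<gamma>"
proof -
  have "(\<Sum>\<sigma>\<in>perms N. f \<sigma> * psi L N (shifted L \<gamma>) \<sigma>) =
    (\<Sum>\<sigma>\<in>perms N. \<Sum>\<delta>\<in>partitions N. c \<delta> * (psi L N (shifted L \<delta>) \<sigma> * psi L N (shifted L \<gamma>) \<sigma>))"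
    by (simp add: f sum_distrib_right mult.assoc)
  also have "\<dots> = (\<Sum>\<delta>\<in>partitions N. \<Sum>\<sigma>\<in>perms N. c \<delta> * (psi L N (shifted L \<delta>) \<sigma> * psi L N (shifted L \<gamma>) \<sigma>))"
    by (rule sum.swap)
  also have "\<dots> = (\<Sum>\<delta>\<in>partitions N. c \<delta> * (\<Sum>\<sigma>\<in>perms N. psi L N (shifted L \<delta>) \<sigma> * psi L N (shifted L \<gamma>) \<sigma>))"
    by (simp only: sum_distrib_left)
  also have "\<dots> = (\<Sum>\<delta>\<in>partitions N. c \<delta> * (fact N * of_bool (\<delta> = \<gamma>)))"
    using sum_psi_orthonormal[OF L _ \<gamma>] by (intro sum.cong) auto
  also have "\<dots> = (\<Sum>\<delta>\<in>partitions N. if \<delta> = \<gamma> then fact N * c \<delta> else 0)"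
    by (intro sum.cong) auto
  also have "\<dots> = fact N * c \<gamma>" using \<gamma> by simp
  finally show ?thesis .
qed

text \<open>The average is the dimension of the invariants in the tensor product of three matrix
  representations.\<close>

lemma sum_irr_char_triple_Nats:
  assumes "\<alpha> \<in> partitions N" "\<beta> \<in> partitions N" "\<gamma> \<in> partitions N"
  shows "(\<Sum>\<sigma>\<in>perms N. irr_char \<alpha> \<sigma> * irr_char \<beta> \<sigma> * irr_char \<gamma> \<sigma>) / fact N \<in> \<nat>"
proof -
  obtain I :: "((nat \<Rightarrow> nat) \<Rightarrow> complex) set" and R where R: "mat_rep N I R"
    "\<And>\<sigma>. \<sigma> \<in> perms N \<Longrightarrow> irr_char \<alpha> \<sigma> = (\<Sum>i\<in>I. R \<sigma> i i)"
    using partition_of.irr_char_mat_rep[OF partition_of.intro[OF assms(1)]] by metis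
  obtain J :: "((nat \<Rightarrow> nat) \<Rightarrow> complex) set" and S where S: "mat_rep N J S"
    "\<And>\<sigma>. \<sigma> \<in> perms N \<Longrightarrow> irr_char \<beta> \<sigma> = (\<Sum>i\<in>J. S \<sigma> i i)"
    using partition_of.irr_char_mat_rep[OF partition_of.intro[OF assms(2)]] by metis
  obtain K :: "((nat \<Rightarrow> nat) \<Rightarrow> complex) set" and T where T: "mat_rep N K T"
    "\<And>\<sigma>. \<sigma> \<in> perms N \<Longrightarrow> irr_char \<gamma> \<sigma> = (\<Sum>i\<in>K. T \<sigma> i i)"
    using partition_of.irr_char_mat_rep[OF partition_of.intro[OF assms(3)]] by metis
  let ?RS = "\<lambda>\<sigma> x y. R \<sigma> (fst x) (fst y) * S \<sigma> (snd x) (snd y)"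
  have "(\<Sum>\<sigma>\<in>perms N. irr_char \<alpha> \<sigma> * irr_char \<beta> \<sigma> * irr_char \<gamma> \<sigma>) =
    (\<Sum>\<sigma>\<in>perms N. \<Sum>x\<in>(I \<times> J) \<times> K. ?RS \<sigma> (fst x) (fst x) * T \<sigma> (snd x) (snd x))"
  proof (rule sum.cong)
    fix \<sigma> assume s: "\<sigma> \<in> perms N"
    have "(\<Sum>x\<in>(I \<times> J) \<times> K. ?RS \<sigma> (fst x) (fst x) * T \<sigma> (snd x) (snd x)) =
      (\<Sum>x\<in>I \<times> J. ?RS \<sigma> x x) * (\<Sum>i\<in>K. T \<sigma> i i)"
      by (rule sum_diagonal_times)
    also have "\<dots> = irr_char \<alpha> \<sigma> * irr_char \<beta> \<sigma> * irr_char \<gamma> \<sigma>"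
      unfolding sum_diagonal_times R(2)[OF s] S(2)[OF s] T(2)[OF s] ..
    finally show "irr_char \<alpha> \<sigma> * irr_char \<beta> \<sigma> * irr_char \<gamma> \<sigma> =
      (\<Sum>x\<in>(I \<times> J) \<times> K. ?RS \<sigma> (fst x) (fst x) * T \<sigma> (snd x) (snd x))" by simp
  qed simp
  then show ?thesis
    using mat_rep_average_trace[OF mat_rep_times[OF mat_rep_times[OF R(1) S(1)] T(1)]] by simp
qed

text \<open>The product has integer coefficients \<open>c\<close> by triangularity, they are
  nonnegative as dimensions of invariants, and orthonormality recovers \<open>c \<gamma>\<close>
  from any decomposition; this settles the description in \<open>char_multiplicity\<close>.
  \<open>L\<close> stays a parameter so that coefficients of different degree can be compared at the
  same \<open>L\<close>.\<close>

lemma kronecker_eq_triple: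
  assumes \<alpha>: "\<alpha> \<in> partitions N" and \<beta>: "\<beta> \<in> partitions N" and \<gamma>: "\<gamma> \<in> partitions N"
    and L: "N \<le> L" "L > 0"
  shows "int (kronecker \<alpha> \<beta> \<gamma>) = triple L (shifted L \<alpha>) (shifted L \<beta>) (shifted L \<gamma>)"
proof -
  let ?p = "\<lambda>\<delta>. psi L N (shifted L \<delta>)"
  have irr: "irr_char \<delta> \<sigma> = of_int (?p \<delta> \<sigma>)" if "\<delta> \<in> partitions N" "\<sigma> \<in> perms N" for \<delta> \<sigma>
    using partition_of.irr_char_eq_psi[OF partition_of.intro[OF that(1)] L(1) that(2)] .
  have bal: "balanced L N (shifted L \<delta>)" if "\<delta> \<in> partitions N" for \<delta>
    using partitions_zero[OF that] L(1) by (intro balanced_shifted[OF that]) simp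
  have "int_span L N (\<lambda>\<sigma>. ?p \<alpha> \<sigma> * ?p \<beta> \<sigma>)"
    by (rule int_span_psi_times_psi[OF L(1) bal[OF \<alpha>] bal[OF \<beta>]])
  then obtain c where c: "\<And>\<sigma>. \<sigma> \<in> perms N \<Longrightarrow> ?p \<alpha> \<sigma> * ?p \<beta> \<sigma> = (\<Sum>\<delta>\<in>partitions N. c \<delta> * ?p \<delta> \<sigma>)"
    unfolding int_span_def by blast
  have sum_c: "(\<Sum>\<sigma>\<in>perms N. ?p \<alpha> \<sigma> * ?p \<beta> \<sigma> * ?p \<delta> \<sigma>) = fact N * c \<delta>" if "\<delta> \<in> partitions N" for \<delta>
    by (rule sum_combination_times_psi[OF L(1) that c])
  have c_nonneg: "c \<delta> \<ge> 0" if \<delta>: "\<delta> \<in> partitions N" for \<delta>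
  proof -
    have "(\<Sum>\<sigma>\<in>perms N. irr_char \<alpha> \<sigma> * irr_char \<beta> \<sigma> * irr_char \<delta> \<sigma>) = of_int (\<Sum>\<sigma>\<in>perms N. ?p \<alpha> \<sigma> * ?p \<beta> \<sigma> * ?p \<delta> \<sigma>)"
      by (simp add: irr \<alpha> \<beta> \<delta>)
    also have "\<dots> = fact N * of_int (c \<delta>)" by (simp only: sum_c[OF \<delta>] of_int_mult of_int_fact)
    finally have "(\<Sum>\<sigma>\<in>perms N. irr_char \<alpha> \<sigma> * irr_char \<beta> \<sigma> * irr_char \<delta> \<sigma>) / fact N = of_int (c \<delta>)"
      by (simp only: nonzero_mult_div_cancel_left[OF fact_nonzero])
    with sum_irr_char_triple_Nats[OF \<alpha> \<beta> \<delta>] have "(of_int (c \<delta>) :: complex) \<in> \<nat>" by (simp only:)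
    then obtain m where "(of_int (c \<delta>) :: complex) = of_nat m" by (auto simp: Nats_def)
    then have "(of_int (c \<delta>) :: complex) = of_int (int m)" by simp
    then have "c \<delta> = int m" by (simp only: of_int_eq_iff)
    then show ?thesis by simp
  qed
  let ?P = "\<lambda>d m. m \<gamma> = d \<and> (\<forall>\<sigma>. \<sigma> permutes {1..N} \<longrightarrow>
    irr_char \<alpha> \<sigma> * irr_char \<beta> \<sigma> = (\<Sum>\<delta>\<in>partitions N. of_nat (m \<delta>) * irr_char \<delta> \<sigma>))"
  have decomposition: "irr_char \<alpha> \<sigma> * irr_char \<beta> \<sigma> = (\<Sum>\<delta>\<in>partitions N. of_nat (m \<delta>) * irr_char \<delta> \<sigma>) \<longleftrightarrow>
      ?p \<alpha> \<sigma> * ?p \<beta> \<sigma> = (\<Sum>\<delta>\<in>partitions N. int (m \<delta>) * ?p \<delta> \<sigma>)" if s: "\<sigma> \<in> perms N" for m \<sigma>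
  proof -
    have "(\<Sum>\<delta>\<in>partitions N. of_nat (m \<delta>) * irr_char \<delta> \<sigma>) = of_int (\<Sum>\<delta>\<in>partitions N. int (m \<delta>) * ?p \<delta> \<sigma>)"
      using irr s by simp
    moreover have "irr_char \<alpha> \<sigma> * irr_char \<beta> \<sigma> = of_int (?p \<alpha> \<sigma> * ?p \<beta> \<sigma>)" using irr s \<alpha> \<beta> by simp
    ultimately show ?thesis by (simp only: of_int_eq_iff)
  qed
  have "(THE d. \<exists>m. ?P d m) = nat (c \<gamma>)"
  proof (rule the_equality)
    have "?P (nat (c \<gamma>)) (\<lambda>\<delta>. nat (c \<delta>))"
    proof (intro conjI allI impI refl)
      fix \<sigma> assume "\<sigma> permutes {1..N}"
      then have s: "\<sigma> \<in> perms N" by (simp add: perms_def)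
      have "(\<Sum>\<delta>\<in>partitions N. int (nat (c \<delta>)) * ?p \<delta> \<sigma>) = (\<Sum>\<delta>\<in>partitions N. c \<delta> * ?p \<delta> \<sigma>)"
        using c_nonneg by (intro sum.cong) auto
      then show "irr_char \<alpha> \<sigma> * irr_char \<beta> \<sigma> = (\<Sum>\<delta>\<in>partitions N. of_nat (nat (c \<delta>)) * irr_char \<delta> \<sigma>)"
        unfolding decomposition[OF s] c[OF s] by simp
    qed
    then show "\<exists>m. ?P (nat (c \<gamma>)) m" by (rule exI[of _ "\<lambda>\<delta>. nat (c \<delta>)"])
  next
    fix d assume "\<exists>m. ?P d m"
    then obtain m where m: "m \<gamma> = d" "\<And>\<sigma>. \<sigma> \<in> perms N \<Longrightarrow>
      irr_char \<alpha> \<sigma> * irr_char \<beta> \<sigma> = (\<Sum>\<delta>\<in>partitions N. of_nat (m \<delta>) * irr_char \<delta> \<sigma>)"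
      unfolding perms_def by blast
    have "(\<Sum>\<sigma>\<in>perms N. ?p \<alpha> \<sigma> * ?p \<beta> \<sigma> * ?p \<gamma> \<sigma>) = fact N * int (m \<gamma>)"
      using m(2) decomposition by (intro sum_combination_times_psi[OF L(1) \<gamma>]) blast
    then have "c \<gamma> = int (m \<gamma>)" using sum_c[OF \<gamma>] by simp
    then show "d = nat (c \<gamma>)" using m(1) by simp
  qed
  then have "kronecker \<alpha> \<beta> \<gamma> = nat (c \<gamma>)"
    unfolding kronecker_def char_multiplicity_def partitions_psize[OF \<gamma>] .
  then have "int (kronecker \<alpha> \<beta> \<gamma>) = c \<gamma>" using c_nonneg[OF \<gamma>] by simp
  moreover have "fact N * c \<gamma> = fact N * triple L (shifted L \<alpha>) (shifted L \<beta>) (shifted L \<gamma>)"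
    using sum_c[OF \<gamma>] sum_psi_times_psi_times_psi[OF L(2) bal[OF \<alpha>] bal[OF \<beta>] bal[OF \<gamma>]] by simp
  ultimately show ?thesis by simp
qed

lemma partitions_add_rectangle:
  assumes "\<alpha> \<in> partitions n" shows "\<alpha> + rectangle t k \<in> partitions (n + t * k)"
proof (rule partitionsI[where L = "n + k"])
  show "(\<alpha> + rectangle t k) j \<le> (\<alpha> + rectangle t k) i" if "i \<le> j" for i j
    using partitions_antimono[OF assms that] that by (simp add: rectangle_def)
  show "(\<alpha> + rectangle t k) i = 0" if "i \<ge> n + k" for i
    using partitions_zero[OF assms, of i] that by (simp add: rectangle_def)
  have "(\<Sum>i<n + k. rectangle t k i) = (\<Sum>i<k. t)"
    unfolding rectangle_def by (rule sum.mono_neutral_cong_right) auto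
  moreover have "(\<Sum>i<n + k. \<alpha> i) = n"
    using partitions_zero[OF assms] by (intro partitions_sum[OF assms]) simp
  ultimately show "(\<Sum>i<n + k. (\<alpha> + rectangle t k) i) = n + t * k"
    by (simp add: sum.distrib mult.commute)
qed

theorem theorem4p1:
  fixes lam mu nu :: parts and n s k t :: nat
  assumes "lam \<in> partitions n" and "mu \<in> partitions n" and "nu \<in> partitions n"
    and "lam 0 \<le> mu 0" and "mu 0 \<le> nu 0"
    and "s = n - nu 0"
    and "k \<ge> 1"
    and "min (lam (k - 1)) (mu (k - 1)) \<ge> max (lam k) (mu k) + s"
  shows "kronecker lam mu nu =
    kronecker (lam + rectangle t k) (mu + rectangle t k) (nu + one_part (t * k))"
proof -
  \<comment> \<open>One determinant size for both sides: at least the two degrees \<open>n\<close>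
    and \<open>n + t * k\<close>, and greater than \<open>k\<close> so that row \<open>k\<close>
    lies inside the determinant.\<close>
  define L where "L = n + t * k + k + 1"
  have L: "n \<le> L" "k < L" "n + t * k \<le> L" "L > 0" by (simp_all add: L_def)
  have nu': "nu + one_part (t * k) \<in> partitions (n + t * k)"
    using partitions_add_rectangle[OF assms(3), of "t * k" 1] by simp
  have "int (kronecker (lam + rectangle t k) (mu + rectangle t k) (nu + one_part (t * k))) =
    triple L (raise t k (shifted L lam)) (raise t k (shifted L mu)) (raise (t * k) 1 (shifted L nu))"
    unfolding shifted_add_rectangle[symmetric]
    by (rule kronecker_eq_triple[OF partitions_add_rectangle[OF assms(1)] partitions_add_rectangle[OF assms(2)] nu' L(3,4)])
  also have "\<dots> = triple L (shifted L lam) (shifted L mu) (shifted L nu)"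
    using assms(8) unfolding assms(6) by (rule triple_raise[OF assms(1-3) L(1,2) assms(7)])
  also have "\<dots> = int (kronecker lam mu nu)"
    by (rule kronecker_eq_triple[OF assms(1-3) L(1,4), symmetric])
  finally show ?thesis by simp
qed

end
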